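(* Let $L$ be a binary $\mathbb{Z}$-lattice on a positive definite quadratic space $V$ over $\mathbb{Q}$ such that $D=-4d_L$ is the discriminant of the imaginary quadratic field $F=\mathbb{Q}(\sqrt{-4d_L})$. Write $Q_L(x,y)=ax^2+bxy+cy^2$ ($a,b,c\in\mathbb{Z}$, $a>0$) for the quadratic form of $L$ in some basis and let $I=\mathbb{Z}a+\mathbb{Z}\frac{b-\sqrt{D}}{2}$, a fractional ideal of $\mathcal{O}_F$. Then \[\zeta^{\mathrm{GL}}_L(s)=\mathrm{Rot}_L(s)+\mathrm{Refl}_L(s),\qquad \mathrm{Refl}_L(s):=\sum_{\rho\in O(V)\setminus O^+(V)}Z_{L,\rho}(s),\] where \[ \mathrm{Rot}_L(s)=\frac{1}{2} \zeta^{\mathrm{SL}}_L(s) + \frac{\zeta(s)\zeta(s-1)}{2\zeta_{F}(s)} \sum_{n=1}^{\infty} \frac{\# \left( \{ [J]\in \mathrm{Cl}_F : |I : J|=n \} \setminus \{ [\overline{J}]\in \mathrm{Cl}_F : |I : J|=n \} \right)}{n^s}, \] with $J$ ranging over $\mathcal{O}_F$-ideals contained in $I$ and $\overline{J}$ the complex conjugate of $J$.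
   Context: $V$ is a positive definite quadratic space over $\mathbb{Q}$ with bilinear form $B$; a $\mathbb{Z}$-lattice $L$ on $V$ is the $\mathbb{Z}$-span of a basis of $V$ with $Q(L)\subseteq\mathbb{Z}$, and $d_L$ is the determinant of its Gram matrix. $O(V)$ is the orthogonal group, $O^+(V)=O(V)\cap\mathrm{SL}(V)$. $a_m^+(L)$ (resp. $a_m(L)$) is the number of classes of sublattices $K\subseteq L$ of index $m$ under $K_1\sim K_2\iff \sigma(K_1)=K_2$ for some $\sigma\in O^+(V)$ (resp. $\sigma\in O(V)$); $\zeta^{\mathrm{SL}}_L(s)=\sum_m a_m^+(L)m^{-s}$, $\zeta^{\mathrm{GL}}_L(s)=\sum_m a_m(L)m^{-s}$. For $\rho\in O(V)$ of finite order, \[Z_{L,\rho}(s)=\sum_{K\subseteq L,\ |L:K|<\infty,\ \rho(K)=K}\frac{|L:K|^{-s}}{\#\{\sigma\in O(V):\sigma(K)\subseteq L\}}.\] $\mathcal{O}_F$, $\mathrm{Cl}_F$, $[J]$, $\zeta_F$ denote ring of integers, class group, ideal class and Dedekind zeta function of $F$; $\zeta$ is the Riemann zeta function. *)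

theory Defs
  imports
    "HOL-Analysis.Analysis"
    "HOL-Computational_Algebra.Polynomial"
    "HOL-Algebra.Ideal"
begin

text \<open>The index of a subgroup \<open>K\<close> of \<open>L\<close>, with the value 0 if it is infinite.\<close>

definition index :: "'a::ab_group_add set \<Rightarrow> 'a set \<Rightarrow> nat"
  where "index L K = card ((\<lambda>x. (+) x ` K) ` L)"

class pos_def_quadratic_space = ab_group_add +
  fixes scaleQ :: "rat \<Rightarrow> 'a \<Rightarrow> 'a" (infixr "*\<^sub>Q" 75)
    and bform :: "'a \<Rightarrow> 'a \<Rightarrow> rat"
  assumes scaleQ_add_right: "r *\<^sub>Q (x + y) = r *\<^sub>Q x + r *\<^sub>Q y"
    and scaleQ_add_left: "(r + t) *\<^sub>Q x = r *\<^sub>Q x + t *\<^sub>Q x"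
    and scaleQ_scaleQ: "r *\<^sub>Q (t *\<^sub>Q x) = (r * t) *\<^sub>Q x"
    and scaleQ_one: "1 *\<^sub>Q x = x"
    and bform_sym: "bform x y = bform y x"
    and bform_add_left: "bform (x + y) z = bform x z + bform y z"
    and bform_scaleQ_left: "bform (r *\<^sub>Q x) y = r * bform x y"
    and bform_pos: "x \<noteq> 0 \<Longrightarrow> bform x x > 0"

interpretation qspace: vector_space
  "scaleQ :: rat \<Rightarrow> 'v::pos_def_quadratic_space \<Rightarrow> 'v"
  by unfold_locales
    (simp_all add: scaleQ_add_right scaleQ_add_left scaleQ_scaleQ scaleQ_one)

definition qform :: "'v::pos_def_quadratic_space \<Rightarrow> rat"
  where "qform x = bform x x"

definition plane_basis :: "'v::pos_def_quadratic_space \<Rightarrow> 'v \<Rightarrow> bool"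
  where "plane_basis e1 e2 \<longleftrightarrow>
    e1 \<noteq> e2 \<and> qspace.independent {e1, e2} \<and> qspace.span {e1, e2} = UNIV"

definition Z_span :: "'v::pos_def_quadratic_space \<Rightarrow> 'v \<Rightarrow> 'v set"
  where "Z_span e1 e2 = {of_int m *\<^sub>Q e1 + of_int n *\<^sub>Q e2 | m n. True}"

definition Z_basis :: "'v::pos_def_quadratic_space \<Rightarrow> 'v \<Rightarrow> 'v set \<Rightarrow> bool"
  where "Z_basis e1 e2 L \<longleftrightarrow> plane_basis e1 e2 \<and> L = Z_span e1 e2"

definition binary_Z_lattice :: "'v::pos_def_quadratic_space set \<Rightarrow> bool"
  where "binary_Z_lattice L \<longleftrightarrow> (\<exists>e1 e2. Z_basis e1 e2 L) \<and> qform ` L \<subseteq> \<int>"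

definition gram_matrix :: "'v::pos_def_quadratic_space \<Rightarrow> 'v \<Rightarrow> rat^2^2"
  where "gram_matrix e1 e2 = vector [vector [bform e1 e1, bform e1 e2],
                                     vector [bform e2 e1, bform e2 e2]]"

definition lattice_det :: "'v::pos_def_quadratic_space set \<Rightarrow> rat"
  where "lattice_det L = (THE d. \<exists>e1 e2. Z_basis e1 e2 L \<and> d = det (gram_matrix e1 e2))"

definition orth_group :: "('v::pos_def_quadratic_space \<Rightarrow> 'v) set"  (\<open>O\<^sub>V\<close>)
  where "O\<^sub>V = {\<sigma>. Vector_Spaces.linear scaleQ scaleQ \<sigma> \<and> bij \<sigma> \<and>
               (\<forall>x y. bform (\<sigma> x) (\<sigma> y) = bform x y)}"

text \<open>The determinant of an endomorphism of a plane is that of its matrix in any basis, so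
  the existential quantifier over bases below could equally be a universal one.\<close>

definition SL_plane :: "('v::pos_def_quadratic_space \<Rightarrow> 'v) set"
  where "SL_plane = {\<sigma>. Vector_Spaces.linear scaleQ scaleQ \<sigma> \<and>
    (\<exists>e1 e2. \<exists>A :: rat^2^2. plane_basis e1 e2 \<and>
       \<sigma> e1 = A$1$1 *\<^sub>Q e1 + A$2$1 *\<^sub>Q e2 \<and>
       \<sigma> e2 = A$1$2 *\<^sub>Q e1 + A$2$2 *\<^sub>Q e2 \<and> det A = 1)}"

definition orth_group_plus :: "('v::pos_def_quadratic_space \<Rightarrow> 'v) set"  (\<open>O\<^sub>V\<^sup>+\<close>)
  where "O\<^sub>V\<^sup>+ = O\<^sub>V \<inter> SL_plane"

definition sublattices :: "'v::pos_def_quadratic_space set \<Rightarrow> nat \<Rightarrow> 'v set set"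
  where "sublattices L m = {K. binary_Z_lattice K \<and> K \<subseteq> L \<and> index L K = m}"

definition num_classes ::
    "('v \<Rightarrow> 'v) set \<Rightarrow> 'v::pos_def_quadratic_space set \<Rightarrow> nat \<Rightarrow> nat"
  where "num_classes G L m = card (sublattices L m //
    {(K1, K2). K1 \<in> sublattices L m \<and> K2 \<in> sublattices L m \<and> (\<exists>\<sigma>\<in>G. \<sigma> ` K1 = K2)})"

definition zeta_GL :: "'v::pos_def_quadratic_space set \<Rightarrow> complex \<Rightarrow> complex"
  where "zeta_GL L s = (\<Sum>\<^sub>\<infinity>m\<in>{1..}. of_nat (num_classes O\<^sub>V L m) * of_nat m powr (- s))"

definition zeta_SL :: "'v::pos_def_quadratic_space set \<Rightarrow> complex \<Rightarrow> complex"
  where "zeta_SL L s = (\<Sum>\<^sub>\<infinity>m\<in>{1..}. of_nat (num_classes O\<^sub>V\<^sup>+ L m) * of_nat m powr (- s))"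

text \<open>The condition \<open>index L K > 0\<close> expresses that the index is finite.\<close>

definition Z_aut ::
    "'v::pos_def_quadratic_space set \<Rightarrow> ('v \<Rightarrow> 'v) \<Rightarrow> complex \<Rightarrow> complex"
  where "Z_aut L \<rho> s =
    (\<Sum>\<^sub>\<infinity>K\<in>{K. binary_Z_lattice K \<and> K \<subseteq> L \<and> index L K > 0 \<and> \<rho> ` K = K}.
       of_nat (index L K) powr (- s) / of_nat (card {\<sigma>\<in>O\<^sub>V. \<sigma> ` K \<subseteq> L}))"

definition zeta_Refl :: "'v::pos_def_quadratic_space set \<Rightarrow> complex \<Rightarrow> complex"
  where "zeta_Refl L s = (\<Sum>\<^sub>\<infinity>\<rho>\<in>O\<^sub>V - O\<^sub>V\<^sup>+. Z_aut L \<rho> s)"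

text \<open>Number fields are subfields of the complex numbers. For negative \<open>D\<close>, the principal root
  \<open>csqrt (of_int D)\<close> is the square root with positive imaginary part.\<close>

definition quadratic_field :: "int \<Rightarrow> complex set"
  where "quadratic_field D = {of_rat x + of_rat y * csqrt (of_int D) | x y. True}"

definition integers :: "complex set \<Rightarrow> complex set"  (\<open>\<O>\<close>)
  where "\<O> F = {x \<in> F. algebraic_int x}"

definition integer_ring :: "complex set \<Rightarrow> complex ring"
  where "integer_ring F =
    \<lparr>carrier = \<O> F, monoid.mult = (*), one = 1, zero = 0, add = (+)\<rparr>"

text \<open>The discriminant of an imaginary quadratic field, whose two embeddings into the complex
  numbers are the inclusion and complex conjugation.\<close>

definition is_discriminant :: "int \<Rightarrow> complex set \<Rightarrow> bool"
  where "is_discriminant D F \<longleftrightarrow> (\<exists>\<omega>1 \<omega>2.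
    bij_betw (\<lambda>(m, n). of_int m * \<omega>1 + of_int n * \<omega>2) (UNIV :: (int \<times> int) set) (\<O> F) \<and>
    of_int D = (det (vector [vector [\<omega>1, \<omega>2], vector [cnj \<omega>1, cnj \<omega>2]] :: complex^2^2))\<^sup>2)"

definition fractional_ideal :: "complex set \<Rightarrow> complex set \<Rightarrow> bool"
  where "fractional_ideal F J \<longleftrightarrow>
    J \<noteq> {0} \<and> (\<exists>d\<in>\<O> F - {0}. ideal ((*) d ` J) (integer_ring F))"

definition ideal_equiv :: "complex set \<Rightarrow> (complex set \<times> complex set) set"
  where "ideal_equiv F = {(J1, J2). fractional_ideal F J1 \<and> fractional_ideal F J2 \<and>
    (\<exists>\<alpha>\<in>F - {0}. J2 = (*) \<alpha> ` J1)}"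

definition class_group :: "complex set \<Rightarrow> complex set set set"
  where "class_group F = {J. fractional_ideal F J} // ideal_equiv F"

definition ideal_class :: "complex set \<Rightarrow> complex set \<Rightarrow> complex set set"
  where "ideal_class F J = ideal_equiv F `` {J}"

text \<open>Both zeta functions are given by their series, so they have the right value only for
  real part greater than 1.\<close>

definition riemann_zeta :: "complex \<Rightarrow> complex"
  where "riemann_zeta s = (\<Sum>\<^sub>\<infinity>n\<in>{1..}. of_nat n powr (- s))"

definition dedekind_zeta :: "complex set \<Rightarrow> complex \<Rightarrow> complex"
  where "dedekind_zeta F s =
    (\<Sum>\<^sub>\<infinity>J\<in>{J. ideal J (integer_ring F) \<and> J \<noteq> {0}}. of_nat (index (\<O> F) J) powr (- s))"

end

theory Submission
  imports Defs
begin

text \<open>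
  The norm form identifies the lattice \<open>L\<close> with the ideal \<open>I\<close> of the maximal order \<open>O\<close>; rotations become
  multiplications by elements of norm 1, and reflections these composed with complex conjugation.
  Counting an orbit through its stabiliser, the number of classes of sublattices of index \<open>m\<close> is the
  sum over these sublattices \<open>K\<close> of the order of the stabiliser of \<open>K\<close>, divided by the number
  of isometries that map \<open>K\<close> into \<open>L\<close>. The reflections in the stabilisers give the reflection part.

  Let \<open>n\<^sub>1\<close> and \<open>n\<^sub>2\<close> be the numbers of rotations and reflections that map \<open>K\<close> into \<open>L\<close>. The rotations in the
  stabilisers contribute half of the \<open>SL\<close> count plus an excess, in which the stabiliser of \<open>K\<close> has the
  weight \<open>1 / (n\<^sub>1 + n\<^sub>2) - 1 / (2 n\<^sub>1)\<close>. Both numbers depend only on the ideal \<open>J = O K\<close>. If \<open>D < -4\<close>, the only units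
  are 1 and -1, and \<open>n\<^sub>1\<close> and \<open>n\<^sub>2\<close> are twice the numbers of ideals of the index of \<open>J\<close> in the class of \<open>J\<close> and in
  the conjugate class; so the excesses of two conjugate classes cancel unless only one of them occurs.
  If \<open>D \<ge> -4\<close>, the order is Euclidean, every ideal is a rotation of its conjugate, and there is no excess.

  The number of subgroups \<open>K\<close> of index \<open>k\<close> in \<open>J\<close> with \<open>O K = J\<close> does not depend on \<open>J\<close>, because \<open>J\<close> is principal
  modulo \<open>k\<close>. The Dirichlet series of these numbers, multiplied by the Dedekind zeta function, counts all
  subgroups of finite index of \<open>O\<close>, hence it is \<open>\<zeta>(s) \<zeta>(s - 1) / \<zeta>\<^sub>F(s)\<close>.
\<close>

section \<open>Subgroups and their indices\<close>

text \<open>The orthogonal group is infinite, so an orbit has to be counted through the finite set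
  of isometries that map \<open>K\<close> into \<open>L\<close>. The excess weight is the weight
  \<open>1 / (n1 + n2)\<close> for all isometries minus half of the weight \<open>1 / n1\<close> for
  rotations alone. The order of the stabiliser is the obstacle: units of the order fix every ideal,
  but need not fix a subgroup \<open>K\<close> that spans it. For \<open>D < -4\<close> the order is
  always 2; for the other discriminants, -3 and -4, the weight itself vanishes. The order is maximal
  because the discriminant hypothesis forces the covolumes of the order and of the ring of integers
  to agree. Maximality makes ideals principal modulo \<open>k\<close>, and puts the multipliers of a
  lattice into the order. Every coefficient is at most the number of all subgroups of index
  \<open>m\<close>, a divisor sum, whose series converges absolutely for \<open>Re s > 2\<close>;
  this allows all rearrangements. Division by the Dedekind zeta function is legitimate because it is
  a factor of \<zeta>(s) \<zeta>(s - 1), which does not vanish.\<close>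

definition subgrp :: "'a::ab_group_add set \<Rightarrow> bool"
  where "subgrp H \<longleftrightarrow> 0 \<in> H \<and> (\<forall>x\<in>H. \<forall>y\<in>H. x - y \<in> H)"

lemma subgrp_zero: "subgrp H \<Longrightarrow> 0 \<in> H"
  and subgrp_diff: "subgrp H \<Longrightarrow> x \<in> H \<Longrightarrow> y \<in> H \<Longrightarrow> x - y \<in> H"
  by (auto simp: subgrp_def)

lemma subgrp_minus: "subgrp H \<Longrightarrow> x \<in> H \<Longrightarrow> - x \<in> H"
  using subgrp_diff[of H 0 x] subgrp_zero[of H] by simp

lemma subgrp_add: "subgrp H \<Longrightarrow> x \<in> H \<Longrightarrow> y \<in> H \<Longrightarrow> x + y \<in> H"
  using subgrp_diff[of H x "- y"] subgrp_minus[of H y] by simp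

lemma subgrp_of_nat_mult: "subgrp H \<Longrightarrow> x \<in> H \<Longrightarrow> of_nat k * (x::'a::ring_1) \<in> H"
  by (induction k) (auto simp: algebra_simps intro: subgrp_zero subgrp_add)

lemma subgrp_of_int_mult: "subgrp H \<Longrightarrow> x \<in> H \<Longrightarrow> of_int k * (x::'a::ring_1) \<in> H"
  by (cases k rule: int_cases2) (auto intro: subgrp_of_nat_mult subgrp_minus)

lemma subgrp_image:
  assumes "subgrp H" "\<And>x y. f (x - y) = f x - f y"
  shows "subgrp (f ` H)"
proof -
  have "f 0 = 0" using assms(2)[of 0 0] by simp
  moreover have "f x - f y \<in> f ` H" if "x \<in> H" "y \<in> H" for x y
    using assms(2)[of x y] subgrp_diff[OF assms(1) that] by (metis imageI)
  ultimately show ?thesis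
    using subgrp_zero[OF assms(1)] by (auto simp: subgrp_def image_iff intro!: bexI[of _ 0])
qed

lemma coset_eq_iff:
  assumes "subgrp K"
  shows "(+) x ` K = (+) y ` K \<longleftrightarrow> x - y \<in> K"
proof
  assume "(+) x ` K = (+) y ` K"
  then have "x + 0 \<in> (+) y ` K" using subgrp_zero[OF assms] by blast
  then show "x - y \<in> K" by auto
next
  assume *: "x - y \<in> K"
  show "(+) x ` K = (+) y ` K"
  proof (intro equalityI subsetI)
    fix z assume "z \<in> (+) x ` K"
    then obtain k where "k \<in> K" "z = x + k" by auto
    then have "z = y + ((x - y) + k)" "(x - y) + k \<in> K"
      using * assms by (auto intro: subgrp_add)
    then show "z \<in> (+) y ` K" by blast
  next
    fix z assume "z \<in> (+) y ` K"
    then obtain k where "k \<in> K" "z = y + k" by auto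
    then have "z = x + (k - (x - y))" "k - (x - y) \<in> K"
      using * assms by (auto intro: subgrp_diff)
    then show "z \<in> (+) x ` K" by blast
  qed
qed

text \<open>Choosing a preimage under \<open>f\<close> and applying \<open>g\<close> is a bijection
  between the images. Finiteness does not enter, so indices can be compared even when they are
  infinite and count as 0.\<close>

lemma card_image_eq_kernel:
  assumes "\<And>x y. x \<in> A \<Longrightarrow> y \<in> A \<Longrightarrow> f x = f y \<longleftrightarrow> g x = g y"
  shows "card (f ` A) = card (g ` A)"
proof (rule bij_betw_same_card)
  show "bij_betw (\<lambda>z. g (inv_into A f z)) (f ` A) (g ` A)"
    unfolding bij_betw_def inj_on_def
  proof (intro conjI ballI impI)
    fix y z assume "y \<in> f ` A" "z \<in> f ` A" "g (inv_into A f y) = g (inv_into A f z)"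
    then show "y = z" using assms by (metis f_inv_into_f inv_into_into)
  next
    show "(\<lambda>z. g (inv_into A f z)) ` f ` A = g ` A"
    proof -
      have "g (inv_into A f (f x)) = g x" if "x \<in> A" for x
        using assms that by (metis f_inv_into_f inv_into_into imageI)
      then show ?thesis by (auto simp: image_image)
    qed
  qed
qed

text \<open>The map \<open>f\<close> induces a bijection from \<open>L\<close> modulo
  \<open>K\<close> to \<open>L'\<close> modulo \<open>K'\<close>. It only has to be onto modulo
  \<open>K'\<close>, which is what multiplication by a generator modulo \<open>k\<close> satisfies
  in \<open>card_gens\<close>.\<close>

lemma index_transfer:
  assumes K': "subgrp K'"
    and f: "\<And>x y. f (x - y) = f x - f y"
    and fL: "f ` L \<subseteq> L'"
    and surj: "\<And>y. y \<in> L' \<Longrightarrow> \<exists>x\<in>L. y - f x \<in> K'"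
    and K: "subgrp K" "\<And>x y. x \<in> L \<Longrightarrow> y \<in> L \<Longrightarrow> x - y \<in> K \<longleftrightarrow> f (x - y) \<in> K'"
  shows "index L K = index L' K'"
proof -
  have "(\<lambda>x. (+) x ` K') ` L' = (\<lambda>x. (+) (f x) ` K') ` L"
  proof (intro equalityI subsetI)
    fix C assume "C \<in> (\<lambda>x. (+) x ` K') ` L'"
    then obtain y where y: "y \<in> L'" "C = (+) y ` K'" by auto
    then obtain x where "x \<in> L" "y - f x \<in> K'" using surj by blast
    then show "C \<in> (\<lambda>x. (+) (f x) ` K') ` L"
      using y coset_eq_iff[OF K', of y "f x"] by auto
  qed (use fL in auto)
  moreover have "card ((\<lambda>x. (+) x ` K) ` L) = card ((\<lambda>x. (+) (f x) ` K') ` L)"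
    by (rule card_image_eq_kernel) (use K f in \<open>simp add: coset_eq_iff K'\<close>)
  ultimately show ?thesis by (simp add: index_def)
qed

lemma index_image:
  assumes K: "subgrp K" and f: "\<And>x y. f (x - y) = f x - f y" and inj: "inj f"
  shows "index (f ` L) (f ` K) = index L K"
proof (rule sym, rule index_transfer[where f = f])
  show "subgrp (f ` K)" by (rule subgrp_image) (use K f in auto)
  then have 0: "0 \<in> f ` K" by (rule subgrp_zero)
  show "\<exists>x\<in>L. y - f x \<in> f ` K" if y: "y \<in> f ` L" for y
  proof -
    obtain x where "x \<in> L" "y = f x" using y by blast
    with 0 show ?thesis by (intro bexI[of _ x]) simp_all
  qed
  show "x - y \<in> K \<longleftrightarrow> f (x - y) \<in> f ` K" for x y
    using inj by (simp add: inj_image_mem_iff)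
qed (use K f in simp_all)

text \<open>With a representative \<open>r\<close> chosen in each coset of \<open>K\<close>, a coset
  of \<open>N\<close> is encoded by the coset of \<open>K\<close> around it and by the coset of
  \<open>N\<close> that contains the difference from \<open>r\<close>.\<close>

lemma index_tower:
  assumes "subgrp N" "subgrp K" "subgrp L" "N \<subseteq> K" "K \<subseteq> L"
  shows "index L N = index L K * index K N"
proof -
  define r where "r C = (SOME x. x \<in> L \<and> (+) x ` K = C)" for C
  define cL where "cL x = (+) x ` K" for x
  define cN where "cN x = (+) x ` N" for x
  have r: "r (cL x) \<in> L \<and> cL (r (cL x)) = cL x" if "x \<in> L" for x
    unfolding r_def cL_def by (rule someI_ex) (use that in auto)
  have rK: "x - r (cL x) \<in> K" if "x \<in> L" for x
    using r[OF that] coset_eq_iff[OF assms(2)] by (metis cL_def)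
  have "card (cN ` L) = card ((\<lambda>x. (cL x, cN (x - r (cL x)))) ` L)"
  proof (rule card_image_eq_kernel)
    fix x y
    have "cN x = cN y \<Longrightarrow> cL x = cL y"
      using assms by (auto simp: cN_def cL_def coset_eq_iff)
    moreover have "cN (x - z) = cN (y - z) \<longleftrightarrow> cN x = cN y" for z
      using assms by (simp add: cN_def coset_eq_iff)
    ultimately show "cN x = cN y \<longleftrightarrow> (cL x, cN (x - r (cL x))) = (cL y, cN (y - r (cL y)))"
      by auto
  qed
  also have "(\<lambda>x. (cL x, cN (x - r (cL x)))) ` L = cL ` L \<times> cN ` K"
  proof (intro equalityI subsetI)
    fix p assume "p \<in> cL ` L \<times> cN ` K"
    then obtain l k where lk: "l \<in> L" "k \<in> K" "p = (cL l, cN k)" by auto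
    define x where "x = r (cL l) + k"
    have "x \<in> L" using r[OF lk(1)] lk(2) assms by (auto simp: x_def intro: subgrp_add)
    moreover have "cL x = cL (r (cL l))"
      using lk(2) assms(2) by (simp add: cL_def coset_eq_iff x_def)
    then have "cL x = cL l" using r[OF lk(1)] by simp
    moreover from \<open>cL x = cL l\<close> have "p = (cL x, cN (x - r (cL x)))"
      using lk(3) by (simp add: x_def)
    ultimately show "p \<in> (\<lambda>x. (cL x, cN (x - r (cL x)))) ` L"
      by (intro rev_image_eqI[of x]) simp_all
  qed (use rK in auto)
  finally show ?thesis by (simp add: index_def cL_def cN_def card_cartesian_product)
qed

lemma index_eq_card_reps:
  assumes "subgrp K" "R \<subseteq> L" "\<And>x. x \<in> L \<Longrightarrow> \<exists>r\<in>R. x - r \<in> K"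
    and "\<And>r r'. r \<in> R \<Longrightarrow> r' \<in> R \<Longrightarrow> r - r' \<in> K \<Longrightarrow> r = r'"
  shows "index L K = card R"
proof -
  have "(\<lambda>x. (+) x ` K) ` L = (\<lambda>x. (+) x ` K) ` R"
    using assms(2,3) coset_eq_iff[OF assms(1)] by (fastforce simp: image_iff)
  moreover have "inj_on (\<lambda>x. (+) x ` K) R"
    using assms(4) coset_eq_iff[OF assms(1)] by (auto simp: inj_on_def)
  ultimately show ?thesis by (simp add: index_def card_image)
qed

lemma index_self: "subgrp K \<Longrightarrow> index K K = 1"
  by (subst index_eq_card_reps[where R = "{0}"]) (auto intro: subgrp_zero)

text \<open>Pigeonhole: the multiples of \<open>x\<close> fall into finitely many cosets, and two in
  the same coset differ by an element of \<open>K\<close>.\<close>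

lemma index_pos_multiple:
  fixes x :: "'a::ring_1"
  assumes K: "subgrp K" and L: "subgrp L" and pos: "index L K > 0" and x: "x \<in> L"
  shows "\<exists>k>0. of_nat k * x \<in> K"
proof -
  have "finite ((\<lambda>x. (+) x ` K) ` L)"
    using pos by (simp add: index_def card_gt_0_iff)
  moreover have "(\<lambda>k. (+) (of_nat k * x) ` K) ` UNIV \<subseteq> (\<lambda>x. (+) x ` K) ` L"
    using subgrp_of_nat_mult[OF L x] by auto
  ultimately have "finite (range (\<lambda>k::nat. (+) (of_nat k * x) ` K))"
    using finite_subset by blast
  then obtain i j :: nat where ij: "i < j" "(+) (of_nat j * x) ` K = (+) (of_nat i * x) ` K"
    by (metis (mono_tags, lifting) finite_imageD infinite_UNIV_nat inj_on_def linorder_neqE_nat)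
  then have "of_nat j * x - of_nat i * x \<in> K" by (simp add: coset_eq_iff K)
  then have "of_nat (j - i) * x \<in> K" using ij(1) by (simp add: of_nat_diff algebra_simps)
  then show ?thesis using ij(1) by (intro exI[of _ "j - i"]) auto
qed

section \<open>Lattices in the complex plane\<close>

definition Zlat :: "complex \<Rightarrow> complex \<Rightarrow> complex set"
  where "Zlat x y = {of_int i * x + of_int j * y | i j. True}"

lemma ZlatI [intro]: "of_int i * x + of_int j * y \<in> Zlat x y"
  by (auto simp: Zlat_def)

lemma ZlatE:
  assumes "z \<in> Zlat x y" obtains i j where "z = of_int i * x + of_int j * y"
  using assms by (auto simp: Zlat_def)

lemma Zlat_basis: "x \<in> Zlat x y" "y \<in> Zlat x y"
  using ZlatI[of 1 x 0 y] ZlatI[of 0 x 1 y] by auto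

lemma subgrp_Zlat: "subgrp (Zlat x y)"
  unfolding subgrp_def
proof (intro conjI ballI)
  show "0 \<in> Zlat x y" using ZlatI[of 0 x 0 y] by simp
  fix z w assume "z \<in> Zlat x y" "w \<in> Zlat x y"
  then obtain i j k l where "z = of_int i * x + of_int j * y" "w = of_int k * x + of_int l * y"
    by (elim ZlatE)
  then have "z - w = of_int (i - k) * x + of_int (j - l) * y"
    by (simp add: algebra_simps)
  then show "z - w \<in> Zlat x y" by (metis ZlatI)
qed

lemma Zlat_subset: "subgrp M \<Longrightarrow> x \<in> M \<Longrightarrow> y \<in> M \<Longrightarrow> Zlat x y \<subseteq> M"
  by (auto elim!: ZlatE intro!: subgrp_add subgrp_of_int_mult)

text \<open>The oriented area of the parallelogram on \<open>x\<close> and \<open>y\<close>. It is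
  nonzero exactly for pairs independent over the reals, and its absolute value is the covolume of
  \<open>Zlat x y\<close>.\<close>

definition cross :: "complex \<Rightarrow> complex \<Rightarrow> real"
  where "cross x y = Im (cnj x * y)"

lemma cross_comb:
  "cross (of_int p * x + of_int q * y) (of_int r * x + of_int t * y)
     = of_int (p * t - q * r) * cross x y"
  by (simp add: cross_def algebra_simps)

lemma Zlat_indep:
  assumes "cross x y \<noteq> 0" "of_int i * x + of_int j * y = of_int k * x + of_int l * y"
  shows "i = k" "j = l"
proof -
  have eq: "of_int (i - k) * x + of_int (j - l) * y = 0"
    using assms(2) by (simp add: algebra_simps)
  have "cross (of_int (i - k) * x + of_int (j - l) * y) y = of_int (i - k) * cross x y"
    using cross_comb[of "i - k" x "j - l" y 0 1] by simp
  moreover have "cross x (of_int (i - k) * x + of_int (j - l) * y) = of_int (j - l) * cross x y"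
    using cross_comb[of 1 x 0 y "i - k" "j - l"] by simp
  ultimately show "i = k" "j = l"
    using assms(1) unfolding eq by (simp_all add: cross_def)
qed

section \<open>Hermite normal forms of sublattices\<close>

lemma int_subgrp_generator:
  assumes "subgrp (H :: int set)" "k \<in> H" "k > 0"
  obtains d where "d > 0" "d \<in> H" "\<And>h. h \<in> H \<Longrightarrow> d dvd h"
proof -
  define n where "n = (LEAST n::nat. n > 0 \<and> int n \<in> H)"
  have n: "n > 0 \<and> int n \<in> H"
    unfolding n_def by (rule LeastI[of _ "nat k"]) (use assms in auto)
  have "int n dvd h" if h: "h \<in> H" for h
  proof (rule ccontr)
    assume "\<not> int n dvd h"
    then have pos: "h mod int n > 0"
      using n by (metis dvd_eq_mod_eq_0 of_nat_0_less_iff order_less_le pos_mod_sign)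
    have "h - of_int (h div int n) * int n \<in> H"
      using assms(1) h n by (intro subgrp_diff subgrp_of_int_mult) auto
    then have "int (nat (h mod int n)) \<in> H"
      using pos by (simp add: minus_div_mult_eq_mod)
    then have "n \<le> nat (h mod int n)"
      using pos Least_le[of "\<lambda>n. n > 0 \<and> int n \<in> H" "nat (h mod int n)"] by (simp add: n_def)
    then show False using n pos_mod_bound[of "int n" h] pos by linarith
  qed
  then show thesis using that[of "int n"] n by auto
qed

text \<open>Here \<open>a\<close> generates the integers \<open>i\<close> with \<open>i x\<close> in
  \<open>M\<close>, and \<open>d\<close> the integers that occur as second coordinates in
  \<open>M\<close>. The multiples of \<open>x\<close> and \<open>y\<close> in \<open>M\<close>
  ensure that neither group is zero. Reducing \<open>b\<close> modulo \<open>a\<close> makes the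
  form unique.\<close>

lemma Zlat_hnf_exists:
  assumes M: "subgrp M" "M \<subseteq> Zlat x y" and k: "k > 0" "of_int k * x \<in> M"
    and l: "l > 0" "of_int l * y \<in> M"
  obtains a b d where "a > 0" "d > 0" "0 \<le> b" "b < a"
    "M = Zlat (of_int a * x) (of_int b * x + of_int d * y)"
proof -
  define H1 where "H1 = {i::int. of_int i * x \<in> M}"
  define H2 where "H2 = {j::int. \<exists>i::int. of_int i * x + of_int j * y \<in> M}"
  have "subgrp H1"
    using M(1) by (auto simp: subgrp_def H1_def algebra_simps)
  then obtain a where a: "a > 0" "a \<in> H1" "\<And>h. h \<in> H1 \<Longrightarrow> a dvd h"
    using int_subgrp_generator[of H1 k] k by (auto simp: H1_def)
  have "subgrp H2"
    unfolding subgrp_def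
  proof (intro conjI ballI)
    show "0 \<in> H2" using subgrp_zero[OF M(1)] by (auto simp: H2_def intro!: exI[of _ 0])
    fix j j' assume "j \<in> H2" "j' \<in> H2"
    then obtain i i' where i: "of_int i * x + of_int j * y \<in> M" "of_int i' * x + of_int j' * y \<in> M"
      by (auto simp: H2_def)
    have "of_int (i - i') * x + of_int (j - j') * y \<in> M"
      using subgrp_diff[OF M(1) i] by (simp add: algebra_simps)
    then show "j - j' \<in> H2" unfolding H2_def by blast
  qed
  moreover have "l \<in> H2" using l by (auto simp: H2_def intro!: exI[of _ 0])
  ultimately obtain d where d: "d > 0" "d \<in> H2" "\<And>h. h \<in> H2 \<Longrightarrow> d dvd h"
    using int_subgrp_generator[of H2 l] l by auto
  then obtain b0 where b0: "of_int b0 * x + of_int d * y \<in> M" by (auto simp: H2_def)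
  define b where "b = b0 mod a"
  define v where "v = of_int b * x + of_int d * y"
  have aM: "of_int a * x \<in> M" using a by (simp add: H1_def)
  have "v = (of_int b0 * x + of_int d * y) - of_int (b0 div a) * (of_int a * x)"
    unfolding v_def b_def by (simp add: algebra_simps minus_div_mult_eq_mod [symmetric])
  then have vM: "v \<in> M"
    using b0 aM M(1) by (auto intro!: subgrp_diff subgrp_of_int_mult)
  have "M \<subseteq> Zlat (of_int a * x) v"
  proof
    fix z assume z: "z \<in> M"
    then obtain i j where ij: "z = of_int i * x + of_int j * y" using M(2) by (blast elim: ZlatE)
    then have "d dvd j" using z d(3) by (auto simp: H2_def)
    then obtain q where q: "j = d * q" by auto
    have "z - of_int q * v \<in> M" using z vM M(1) by (auto intro!: subgrp_diff subgrp_of_int_mult)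
    moreover have "z - of_int q * v = of_int (i - q * b) * x"
      by (simp add: ij q v_def algebra_simps)
    ultimately have "a dvd i - q * b" using a(3) by (auto simp: H1_def)
    then obtain p where "i - q * b = a * p" by auto
    then have "z = of_int p * (of_int a * x) + of_int q * v"
      using \<open>z - of_int q * v = of_int (i - q * b) * x\<close> by (simp add: algebra_simps)
    then show "z \<in> Zlat (of_int a * x) v" by auto
  qed
  moreover have "Zlat (of_int a * x) v \<subseteq> M" using Zlat_subset M(1) aM vM by blast
  ultimately have "M = Zlat (of_int a * x) v" by blast
  moreover have "0 \<le> b" "b < a" using a(1) by (auto simp: b_def)
  ultimately show thesis using that[of a d b] a(1) d(1) by (simp add: v_def)
qed

text \<open>Turns membership into integer divisibility; the index and the uniqueness of the normal
  form are both read off from it.\<close>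

lemma hnf_mem_iff:
  assumes "cross x y \<noteq> 0"
  shows "of_int i * x + of_int j * y \<in> Zlat (of_int a * x) (of_int b * x + of_int d * y)
    \<longleftrightarrow> (\<exists>q. j = q * d \<and> a dvd i - q * b)"
proof
  assume "of_int i * x + of_int j * y \<in> Zlat (of_int a * x) (of_int b * x + of_int d * y)"
  then obtain p q where "of_int i * x + of_int j * y
      = of_int p * (of_int a * x) + of_int q * (of_int b * x + of_int d * y)"
    by (elim ZlatE)
  then have "of_int i * x + of_int j * y = of_int (p * a + q * b) * x + of_int (q * d) * y"
    by (simp add: algebra_simps)
  from Zlat_indep[OF assms this] show "\<exists>q. j = q * d \<and> a dvd i - q * b" by auto
next
  assume "\<exists>q. j = q * d \<and> a dvd i - q * b"
  then obtain p q where "j = q * d" "i - q * b = a * p" by (blast elim: dvdE)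
  then have "i = p * a + q * b" "j = q * d" by (simp_all add: algebra_simps)
  then have "of_int i * x + of_int j * y
      = of_int p * (of_int a * x) + of_int q * (of_int b * x + of_int d * y)"
    by (simp add: algebra_simps)
  then show "of_int i * x + of_int j * y \<in> Zlat (of_int a * x) (of_int b * x + of_int d * y)"
    by auto
qed

lemma index_hnf:
  assumes "cross x y \<noteq> 0" "a > 0" "d > 0"
  shows "index (Zlat x y) (Zlat (of_int a * x) (of_int b * x + of_int d * y)) = nat (a * d)"
proof -
  let ?K = "Zlat (of_int a * x) (of_int b * x + of_int d * y)"
  define f where "f = (\<lambda>(i::int, j::int). of_int i * x + of_int j * y)"
  have inj: "inj f" using Zlat_indep[OF assms(1)] by (fastforce simp: inj_def f_def)
  have "index (Zlat x y) ?K = card (f ` ({0..<a} \<times> {0..<d}))"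
  proof (rule index_eq_card_reps[OF subgrp_Zlat])
    show "f ` ({0..<a} \<times> {0..<d}) \<subseteq> Zlat x y" by (auto simp: f_def)
  next
    fix z assume "z \<in> Zlat x y"
    then obtain i j where ij: "z = of_int i * x + of_int j * y" by (elim ZlatE)
    \<comment> \<open>Subtracting \<open>q\<close> copies of the second basis vector reduces
      \<open>j\<close> modulo \<open>d\<close> and shifts \<open>i\<close> by \<open>q * b\<close>;
      only then is \<open>i\<close> reduced modulo \<open>a\<close>.\<close>
    define q where "q = j div d"
    define i' where "i' = (i - q * b) mod a"
    have "z - f (i', j mod d) = of_int (i - i') * x + of_int (j - j mod d) * y"
      by (simp add: ij f_def algebra_simps)
    moreover have "j - j mod d = q * d" by (simp add: q_def minus_mod_eq_div_mult)
    moreover have "a dvd (i - i') - q * b"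
    proof -
      have "(i - i') - q * b = (i - q * b) - (i - q * b) mod a" by (simp add: i'_def)
      then show ?thesis by (simp only: dvd_minus_mod)
    qed
    ultimately have "z - f (i', j mod d) \<in> ?K" by (metis hnf_mem_iff[OF assms(1)])
    moreover have "(i', j mod d) \<in> {0..<a} \<times> {0..<d}" using assms by (auto simp: i'_def)
    ultimately show "\<exists>r\<in>f ` ({0..<a} \<times> {0..<d}). z - r \<in> ?K" by blast
  next
    fix r r' assume "r \<in> f ` ({0..<a} \<times> {0..<d})" "r' \<in> f ` ({0..<a} \<times> {0..<d})" and K: "r - r' \<in> ?K"
    then obtain i j i' j' where ij: "r = f (i, j)" "r' = f (i', j')"
      "0 \<le> i" "i < a" "0 \<le> j" "j < d" "0 \<le> i'" "i' < a" "0 \<le> j'" "j' < d" by auto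
    have "r - r' = of_int (i - i') * x + of_int (j - j') * y"
      by (simp add: ij f_def algebra_simps)
    then obtain q where q: "j - j' = q * d" "a dvd i - i' - q * b"
      using K by (metis hnf_mem_iff[OF assms(1)])
    have "j mod d = j' mod d" using q(1) by (metis dvd_triv_right mod_eq_dvd_iff)
    then have "j = j'" using ij by simp
    then have "q = 0" using q(1) assms by simp
    then have "i mod a = i' mod a" using q(2) by (simp add: mod_eq_dvd_iff)
    then have "i = i'" using ij by simp
    with \<open>j = j'\<close> show "r = r'" by (simp add: ij)
  qed
  also have "\<dots> = card ({0..<a} \<times> {0..<d})"
    by (intro card_image) (use inj in \<open>auto intro: inj_on_subset\<close>)
  finally show ?thesis using assms by (simp add: card_cartesian_product nat_mult_distrib)
qed

lemma cross_hnf: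
  "cross (of_int a * x) (of_int b * x + of_int d * y) = of_int (a * d) * cross x y"
  using cross_comb[of a x 0 y b d] by simp

text \<open>Testing the basis vectors of each lattice for membership in the other gives divisibility
  in both directions, and \<open>b\<close> is then determined modulo \<open>a\<close>.\<close>

lemma hnf_unique:
  assumes "cross x y \<noteq> 0" "a > 0" "d > 0" "0 \<le> b" "b < a" "a' > 0" "d' > 0" "0 \<le> b'" "b' < a'"
    and eq: "Zlat (of_int a * x) (of_int b * x + of_int d * y)
      = Zlat (of_int a' * x) (of_int b' * x + of_int d' * y)"
  shows "a = a'" "b = b'" "d = d'"
proof -
  have mem: "(\<exists>q. j = q * d \<and> a dvd i - q * b) \<longleftrightarrow> (\<exists>q. j = q * d' \<and> a' dvd i - q * b')" for i j
    using hnf_mem_iff[OF assms(1)] eq by metis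
  have "a' dvd a" using mem[of 0 a] assms by auto
  moreover have "a dvd a'" using mem[of 0 a'] assms by auto
  ultimately show a: "a = a'" using assms by (intro zdvd_antisym_nonneg) auto
  have "d' dvd d" using mem[of d b] by auto
  moreover have "d dvd d'" using mem[of d' b'] by auto
  ultimately show d: "d = d'" using assms by (intro zdvd_antisym_nonneg) auto
  have "a dvd b - b'" using mem[of d b] a d assms by auto
  then have "b mod a = b' mod a" by (simp add: mod_eq_dvd_iff)
  then show "b = b'" using assms a by simp
qed

text \<open>Cramer's rule puts a multiple of the ambient basis into the sublattice.\<close>

lemma Zlat_sub_hnf:
  assumes xy: "cross x y \<noteq> 0" and uv: "cross u v \<noteq> 0" and sub: "Zlat u v \<subseteq> Zlat x y"
  obtains a b d where "a > 0" "d > 0" "0 \<le> b" "b < a"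
    "Zlat u v = Zlat (of_int a * x) (of_int b * x + of_int d * y)"
proof -
  obtain p q r t where pq: "u = of_int p * x + of_int q * y" "v = of_int r * x + of_int t * y"
    using sub Zlat_basis[where x = u and y = v] by (meson ZlatE subsetD)
  define \<Delta> where "\<Delta> = p * t - q * r"
  have "cross u v = of_int \<Delta> * cross x y" unfolding pq \<Delta>_def by (rule cross_comb)
  then have nz: "\<Delta> \<noteq> 0" using uv by auto
  have "of_int \<Delta> * x = of_int t * u + of_int (- q) * v"
    "of_int \<Delta> * y = of_int (- r) * u + of_int p * v"
    by (simp_all add: pq \<Delta>_def algebra_simps)
  then have "of_int \<Delta> * x \<in> Zlat u v" "of_int \<Delta> * y \<in> Zlat u v" by (metis ZlatI)+
  then have "of_int (sgn \<Delta>) * (of_int \<Delta> * x) \<in> Zlat u v"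
    "of_int (sgn \<Delta>) * (of_int \<Delta> * y) \<in> Zlat u v"
    by (auto intro: subgrp_of_int_mult subgrp_Zlat)
  moreover have "of_int (sgn \<Delta>) * (of_int \<Delta> * z) = of_int \<bar>\<Delta>\<bar> * z" for z :: complex
    by (simp add: sgn_if)
  ultimately have "of_int \<bar>\<Delta>\<bar> * x \<in> Zlat u v" "of_int \<bar>\<Delta>\<bar> * y \<in> Zlat u v" by metis+
  moreover have "\<bar>\<Delta>\<bar> > 0" using nz by simp
  ultimately obtain a b d where "a > 0" "d > 0" "0 \<le> b" "b < a"
    "Zlat u v = Zlat (of_int a * x) (of_int b * x + of_int d * y)"
    using Zlat_hnf_exists[OF subgrp_Zlat sub, of "\<bar>\<Delta>\<bar>" "\<bar>\<Delta>\<bar>"] by metis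
  then show thesis by (rule that)
qed

lemma subgrp_pos_index_hnf:
  assumes xy: "cross x y \<noteq> 0" and M: "subgrp M" "M \<subseteq> Zlat x y" "index (Zlat x y) M > 0"
  obtains a b d where "a > 0" "d > 0" "0 \<le> b" "b < a"
    "M = Zlat (of_int a * x) (of_int b * x + of_int d * y)"
proof -
  obtain k l :: nat where "k > 0" "of_nat k * x \<in> M" "l > 0" "of_nat l * y \<in> M"
    using index_pos_multiple[OF M(1) subgrp_Zlat M(3)] Zlat_basis by meson
  then have "int k > 0" "of_int (int k) * x \<in> M" "int l > 0" "of_int (int l) * y \<in> M" by auto
  then obtain a b d where "a > 0" "d > 0" "0 \<le> b" "b < a"
    "M = Zlat (of_int a * x) (of_int b * x + of_int d * y)"
    by (rule Zlat_hnf_exists[OF M(1,2)])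
  then show thesis by (rule that)
qed

text \<open>The base changes in the two directions are integral and mutually inverse, so their
  determinants are 1 or -1: the covolume belongs to the lattice and not to the basis.\<close>

lemma abs_cross_same_lattice:
  assumes xy: "cross x y \<noteq> 0" and eq: "Zlat x y = Zlat u v"
  shows "\<bar>cross u v\<bar> = \<bar>cross x y\<bar>"
proof -
  have "u \<in> Zlat x y" "v \<in> Zlat x y" "x \<in> Zlat u v" "y \<in> Zlat u v"
    using eq Zlat_basis by auto
  then obtain p q r t p' q' r' t' where
    1: "u = of_int p * x + of_int q * y" "v = of_int r * x + of_int t * y" and
    2: "x = of_int p' * u + of_int q' * v" "y = of_int r' * u + of_int t' * v"
    by (elim ZlatE)
  have c1: "cross u v = of_int (p * t - q * r) * cross x y" unfolding 1 by (rule cross_comb)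
  have c2: "cross x y = of_int (p' * t' - q' * r') * cross u v" 
    using cross_comb[of p' u q' v r' t'] by (simp only: 2[symmetric])
  have "1 * cross x y = of_int ((p' * t' - q' * r') * (p * t - q * r)) * cross x y"
    unfolding of_int_mult mult.assoc mult_1 c1[symmetric] by (rule c2)
  then have "real_of_int ((p' * t' - q' * r') * (p * t - q * r)) = 1"
    unfolding mult_right_cancel[OF xy] by (rule sym)
  then have "(p * t - q * r) * (p' * t' - q' * r') = 1"
    unfolding of_int_eq_1_iff by (simp only: mult.commute)
  then have "\<bar>(p * t - q * r) * (p' * t' - q' * r')\<bar> = 1" by (simp only: abs_1)
  then have "\<bar>p * t - q * r\<bar> = 1" by (rule abs_zmult_eq_1)
  then have "\<bar>real_of_int (p * t - q * r)\<bar> = 1" by (metis of_int_1 of_int_abs)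
  then show ?thesis unfolding c1 by (simp only: abs_mult mult_1)
qed

text \<open>The index is the quotient of the covolumes: in normal form both are governed by
  \<open>a * d\<close>. From here on indices are compared through areas instead of cosets.\<close>

lemma index_cross:
  assumes xy: "cross x y \<noteq> 0" and uv: "cross u v \<noteq> 0" and sub: "Zlat u v \<subseteq> Zlat x y"
  shows "\<bar>cross u v\<bar> = real (index (Zlat x y) (Zlat u v)) * \<bar>cross x y\<bar>"
    and "index (Zlat x y) (Zlat u v) > 0"
proof -
  obtain a b d where h: "a > 0" "d > 0" "0 \<le> b" "b < a"
    "Zlat u v = Zlat (of_int a * x) (of_int b * x + of_int d * y)"
    by (rule Zlat_sub_hnf[OF assms])
  have "index (Zlat x y) (Zlat u v) = nat (a * d)"
    unfolding h(5) by (rule index_hnf[OF xy h(1,2)])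
  moreover have "\<bar>cross u v\<bar> = of_int (a * d) * \<bar>cross x y\<bar>"
    using abs_cross_same_lattice[OF uv h(5)] h(1,2) by (simp add: cross_hnf abs_mult)
  ultimately show "\<bar>cross u v\<bar> = real (index (Zlat x y) (Zlat u v)) * \<bar>cross x y\<bar>"
    "index (Zlat x y) (Zlat u v) > 0"
    using h(1,2) by auto
qed

section \<open>Lattices of full rank and their similarities\<close>

definition planar :: "complex set \<Rightarrow> bool"
  where "planar A \<longleftrightarrow> (\<exists>x y. cross x y \<noteq> 0 \<and> A = Zlat x y)"

lemma planarE:
  assumes "planar A" obtains x y where "cross x y \<noteq> 0" "A = Zlat x y"
  using assms by (auto simp: planar_def)

lemma planar_subgrp: "planar A \<Longrightarrow> subgrp A"
  by (auto elim!: planarE intro: subgrp_Zlat)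

lemma planar_sub:
  assumes "planar A" "subgrp M" "M \<subseteq> A" "index A M > 0"
  shows "planar M"
proof -
  obtain x y where xy: "cross x y \<noteq> 0" "A = Zlat x y" using assms(1) by (rule planarE)
  obtain a b d where "a > 0" "d > 0" "M = Zlat (of_int a * x) (of_int b * x + of_int d * y)"
    using subgrp_pos_index_hnf[OF xy(1)] assms xy(2) by metis
  then show ?thesis
    using xy(1) unfolding planar_def by (metis cross_hnf mult_eq_0_iff of_int_eq_0_iff less_irrefl)
qed

lemma planar_index_pos: "planar A \<Longrightarrow> planar M \<Longrightarrow> M \<subseteq> A \<Longrightarrow> index A M > 0"
  using index_cross(2) by (auto elim!: planarE)

lemma planar_nonzero:
  assumes "planar A" obtains x where "x \<in> A" "x \<noteq> 0"
proof -
  obtain x y where xy: "cross x y \<noteq> 0" "A = Zlat x y" using assms by (rule planarE)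
  then have "x \<noteq> 0" by (auto simp: cross_def)
  then show thesis using that[of x] Zlat_basis(1) xy(2) by blast
qed

text \<open>Lagrange's theorem for the quotient group, read off from the normal form, in which the
  index is \<open>a * d\<close>.\<close>

lemma index_multiple_mem:
  assumes A: "planar A" and M: "subgrp M" "M \<subseteq> A" "index A M > 0" and z: "z \<in> A"
  shows "of_nat (index A M) * z \<in> M"
proof -
  obtain x y where xy: "cross x y \<noteq> 0" "A = Zlat x y" using A by (rule planarE)
  obtain a b d where h: "a > 0" "d > 0" "M = Zlat (of_int a * x) (of_int b * x + of_int d * y)"
    using subgrp_pos_index_hnf[OF xy(1)] M xy(2) by metis
  have idx: "index A M = nat (a * d)" unfolding h xy(2) by (rule index_hnf[OF xy(1) h(1,2)])
  obtain i j where ij: "z = of_int i * x + of_int j * y" using z xy(2) by (blast elim: ZlatE)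
  have "of_nat (nat (a * d)) * z = of_int (a * d * i) * x + of_int (a * d * j) * y"
    using h(1,2) by (simp add: ij algebra_simps)
  also have "\<dots> \<in> M"
    unfolding h(3) hnf_mem_iff[OF xy(1)]
    by (intro exI[of _ "a * j"]) (simp add: dvd_diff)
  finally show ?thesis unfolding idx .
qed

text \<open>For \<open>u\<close> of absolute value 1, \<open>cmul u\<close> is a rotation and
  \<open>ccmul u\<close> a reflection. They are named functions so that one statement about
  \<open>f \<in> {cmul, ccmul}\<close> covers both kinds.\<close>

definition cmul :: "complex \<Rightarrow> complex \<Rightarrow> complex"
  where "cmul u z = u * z"

definition ccmul :: "complex \<Rightarrow> complex \<Rightarrow> complex"
  where "ccmul u z = u * cnj z"

lemma cross_similar:
  "cross (cmul u v) (cmul u w) = (cmod u)\<^sup>2 * cross v w"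
  "cross (ccmul u v) (ccmul u w) = - ((cmod u)\<^sup>2 * cross v w)"
  unfolding cmod_power2 by (simp_all add: cross_def cmul_def ccmul_def algebra_simps power2_eq_square)

text \<open>A similarity scales areas by the square of the absolute value of \<open>u\<close>, and
  the index is a quotient of areas.\<close>

lemma index_similarity:
  assumes A: "planar A" and M: "subgrp M" "M \<subseteq> A" "index A M > 0"
    and f: "f \<in> {cmul u, ccmul u}" "u \<noteq> 0"
  shows "planar (f ` M)"
    and "f ` M \<subseteq> A \<Longrightarrow> real (index A (f ` M)) = (cmod u)\<^sup>2 * real (index A M)"
proof -
  obtain x y where xy: "cross x y \<noteq> 0" "A = Zlat x y" using A by (rule planarE)
  obtain v w where vw: "cross v w \<noteq> 0" "M = Zlat v w"
    using planar_sub[OF A M] by (rule planarE)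
  have lin: "f (of_int i * v + of_int j * w) = of_int i * f v + of_int j * f w" for i j
    using f(1) by (auto simp: cmul_def ccmul_def algebra_simps)
  have im: "f ` M = Zlat (f v) (f w)"
  proof (intro equalityI subsetI)
    fix z assume "z \<in> f ` M"
    then show "z \<in> Zlat (f v) (f w)" using lin by (auto simp: vw(2) elim!: ZlatE)
  next
    fix z assume "z \<in> Zlat (f v) (f w)"
    then show "z \<in> f ` M" using lin by (metis ZlatE ZlatI imageI vw(2))
  qed
  have cr: "\<bar>cross (f v) (f w)\<bar> = (cmod u)\<^sup>2 * \<bar>cross v w\<bar>"
  proof -
    have "\<bar>cross (f v) (f w)\<bar> = \<bar>(cmod u)\<^sup>2 * cross v w\<bar>"
      using f(1) cross_similar by auto
    then show ?thesis by (simp add: abs_mult)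
  qed
  then have nz: "cross (f v) (f w) \<noteq> 0" using vw(1) f(2) by auto
  show "planar (f ` M)" using nz im by (auto simp: planar_def)
  assume "f ` M \<subseteq> A"
  then have "\<bar>cross (f v) (f w)\<bar> = real (index A (f ` M)) * \<bar>cross x y\<bar>"
    using index_cross(1)[OF xy(1) nz] im xy(2) by simp
  moreover have "\<bar>cross v w\<bar> = real (index A M) * \<bar>cross x y\<bar>"
    using index_cross(1)[OF xy(1) vw(1)] M(2) vw(2) xy(2) by simp
  ultimately show "real (index A (f ` M)) = (cmod u)\<^sup>2 * real (index A M)"
    using cr xy(1) by simp
qed

definition subs :: "complex set \<Rightarrow> nat \<Rightarrow> complex set set"
  where "subs A m = {M. subgrp M \<and> M \<subseteq> A \<and> index A M = m}"

text \<open>In a normal form of index \<open>m\<close> a divisor \<open>a\<close> fixes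
  \<open>d\<close> and leaves \<open>a\<close> choices for \<open>b\<close>. Summed over
  \<open>a\<close>, this is the divisor sum that appears as the number of subgroups of index
  \<open>m\<close>.\<close>

lemma bij_subs_hnf:
  assumes "cross x y \<noteq> 0" "m > 0"
  defines "h \<equiv> \<lambda>(a, b). Zlat (of_int (int a) * x) (of_int (int b) * x + of_int (int (m div a)) * y)"
  shows "bij_betw h (SIGMA a:{a. a dvd m}. {..<a}) (subs (Zlat x y) m)"
  unfolding bij_betw_def
proof
  have pos: "a > 0 \<and> m div a > 0" if "a dvd m" for a
    using that assms(2) by (auto elim!: dvdE)
  show "inj_on h (SIGMA a:{a. a dvd m}. {..<a})"
  proof (rule inj_onI)
    fix s t assume "s \<in> (SIGMA a:{a. a dvd m}. {..<a})" "t \<in> (SIGMA a:{a. a dvd m}. {..<a})" "h s = h t"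
    then obtain a b a' b' where st: "s = (a, b)" "t = (a', b')" and
      *: "a dvd m" "b < a" "a' dvd m" "b' < a'" "h (a, b) = h (a', b')"
      by (cases s, cases t) auto
    have "a = a' \<and> b = b'"
      using hnf_unique[OF assms(1), of "int a" "int (m div a)" "int b" "int a'" "int (m div a')" "int b'"]
        pos[OF *(1)] pos[OF *(3)] * by (auto simp: h_def)
    then show "s = t" by (simp add: st)
  qed
  show "h ` (SIGMA a:{a. a dvd m}. {..<a}) = subs (Zlat x y) m"
  proof (intro equalityI subsetI)
    fix M assume "M \<in> h ` (SIGMA a:{a. a dvd m}. {..<a})"
    then obtain a b where ab: "a dvd m" "M = h (a, b)" by auto
    have "index (Zlat x y) M = nat (int a * int (m div a))"
      unfolding ab(2) h_def prod.case by (rule index_hnf[OF assms(1)]) (use pos[OF ab(1)] in auto)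
    then have "index (Zlat x y) M = m" using ab(1) by (simp flip: of_nat_mult)
    moreover have "M \<subseteq> Zlat x y"
      unfolding ab(2) h_def prod.case
      by (intro Zlat_subset subgrp_Zlat ZlatI subgrp_of_int_mult Zlat_basis)
    ultimately show "M \<in> subs (Zlat x y) m"
      by (simp add: subs_def ab(2) h_def subgrp_Zlat)
  next
    fix M assume "M \<in> subs (Zlat x y) m"
    then have M: "subgrp M" "M \<subseteq> Zlat x y" "index (Zlat x y) M = m" by (auto simp: subs_def)
    obtain a b d where h: "a > 0" "d > 0" "0 \<le> b" "b < a"
      "M = Zlat (of_int a * x) (of_int b * x + of_int d * y)"
      using subgrp_pos_index_hnf[OF assms(1) M(1,2)] M(3) assms(2) by metis
    have "m = nat (a * d)"
      using M(3) unfolding h(5) by (simp only: index_hnf[OF assms(1) h(1,2)])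
    then have m: "m = nat a * nat d" using h by (simp add: nat_mult_distrib)
    have "M = h (nat a, nat b)" using h m by (simp add: h_def)
    moreover have "(nat a, nat b) \<in> (SIGMA a:{a. a dvd m}. {..<a})" using h m by auto
    ultimately show "M \<in> h ` (SIGMA a:{a. a dvd m}. {..<a})" by blast
  qed
qed

lemma card_subs:
  assumes "planar A" "m > 0"
  shows "finite (subs A m)" "card (subs A m) = \<Sum>{a. a dvd m}"
proof -
  obtain x y where xy: "cross x y \<noteq> 0" "A = Zlat x y" using assms(1) by (rule planarE)
  note bij = bij_subs_hnf[OF xy(1) assms(2), folded xy(2)]
  have fin: "finite {a. a dvd m}" using assms(2) by (simp add: finite_divisors_nat)
  show "finite (subs A m)" using bij_betw_finite[OF bij] fin by auto
  show "card (subs A m) = \<Sum>{a. a dvd m}" using bij_betw_same_card[OF bij] fin by simp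
qed

section \<open>The maximal order of an imaginary quadratic field\<close>

lemma prime_dvd_Prod_iff_mem:
  assumes "finite S" "\<And>q. q \<in> S \<Longrightarrow> prime q" "prime (p::int)"
  shows "p dvd \<Prod>S \<longleftrightarrow> p \<in> S"
proof -
  have "p dvd \<Prod>S \<longleftrightarrow> (\<exists>q\<in>S. p dvd q)"
    using assms(1,3) by (simp add: prime_dvd_prod_iff)
  also have "\<dots> \<longleftrightarrow> p \<in> S"
    using assms(2) primes_dvd_imp_eq[OF assms(3)] by (auto intro: bexI[of _ p])
  finally show ?thesis .
qed

text \<open>For each prime \<open>p\<close> of \<open>k\<close> exactly one of the three terms is to
  survive modulo \<open>p\<close>. If \<open>p\<close> does not divide \<open>A\<close>, it is put
  into \<open>j\<close>; if it divides \<open>A\<close> but not \<open>C\<close>, into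
  \<open>i\<close>; if it divides both, it does not divide \<open>B\<close> and is put into
  neither.\<close>

lemma primitive_form_represents_coprime:
  fixes A B C k :: int
  assumes prim: "gcd A (gcd B C) = 1" and k: "k \<noteq> 0"
  obtains i j where "coprime (A * i\<^sup>2 + B * i * j + C * j\<^sup>2) k"
proof -
  define S where "S = prime_factors k"
  define Si where "Si = {p \<in> S. p dvd A \<and> \<not> p dvd C}"
  define Sj where "Sj = {p \<in> S. \<not> p dvd A}"
  have S: "finite S" "\<And>p. p \<in> S \<Longrightarrow> prime p" by (auto simp: S_def)
  have fin: "finite Si" "finite Sj" using S by (auto simp: Si_def Sj_def)
  define X where "X = A * (\<Prod>Si)\<^sup>2 + B * \<Prod>Si * \<Prod>Sj + C * (\<Prod>Sj)\<^sup>2"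
  have "coprime X k"
  proof (rule ccontr)
    assume "\<not> ?thesis"
    then have "\<not> is_unit (gcd X k)"
      by (simp add: coprime_iff_gcd_eq_1)
    moreover have "gcd X k \<noteq> 0" using k by simp
    ultimately obtain p where "prime p" "p dvd gcd X k" using prime_divisor_exists by blast
    then have p: "prime p" "p dvd X" "p dvd k" by simp_all
    have pS: "p \<in> S" using p k by (simp add: S_def prime_factors_dvd)
    have i: "p dvd \<Prod>Si \<longleftrightarrow> p dvd A \<and> \<not> p dvd C"
      using prime_dvd_Prod_iff_mem[OF fin(1) _ p(1)] S pS by (auto simp: Si_def)
    have j: "p dvd \<Prod>Sj \<longleftrightarrow> \<not> p dvd A"
      using prime_dvd_Prod_iff_mem[OF fin(2) _ p(1)] S pS by (auto simp: Sj_def)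
    have nABC: "\<not> (p dvd A \<and> p dvd B \<and> p dvd C)"
    proof
      assume "p dvd A \<and> p dvd B \<and> p dvd C"
      then have "p dvd gcd A (gcd B C)" by simp
      then have "is_unit p" unfolding prim .
      then show False using not_prime_unit p(1) by blast
    qed
    consider "\<not> p dvd A" | "p dvd A" "\<not> p dvd C" | "p dvd A" "p dvd C" "\<not> p dvd B"
      using nABC by blast
    then show False
    proof cases
      case 1
      then have "p dvd \<Prod>Sj" "\<not> p dvd \<Prod>Si" using i j by auto
      then have "p dvd A * (\<Prod>Si)\<^sup>2"
        using p(2) by (simp add: X_def dvd_add_left_iff power2_eq_square)
      then show False
        using 1 \<open>\<not> p dvd \<Prod>Si\<close> p(1) by (simp add: prime_dvd_mult_iff prime_dvd_power_iff)
    next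
      case 2
      then have "p dvd \<Prod>Si" "\<not> p dvd \<Prod>Sj" using i j by auto
      then have "p dvd C * (\<Prod>Sj)\<^sup>2"
        using p(2) by (simp add: X_def dvd_add_right_iff power2_eq_square)
      then show False
        using 2 \<open>\<not> p dvd \<Prod>Sj\<close> p(1) by (simp add: prime_dvd_mult_iff prime_dvd_power_iff)
    next
      case 3
      then have *: "\<not> p dvd \<Prod>Si" "\<not> p dvd \<Prod>Sj" using i j by auto
      have "p dvd B * \<Prod>Si * \<Prod>Sj"
        using p(2) 3 by (simp add: X_def dvd_add_left_iff dvd_add_right_iff)
      then show False using * 3 p(1) by (simp add: prime_dvd_mult_iff)
    qed
  qed
  then show thesis unfolding X_def by (rule that)
qed

section \<open>The field \<open>F\<close> and the order \<open>Ord\<close>\<close>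

lemma cnj_of_rat: "cnj (of_rat r) = of_rat r"
  by (cases r) (simp add: of_rat_rat)

lemma algebraic_int_quadratic:
  assumes "z * z = of_int t * z - of_int m"
  shows "algebraic_int (z :: complex)"
proof (rule algebraic_int.intros)
  show "lead_coeff [:of_int m, - of_int t, 1 :: complex:] = 1" by simp
  show "\<forall>i. coeff [:of_int m, - of_int t, 1 :: complex:] i \<in> \<int>"
    by (auto simp: coeff_pCons split: nat.splits)
  show "poly [:of_int m, - of_int t, 1:] z = 0"
    using assms by (simp add: algebra_simps)
qed

text \<open>The integers \<open>b\<close> and \<open>n\<close> are the trace and the norm of
  \<open>tau\<close>. For the lattice \<open>n\<close> will be \<open>a * c\<close>, so that the
  same \<open>tau\<close> generates the order together with 1 and the ideal \<open>I\<close>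
  together with \<open>a\<close>.\<close>

locale imaginary_quadratic =
  fixes b n D :: int and F :: "complex set"
  assumes D_eq: "D = b\<^sup>2 - 4 * n" and D_neg: "D < 0" and F_eq: "F = quadratic_field D"
begin

definition tau :: complex where "tau = (of_int b - csqrt (of_int D)) / 2"

definition Ord :: "complex set" where "Ord = Zlat 1 tau"

lemma csqrt_D: "csqrt (of_int D) = \<i> * of_real (sqrt (- of_int D))"
  using D_neg csqrt_of_real_nonpos[of "of_int D"] by simp

lemma csqrt_D_sq: "csqrt (of_int D) * csqrt (of_int D) = of_int D"
  by (metis power2_csqrt power2_eq_square)

lemma cnj_csqrt_D: "cnj (csqrt (of_int D)) = - csqrt (of_int D)"
  by (simp add: csqrt_D)

lemma Im_tau: "Im tau = - sqrt (- of_int D) / 2" and Re_tau: "Re tau = of_int b / 2"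
  by (simp_all add: tau_def csqrt_D)

lemma cnj_tau: "cnj tau = of_int b - tau"
  by (simp add: tau_def cnj_csqrt_D field_simps del: of_real_sqrt)

lemma tau_sq: "tau * tau = of_int b * tau - of_int n"
proof -
  have "csqrt (of_int D) = of_int b - 2 * tau" by (simp add: tau_def field_simps)
  then have "(of_int b - 2 * tau) * (of_int b - 2 * tau) = of_int (b * b - 4 * n)"
    using csqrt_D_sq D_eq by (simp add: power2_eq_square)
  then have "4 * (tau * tau) = 4 * (of_int b * tau - of_int n)"
    by (simp add: algebra_simps)
  then show ?thesis by (metis mult_left_cancel zero_neq_numeral)
qed

lemma cross_1_tau: "cross 1 tau \<noteq> 0"
  using D_neg by (simp add: cross_def Im_tau)

lemma planar_Ord: "planar Ord"
  using cross_1_tau by (auto simp: planar_def Ord_def)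

lemma subgrp_Ord: "subgrp Ord"
  by (simp add: Ord_def subgrp_Zlat)

lemma one_Ord: "1 \<in> Ord" and tau_Ord: "tau \<in> Ord"
  by (simp_all add: Ord_def Zlat_basis)

lemma Ord_add: "x \<in> Ord \<Longrightarrow> y \<in> Ord \<Longrightarrow> x + y \<in> Ord"
  using subgrp_Ord by (rule subgrp_add)

lemma Ord_diff: "x \<in> Ord \<Longrightarrow> y \<in> Ord \<Longrightarrow> x - y \<in> Ord"
  using subgrp_Ord by (rule subgrp_diff)

lemma Ord_of_int: "of_int k \<in> Ord"
  using subgrp_of_int_mult[OF subgrp_Ord one_Ord] by simp

lemma OrdE:
  assumes "z \<in> Ord" obtains i j where "z = of_int i + of_int j * tau"
  using assms unfolding Ord_def by (auto elim: ZlatE)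

lemma Ord_mult_closed:
  assumes "subgrp J" "\<And>x. x \<in> J \<Longrightarrow> tau * x \<in> J" "r \<in> Ord" "x \<in> J"
  shows "r * x \<in> J"
proof -
  obtain i j where r: "r = of_int i + of_int j * tau" using assms(3) by (rule OrdE)
  have "of_int i * x + of_int j * (tau * x) \<in> J"
    using assms by (intro subgrp_add subgrp_of_int_mult) auto
  then show ?thesis by (simp add: r algebra_simps)
qed

lemma tau_mult_Ord: "x \<in> Ord \<Longrightarrow> tau * x \<in> Ord"
proof (elim OrdE)
  fix i j assume "x = of_int i + of_int j * tau"
  then have "tau * x = of_int (- (j * n)) + of_int (i + j * b) * tau"
    by (simp add: ring_distribs mult.left_commute[of tau] tau_sq)
  then show ?thesis
    using Ord_add[OF Ord_of_int subgrp_of_int_mult[OF subgrp_Ord tau_Ord]] by metis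
qed

lemma Ord_mult: "x \<in> Ord \<Longrightarrow> y \<in> Ord \<Longrightarrow> x * y \<in> Ord"
  using Ord_mult_closed[OF subgrp_Ord tau_mult_Ord] by blast

lemma Ord_cnj: "x \<in> Ord \<Longrightarrow> cnj x \<in> Ord"
  by (elim OrdE) (auto simp: cnj_tau intro!: Ord_add Ord_mult Ord_of_int Ord_diff tau_Ord)

lemma norm_Ord_elem:
  "(of_int i + of_int j * tau) * cnj (of_int i + of_int j * tau) = of_int (i * i + i * j * b + j * j * n)"
proof -
  have "(of_int i + of_int j * tau) * cnj (of_int i + of_int j * tau)
      = of_int (i * i + i * j * b) + of_int (j * j) * (of_int b * tau - tau * tau)"
    by (simp add: cnj_tau algebra_simps)
  then show ?thesis by (simp add: tau_sq)
qed

lemma Ord_norm_trace: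
  assumes "x \<in> Ord"
  obtains m t :: int where "x * cnj x = of_int m" "x + cnj x = of_int t"
proof -
  obtain i j where x: "x = of_int i + of_int j * tau" using assms by (rule OrdE)
  have "x * cnj x = of_int (i * i + i * j * b + j * j * n)" unfolding x by (rule norm_Ord_elem)
  moreover have "x + cnj x = of_int (2 * i + j * b)"
    by (simp add: x cnj_tau algebra_simps)
  ultimately show thesis by (rule that)
qed

lemma F_I: "of_rat p + of_rat q * csqrt (of_int D) \<in> F"
  by (auto simp: F_eq quadratic_field_def)

lemma F_E:
  assumes "z \<in> F" obtains p q where "z = of_rat p + of_rat q * csqrt (of_int D)"
  using assms by (auto simp: F_eq quadratic_field_def)

lemma F_of_rat: "of_rat r \<in> F"
  using F_I[of r 0] by simp

lemma F_of_int: "of_int k \<in> F"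
  using F_of_rat[of "of_int k"] by simp

lemma F_add: "x \<in> F \<Longrightarrow> y \<in> F \<Longrightarrow> x + y \<in> F"
proof (elim F_E)
  fix p q p' q' assume "x = of_rat p + of_rat q * csqrt (of_int D)"
    "y = of_rat p' + of_rat q' * csqrt (of_int D)"
  then have "x + y = of_rat (p + p') + of_rat (q + q') * csqrt (of_int D)"
    by (simp add: of_rat_add algebra_simps)
  then show ?thesis by (metis F_I)
qed

lemma F_mult: "x \<in> F \<Longrightarrow> y \<in> F \<Longrightarrow> x * y \<in> F"
proof (elim F_E)
  fix p q p' q' assume xy: "x = of_rat p + of_rat q * csqrt (of_int D)"
    "y = of_rat p' + of_rat q' * csqrt (of_int D)"
  have "x * y = of_rat p * of_rat p' + of_rat q * of_rat q' * (csqrt (of_int D) * csqrt (of_int D))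
      + (of_rat p * of_rat q' + of_rat q * of_rat p') * csqrt (of_int D)"
    unfolding xy by (simp only: algebra_simps)
  then have "x * y = of_rat (p * p' + q * q' * of_int D) + of_rat (p * q' + q * p') * csqrt (of_int D)"
    unfolding csqrt_D_sq by (simp add: of_rat_add of_rat_mult)
  then show ?thesis by (metis F_I)
qed

lemma F_cnj: "x \<in> F \<Longrightarrow> cnj x \<in> F"
proof (elim F_E)
  fix p q assume x: "x = of_rat p + of_rat q * csqrt (of_int D)"
  have "cnj x = of_rat p + of_rat (- q) * csqrt (of_int D)"
    unfolding x complex_cnj_add complex_cnj_mult cnj_csqrt_D cnj_of_rat by (simp add: of_rat_minus)
  then show ?thesis by (metis F_I)
qed

lemma F_norm:
  assumes "x \<in> F" obtains r where "x * cnj x = of_rat r"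
proof -
  obtain p q where x: "x = of_rat p + of_rat q * csqrt (of_int D)" using assms by (rule F_E)
  have "x * cnj x = of_rat p * of_rat p - of_rat q * of_rat q * (csqrt (of_int D) * csqrt (of_int D))"
    unfolding x complex_cnj_add complex_cnj_mult cnj_csqrt_D cnj_of_rat by (simp add: algebra_simps)
  then have "x * cnj x = of_rat (p * p - q * q * of_int D)"
    unfolding csqrt_D_sq by (simp add: of_rat_diff of_rat_mult)
  then show thesis by (rule that)
qed

lemma F_inverse: "x \<in> F \<Longrightarrow> inverse x \<in> F"
proof -
  assume x: "x \<in> F"
  then obtain r where r: "x * cnj x = of_rat r" by (rule F_norm)
  have "inverse x = of_rat (inverse r) * cnj x"
    by (cases "x = 0") (simp_all add: of_rat_inverse flip: r)
  then show ?thesis using F_mult[OF F_of_rat F_cnj[OF x]] by simp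
qed

lemma F_divide: "x \<in> F \<Longrightarrow> y \<in> F \<Longrightarrow> x / y \<in> F"
  using F_mult F_inverse by (simp add: field_class.field_divide_inverse)

lemma tau_F: "tau \<in> F"
  using F_I[of "of_int b / 2" "- 1 / 2"]
  by (simp add: tau_def of_rat_divide of_rat_minus diff_divide_distrib del: of_real_sqrt)

lemma Ord_F: "x \<in> Ord \<Longrightarrow> x \<in> F"
  by (elim OrdE) (auto intro: F_add F_mult F_of_int tau_F)

lemma Ord_algebraic_int:
  assumes "z \<in> Ord" shows "algebraic_int z"
proof -
  obtain m t where mt: "z * cnj z = of_int m" "z + cnj z = of_int t"
    using assms by (rule Ord_norm_trace)
  have "z * z = (z + cnj z) * z - z * cnj z" by (simp add: algebra_simps)
  then show ?thesis unfolding mt by (rule algebraic_int_quadratic)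
qed

end

text \<open>The assumption says that \<open>Ord\<close> is the maximal order;
  \<open>quadratic_order_if_discriminant\<close> supplies it. It enters through
  \<open>generator_modulo\<close>, \<open>stabilizer_trivial\<close> and the identification of
  \<open>Ord\<close> with the ring of integers.\<close>

locale quadratic_order = imaginary_quadratic +
  assumes integral: "\<And>z. z \<in> F \<Longrightarrow> algebraic_int z \<Longrightarrow> z \<in> Ord"
begin

section \<open>Ideals and the subgroups that generate them\<close>

lemma quadratic_integral:
  assumes "z \<in> F" "z * z = of_int t * z - of_int m"
  shows "z \<in> Ord"
  using integral[OF assms(1) algebraic_int_quadratic[OF assms(2)]] .

text \<open>The nonzero ideals of \<open>Ord\<close>. Closure under \<open>tau\<close> is closure
  under all of \<open>Ord\<close>, and finite index takes the place of being nonzero.\<close>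

definition olat :: "complex set \<Rightarrow> bool"
  where "olat J \<longleftrightarrow> subgrp J \<and> (\<forall>x\<in>J. tau * x \<in> J) \<and> J \<subseteq> Ord \<and> index Ord J > 0"

lemma olat_Ord: "olat Ord"
  by (simp add: olat_def subgrp_Ord tau_mult_Ord index_self)

lemma olat_planar: "olat J \<Longrightarrow> planar J"
  using planar_sub[OF planar_Ord] by (auto simp: olat_def)

lemma olat_mult: "olat J \<Longrightarrow> r \<in> Ord \<Longrightarrow> x \<in> J \<Longrightarrow> r * x \<in> J"
  using Ord_mult_closed by (auto simp: olat_def)

text \<open>As \<open>Ord = \<int> + \<int> tau\<close>, this is the product of \<open>Ord\<close> and the subgroup \<open>M\<close>.\<close>

definition ospan :: "complex set \<Rightarrow> complex set"
  where "ospan M = {x + tau * y | x y. x \<in> M \<and> y \<in> M}"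

lemma ospanI: "x \<in> M \<Longrightarrow> y \<in> M \<Longrightarrow> x + tau * y \<in> ospan M"
  by (auto simp: ospan_def)

lemma ospan_subgrp: "subgrp M \<Longrightarrow> subgrp (ospan M)"
  unfolding subgrp_def[of "ospan M"]
proof (intro conjI ballI)
  assume M: "subgrp M"
  show "0 \<in> ospan M"
    using subgrp_zero[OF M] by (auto simp: ospan_def intro!: exI[of _ 0])
  fix z w assume "z \<in> ospan M" "w \<in> ospan M"
  then obtain x y x' y' where *: "z = x + tau * y" "w = x' + tau * y'" "x \<in> M" "y \<in> M" "x' \<in> M" "y' \<in> M"
    by (auto simp: ospan_def)
  have "z - w = (x - x') + tau * (y - y')" unfolding * by (simp add: algebra_simps)
  also have "\<dots> \<in> ospan M" using * M by (intro ospanI subgrp_diff)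
  finally show "z - w \<in> ospan M" .
qed

lemma ospan_tau:
  assumes M: "subgrp M" and z: "z \<in> ospan M" shows "tau * z \<in> ospan M"
proof -
  obtain x y where *: "z = x + tau * y" "x \<in> M" "y \<in> M" using z by (auto simp: ospan_def)
  have "tau * z = tau * x + (tau * tau) * y" by (simp add: * algebra_simps)
  also have "\<dots> = of_int (- n) * y + tau * (x + of_int b * y)"
    by (simp add: tau_sq algebra_simps)
  also have "\<dots> \<in> ospan M"
    using * M by (intro ospanI subgrp_add subgrp_of_int_mult)
  finally show ?thesis .
qed

lemma ospan_superset: "subgrp M \<Longrightarrow> M \<subseteq> ospan M"
proof
  fix x assume "subgrp M" "x \<in> M"
  then have "x = x + tau * 0" "0 \<in> M" by (auto intro: subgrp_zero)
  then show "x \<in> ospan M" using \<open>x \<in> M\<close> unfolding ospan_def by blast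
qed

lemma ospan_least: "subgrp J \<Longrightarrow> (\<And>x. x \<in> J \<Longrightarrow> tau * x \<in> J) \<Longrightarrow> M \<subseteq> J \<Longrightarrow> ospan M \<subseteq> J"
  by (auto simp: ospan_def intro!: subgrp_add)

lemma olat_ospan_least: "olat J \<Longrightarrow> M \<subseteq> J \<Longrightarrow> ospan M \<subseteq> J"
  by (rule ospan_least) (auto simp: olat_def)

definition ideals :: "complex set \<Rightarrow> nat \<Rightarrow> complex set set"
  where "ideals A d = {J \<in> subs A d. \<forall>x\<in>J. tau * x \<in> J}"

definition gens :: "complex set \<Rightarrow> nat \<Rightarrow> complex set set"
  where "gens J k = {M \<in> subs J k. ospan M = J}"

lemma index_olat_tower:
  assumes "olat A" "subgrp M" "M \<subseteq> A"
  shows "index Ord M = index Ord A * index A M"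
  using index_tower[OF assms(2) _ subgrp_Ord assms(3)] assms(1) by (auto simp: olat_def)

lemma ideals_olat: "olat A \<Longrightarrow> d > 0 \<Longrightarrow> J \<in> ideals A d \<Longrightarrow> olat J"
  using index_olat_tower[of A J] by (auto simp: olat_def ideals_def subs_def)

lemma finite_ideals: "olat A \<Longrightarrow> d > 0 \<Longrightarrow> finite (ideals A d)"
  using card_subs(1)[OF olat_planar] by (simp add: ideals_def)

lemma finite_gens: "olat A \<Longrightarrow> d > 0 \<Longrightarrow> finite (gens A d)"
  using card_subs(1)[OF olat_planar] by (simp add: gens_def)

text \<open>A subgroup \<open>M\<close> is filed under the ideal \<open>ospan M\<close>, which lies
  between \<open>M\<close> and \<open>A\<close>. As indices multiply, sums over subgroups acquire
  the shape of a Dirichlet convolution.\<close>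

lemma sum_subs:
  fixes g :: "complex set \<Rightarrow> 'a::comm_monoid_add"
  assumes A: "olat A" and m: "m > 0"
  shows "(\<Sum>M\<in>subs A m. g M)
    = (\<Sum>d | d dvd m. \<Sum>J\<in>ideals A d. \<Sum>M\<in>gens J (m div d). g M)"
proof -
  let ?T = "SIGMA d:{d. d dvd m}. SIGMA J:ideals A d. gens J (m div d)"
  have pos: "d > 0" "m div d > 0" if "d dvd m" for d
    using that m by (auto elim!: dvdE)
  have fin: "finite (ideals A d)" "J \<in> ideals A d \<Longrightarrow> finite (gens J (m div d))" if "d dvd m" for d J
    using finite_ideals[OF A] finite_gens ideals_olat[OF A] pos[OF that] by blast+
  have "(\<Sum>d | d dvd m. \<Sum>J\<in>ideals A d. \<Sum>M\<in>gens J (m div d). g M) = (\<Sum>(d, J, M)\<in>?T. g M)"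
    using fin m by (simp add: sum.Sigma finite_divisors_nat)
  also have "\<dots> = (\<Sum>M\<in>subs A m. g M)"
  proof (rule sum.reindex_bij_witness[where i = "\<lambda>M. (index A (ospan M), ospan M, M)" and j = "\<lambda>(d, J, M). M"])
    fix t assume "t \<in> ?T"
    then obtain d J M where t: "t = (d, J, M)" "d dvd m" "J \<in> ideals A d" "M \<in> gens J (m div d)" by auto
    have "index A M = index A J * index J M"
      by (rule index_tower) (use t A in \<open>auto simp: gens_def ideals_def subs_def olat_def\<close>)
    then show "(case t of (d, J, M) \<Rightarrow> M) \<in> subs A m"
      using t by (auto simp: gens_def ideals_def subs_def)
    show "(\<lambda>M. (index A (ospan M), ospan M, M)) (case t of (d, J, M) \<Rightarrow> M) = t"
      using t by (auto simp: gens_def ideals_def subs_def)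
  next
    fix M assume M: "M \<in> subs A m"
    have sub: "M \<subseteq> ospan M" "ospan M \<subseteq> A" "subgrp (ospan M)"
      using M A by (auto simp: subs_def dest: ospan_superset ospan_subgrp olat_ospan_least)
    have "index A M = index A (ospan M) * index (ospan M) M"
      by (rule index_tower) (use M A sub in \<open>auto simp: subs_def olat_def\<close>)
    then have m': "m = index A (ospan M) * index (ospan M) M" using M by (simp add: subs_def)
    then have "m div index A (ospan M) = index (ospan M) M" using m by simp
    then show "(\<lambda>M. (index A (ospan M), ospan M, M)) M \<in> ?T"
      using sub M m' by (auto simp: gens_def ideals_def subs_def intro: ospan_tau)
  qed auto
  finally show ?thesis by (rule sym)
qed

text \<open>The witness \<open>\<alpha>\<close> generates \<open>J\<close> modulo \<open>k\<close>: it has norm \<open>g q\<close>, where \<open>g\<close> is the content of the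
  norm form on \<open>J\<close>, and \<open>cnj \<alpha> * z / g\<close> is integral for every \<open>z \<in> J\<close>.\<close>

lemma generator_modulo:
  assumes J: "olat J" and k: "k \<noteq> 0"
  obtains \<alpha> q where "\<alpha> \<in> J" "\<alpha> \<noteq> 0" "coprime q (k::int)"
    "\<And>z. z \<in> J \<Longrightarrow> \<exists>r\<in>Ord. of_int q * z = \<alpha> * r"
proof -
  obtain x y where xy: "cross x y \<noteq> 0" "J = Zlat x y" using olat_planar[OF J] by (rule planarE)
  have xyJ: "x \<in> J" "y \<in> J" using Zlat_basis xy(2) by auto
  then have xyO: "x \<in> Ord" "y \<in> Ord" "x \<in> F" "y \<in> F" using J by (auto simp: olat_def intro: Ord_F)
  obtain P where P: "x * cnj x = of_int P" using Ord_norm_trace[OF xyO(1)] by metis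
  obtain R where R: "y * cnj y = of_int R" using Ord_norm_trace[OF xyO(2)] by metis
  obtain T where T: "cnj x * y + cnj (cnj x * y) = of_int T"
    using Ord_norm_trace[OF Ord_mult[OF Ord_cnj[OF xyO(1)] xyO(2)]] by metis
  have x0: "x \<noteq> 0" using xy(1) by (auto simp: cross_def)
  then have "P \<noteq> 0" using P by auto
  define g where "g = gcd P (gcd T R)"
  have g0: "g \<noteq> 0" using \<open>P \<noteq> 0\<close> by (simp add: g_def)
  have "g dvd P" "g dvd T" "g dvd R"
    unfolding g_def by (auto intro: dvd_trans[OF gcd_dvd2])
  then obtain A B C where ABC: "P = g * A" "T = g * B" "R = g * C" by (auto elim!: dvdE)
  have "gcd A (gcd B C) = 1"
  proof -
    have "\<bar>g\<bar> * gcd A (gcd B C) = gcd (g * A) (g * gcd B C)"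
      by (simp add: gcd_mult_distrib_int)
    also have "\<dots> = gcd (g * A) (gcd (g * B) (g * C))"
      by (metis abs_mult gcd.commute gcd_abs1_int gcd_mult_distrib_int abs_gcd_int)
    also have "\<dots> = \<bar>g\<bar>" unfolding ABC[symmetric] by (simp add: g_def)
    finally show ?thesis using g0 by simp
  qed
  \<comment> \<open>The factor 2 excludes \<open>q = 0\<close>, which would still be coprime to
    \<open>k = 1\<close>.\<close>
  moreover have "2 * k \<noteq> 0" using k by simp
  ultimately obtain i j where ij: "coprime (A * i\<^sup>2 + B * i * j + C * j\<^sup>2) (2 * k)"
    by (rule primitive_form_represents_coprime)
  define q where "q = A * i\<^sup>2 + B * i * j + C * j\<^sup>2"
  define \<alpha> where "\<alpha> = of_int i * x + of_int j * y"
  \<comment> \<open>Dividing the norm form on \<open>J\<close> by its content \<open>g\<close> gives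
    \<open>w\<close> the integral trace \<open>B\<close> and the integral norm \<open>A * C\<close>,
    so maximality of the order puts \<open>w\<close> into \<open>Ord\<close>.\<close>
  define w where "w = cnj x * y / of_int g"
  have wF: "w \<in> F" unfolding w_def by (intro F_divide F_mult F_cnj xyO F_of_int)
  have w1: "w + cnj w = of_int B"
    using T g0 by (simp add: w_def ABC field_simps)
  have "w * cnj w = (x * cnj x) * (y * cnj y) / (of_int g * of_int g)" by (simp add: w_def)
  then have w2: "w * cnj w = of_int (A * C)" using g0 by (simp add: P R ABC)
  have "w * w = w * (w + cnj w) - w * cnj w" by (simp add: algebra_simps)
  then have "w * w = of_int B * w - of_int (A * C)" unfolding w1 w2 by (simp add: mult.commute)
  then have wO: "w \<in> Ord" using wF quadratic_integral by blast
  have form: "cnj (of_int i * x + of_int j * y) * (of_int i' * x + of_int j' * y)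
      = of_int g * (of_int (i * i' * A + j * j' * C) + of_int (i * j') * w + of_int (j * i') * cnj w)" for i j i' j'
  proof -
    have "cnj (of_int i * x + of_int j * y) * (of_int i' * x + of_int j' * y)
      = of_int (i * i') * (x * cnj x) + of_int (j * j') * (y * cnj y)
        + of_int (i * j') * (cnj x * y) + of_int (j * i') * cnj (cnj x * y)"
      by (simp add: algebra_simps)
    also have "cnj x * y = of_int g * w" using g0 by (simp add: w_def)
    finally show ?thesis by (simp add: P R ABC algebra_simps)
  qed
  have norm: "cnj \<alpha> * \<alpha> = of_int g * of_int q"
  proof -
    have "cnj \<alpha> * \<alpha> = of_int g * (of_int (i * i * A + j * j * C) + of_int (i * j) * (w + cnj w))"
      unfolding \<alpha>_def form by (simp add: algebra_simps)
    then show ?thesis unfolding w1 by (simp add: q_def power2_eq_square algebra_simps)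
  qed
  have "q \<noteq> 0" using ij by (auto simp: q_def[symmetric])
  then have "\<alpha> \<noteq> 0" using norm g0 by auto
  moreover have "\<exists>r\<in>Ord. of_int q * z = \<alpha> * r" if zJ: "z \<in> J" for z
  proof -
    obtain i' j' where z: "z = of_int i' * x + of_int j' * y" using zJ xy(2) by (blast elim: ZlatE)
    define r where "r = of_int (i * i' * A + j * j' * C) + of_int (i * j') * w + of_int (j * i') * cnj w"
    have "r \<in> Ord" unfolding r_def by (intro Ord_add Ord_mult Ord_of_int wO Ord_cnj)
    moreover have "of_int g * (of_int q * z) = of_int g * (\<alpha> * r)"
    proof -
      have "of_int g * (of_int q * z) = \<alpha> * (cnj \<alpha> * z)" using norm by (simp add: mult_ac)
      also have "cnj \<alpha> * z = of_int g * r" unfolding \<alpha>_def z r_def by (rule form)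
      finally show ?thesis by (simp add: mult_ac)
    qed
    ultimately show ?thesis using g0 by auto
  qed
  moreover have "\<alpha> \<in> J" unfolding \<alpha>_def xy(2) by (rule ZlatI)
  moreover have "coprime q k" using ij by (simp add: q_def)
  ultimately show thesis using that by blast
qed

text \<open>Multiplication by \<alpha> induces an isomorphism from \<open>Ord\<close> modulo
  \<open>k\<close> to \<open>J\<close> modulo \<open>k\<close>: \<open>decomp\<close> makes it onto,
  \<open>cancel\<close> one-to-one. Subgroups of index \<open>k\<close> contain all
  \<open>k\<close>-fold multiples, so taking preimages under it is a bijection between them; it
  remains to see that this respects the condition on \<open>ospan\<close>.\<close>

lemma card_gens:
  assumes J: "olat J" and k: "k > 0"
  shows "card (gens J k) = card (gens Ord k)"
proof -
  have "int k \<noteq> 0" using k by simp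
  then obtain \<alpha> q where \<alpha>: "\<alpha> \<in> J" "\<alpha> \<noteq> 0" "coprime q (int k)"
    and q: "\<And>z. z \<in> J \<Longrightarrow> \<exists>r\<in>Ord. of_int q * z = \<alpha> * r"
    using generator_modulo[OF J] by metis
  \<comment> \<open>Bezout makes \<open>q\<close> invertible modulo \<open>k\<close>, with inverse
    \<open>s\<close>; thus the divisibility of \<open>q z\<close> by \<alpha> becomes divisibility
    of \<open>z\<close> modulo \<open>k\<close>.\<close>
  obtain s t where st: "s * q + t * int k = 1" using \<alpha>(3) bezout_int[of q "int k"] by auto
  have st': "of_int s * of_int q * z + of_int t * of_nat k * z = (z::complex)" for z
  proof -
    have "of_int (s * q + t * int k) * z = z" by (simp add: st)
    then show ?thesis by (simp add: algebra_simps)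
  qed
  have Jsub: "subgrp J" using J by (simp add: olat_def)
  have \<alpha>O: "\<alpha> * r \<in> J" if "r \<in> Ord" for r using olat_mult[OF J that \<alpha>(1)] by (simp add: mult.commute)
  have decomp: "\<exists>r\<in>Ord. z - \<alpha> * r \<in> (\<lambda>z. of_nat k * z) ` J" if z: "z \<in> J" for z
  proof -
    obtain r where r: "r \<in> Ord" "of_int q * z = \<alpha> * r" using q[OF z] by blast
    have "z = of_int s * (of_int q * z) + of_nat k * (of_int t * z)"
      using st'[of z] by (simp add: mult_ac)
    then have "z - \<alpha> * (of_int s * r) = of_nat k * (of_int t * z)"
      unfolding r(2) by (simp add: algebra_simps)
    then show ?thesis using r(1) z Jsub
      by (intro bexI[of _ "of_int s * r"]) (auto intro: subgrp_of_int_mult Ord_mult Ord_of_int)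
  qed
  have cancel: "x \<in> (\<lambda>z. of_nat k * z) ` Ord"
    if x: "x \<in> Ord" and xk: "\<alpha> * x \<in> (\<lambda>z. of_nat k * z) ` J" for x
  proof -
    obtain j where j: "j \<in> J" "\<alpha> * x = of_nat k * j" using xk by auto
    obtain r where r: "r \<in> Ord" "of_int q * j = \<alpha> * r" using q[OF j(1)] by blast
    have "\<alpha> * (of_int q * x) = of_nat k * (of_int q * j)"
      using j(2) by (simp add: mult_ac)
    then have "\<alpha> * (of_int q * x) = \<alpha> * (of_nat k * r)"
      unfolding r(2) by (simp add: mult_ac)
    then have qx: "of_int q * x = of_nat k * r" using \<alpha>(2) by simp
    have "x = of_int s * (of_int q * x) + of_nat k * (of_int t * x)"
      using st'[of x] by (simp add: mult_ac)
    then have "x = of_nat k * (of_int s * r + of_int t * x)"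
      unfolding qx by (simp add: algebra_simps)
    moreover have "of_int s * r + of_int t * x \<in> Ord"
      using r(1) x by (intro Ord_add Ord_mult Ord_of_int)
    ultimately show ?thesis by blast
  qed
  have kM: "(\<lambda>z. of_nat k * z) ` A \<subseteq> M" if "olat A" "M \<in> subs A k" for A M
    using index_multiple_mem[OF olat_planar[OF that(1)], of M] that(2) k by (auto simp: subs_def)
  define \<Psi> where "\<Psi> M = {x \<in> Ord. \<alpha> * x \<in> M}" for M
  have \<Psi>_idx: "subgrp (\<Psi> M) \<and> index Ord (\<Psi> M) = index J M"
    if M: "subgrp M" "(\<lambda>z. of_nat k * z) ` J \<subseteq> M" for M
  proof
    show s: "subgrp (\<Psi> M)"
      using M(1) by (auto simp: subgrp_def \<Psi>_def algebra_simps intro: Ord_diff subgrp_zero[OF subgrp_Ord])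
    show "index Ord (\<Psi> M) = index J M"
    proof (rule index_transfer[where f = "\<lambda>x. \<alpha> * x"])
      show "\<exists>x\<in>Ord. y - \<alpha> * x \<in> M" if "y \<in> J" for y
        using decomp[OF that] M(2) by blast
      show "x - y \<in> \<Psi> M \<longleftrightarrow> \<alpha> * (x - y) \<in> M" if "x \<in> Ord" "y \<in> Ord" for x y
        using Ord_diff[OF that] by (simp add: \<Psi>_def)
    qed (use M s \<alpha>O in \<open>auto simp: right_diff_distrib\<close>)
  qed
  have "bij_betw \<Psi> (gens J k) (gens Ord k)"
    unfolding bij_betw_def
  proof
    show "inj_on \<Psi> (gens J k)"
    proof (rule inj_onI)
      have sub: "M \<subseteq> M'" if M: "M \<in> gens J k" "M' \<in> gens J k" and eq: "\<Psi> M = \<Psi> M'" for M M'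
      proof
        fix z assume z: "z \<in> M"
        have MM: "M \<in> subs J k" "M' \<in> subs J k" "subgrp M" "subgrp M'" "M \<subseteq> J"
          using M by (auto simp: gens_def subs_def)
        obtain r where r: "r \<in> Ord" "z - \<alpha> * r \<in> (\<lambda>z. of_nat k * z) ` J"
          using decomp[of z] z MM(5) by auto
        have *: "z - \<alpha> * r \<in> M" "z - \<alpha> * r \<in> M'" using kM[OF J] MM r(2) by blast+
        have "z - (z - \<alpha> * r) \<in> M" by (rule subgrp_diff[OF MM(3) z *(1)])
        then have "r \<in> \<Psi> M" using r(1) by (simp add: \<Psi>_def)
        then have "\<alpha> * r \<in> M'" unfolding eq by (simp add: \<Psi>_def)
        then have "\<alpha> * r + (z - \<alpha> * r) \<in> M'" using subgrp_add[OF MM(4) _ *(2)] by blast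
        then show "z \<in> M'" by simp
      qed
      fix M M' assume "M \<in> gens J k" "M' \<in> gens J k" "\<Psi> M = \<Psi> M'"
      then show "M = M'" using sub[of M M'] sub[of M' M] by blast
    qed
    show "\<Psi> ` gens J k = gens Ord k"
    proof (intro equalityI subsetI)
      fix N assume "N \<in> \<Psi> ` gens J k"
      then obtain M where M: "M \<in> subs J k" "ospan M = J" "N = \<Psi> M" by (auto simp: gens_def)
      have N: "N \<in> subs Ord k"
        using \<Psi>_idx[of M] kM[OF J M(1)] M by (auto simp: subs_def \<Psi>_def)
      have Msub: "subgrp M" using M by (simp add: subs_def)
      have Nsub: "subgrp N" using N by (simp add: subs_def)
      have dec: "\<exists>r j. r \<in> N \<and> j \<in> J \<and> z = \<alpha> * r + of_nat k * j" if z: "z \<in> M" for z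
      proof -
        obtain r j where r: "r \<in> Ord" "j \<in> J" "z - \<alpha> * r = of_nat k * j"
          using decomp[of z] z M(1) by (auto simp: subs_def)
        then have "z - \<alpha> * r \<in> M" using kM[OF J M(1)] by auto
        then have "z - (z - \<alpha> * r) \<in> M" by (rule subgrp_diff[OF Msub z])
        then have "r \<in> N" using r(1) M(3) by (simp add: \<Psi>_def)
        then show ?thesis using r by (intro exI[of _ r] exI[of _ j]) (simp add: algebra_simps)
      qed
      obtain z1 z2 where z: "\<alpha> = z1 + tau * z2" "z1 \<in> M" "z2 \<in> M"
        using \<alpha>(1) M(2) by (auto simp: ospan_def)
      obtain r1 j1 where 1: "r1 \<in> N" "j1 \<in> J" "z1 = \<alpha> * r1 + of_nat k * j1" using dec[OF z(2)] by blast
      obtain r2 j2 where 2: "r2 \<in> N" "j2 \<in> J" "z2 = \<alpha> * r2 + of_nat k * j2" using dec[OF z(3)] by blast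
      \<comment> \<open>The error in writing 1 as an element of \<open>ospan N\<close>. Multiplied
        by \<alpha> it lies in \<open>k J\<close>, so \<open>cancel\<close> puts it into
        \<open>k Ord\<close>, hence into \<open>N\<close>; therefore 1 is in
        \<open>ospan N\<close>.\<close>
      define e where "e = 1 - (r1 + tau * r2)"
      have NO: "N \<subseteq> Ord" using N by (simp add: subs_def)
      have "\<alpha> * e = \<alpha> - (\<alpha> * r1 + tau * (\<alpha> * r2))" by (simp add: e_def algebra_simps)
      also have "\<dots> = of_nat k * (j1 + tau * j2)"
        by (subst (1) z(1)) (simp add: 1(3) 2(3) algebra_simps)
      finally have "\<alpha> * e \<in> (\<lambda>z. of_nat k * z) ` J"
        using 1 2 Jsub olat_mult[OF J tau_Ord] by (auto intro: subgrp_add)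
      moreover have "e \<in> Ord"
        unfolding e_def using 1 2 NO by (intro Ord_diff Ord_add Ord_mult one_Ord tau_Ord) auto
      ultimately have "e \<in> N" using cancel kM[OF olat_Ord N] by blast
      then have "e + (r1 + tau * r2) \<in> ospan N"
        using ospan_superset[OF Nsub] \<open>e \<in> N\<close>
        by (intro subgrp_add ospan_subgrp[OF Nsub] ospanI 1(1) 2(1)) blast
      then have "1 \<in> ospan N" by (simp add: e_def)
      then have "r * 1 \<in> ospan N" if "r \<in> Ord" for r
        using Ord_mult_closed[OF ospan_subgrp[OF Nsub] ospan_tau[OF Nsub] that] by blast
      then have "ospan N = Ord" using olat_ospan_least[OF olat_Ord NO] by auto
      then show "N \<in> gens Ord k" using N by (simp add: gens_def)
    next
      fix N assume "N \<in> gens Ord k"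
      then have N: "N \<in> subs Ord k" "ospan N = Ord" "subgrp N" "N \<subseteq> Ord"
        by (auto simp: gens_def subs_def)
      \<comment> \<open>A preimage of \<open>N\<close> must contain \<alpha> \<open>N\<close> and
        \<open>k J\<close>; their sum is already large enough.\<close>
      define M where "M = {\<alpha> * r + of_nat k * j | r j. r \<in> N \<and> j \<in> J}"
      have Msub: "subgrp M"
        unfolding subgrp_def
      proof (intro conjI ballI)
        show "0 \<in> M" unfolding M_def using subgrp_zero[OF N(3)] subgrp_zero[OF Jsub]
          by (auto intro!: exI[of _ 0])
        fix z w assume "z \<in> M" "w \<in> M"
        then obtain r j r' j' where *: "r \<in> N" "j \<in> J" "r' \<in> N" "j' \<in> J"
          "z = \<alpha> * r + of_nat k * j" "w = \<alpha> * r' + of_nat k * j'" by (auto simp: M_def)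
        then have "z - w = \<alpha> * (r - r') + of_nat k * (j - j')" by (simp add: algebra_simps)
        then show "z - w \<in> M" unfolding M_def
          using * subgrp_diff[OF N(3)] subgrp_diff[OF Jsub] by blast
      qed
      have kJM: "(\<lambda>z. of_nat k * z) ` J \<subseteq> M"
      proof clarify
        fix j assume "j \<in> J"
        then have "\<alpha> * 0 + of_nat k * j \<in> M" unfolding M_def using subgrp_zero[OF N(3)] by blast
        then show "of_nat k * j \<in> M" by simp
      qed
      have \<alpha>N: "\<alpha> * r \<in> M" if "r \<in> N" for r
      proof -
        have "\<alpha> * r + of_nat k * 0 \<in> M" unfolding M_def using subgrp_zero[OF Jsub] that by blast
        then show ?thesis by simp
      qed
      have MJ: "M \<subseteq> J"
        using N(4) \<alpha>O Jsub by (auto simp: M_def intro!: subgrp_add subgrp_of_nat_mult)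
      have \<Psi>: "\<Psi> M = N"
      proof (intro equalityI subsetI)
        fix x assume "x \<in> \<Psi> M"
        then obtain r j where *: "x \<in> Ord" "r \<in> N" "j \<in> J" "\<alpha> * x = \<alpha> * r + of_nat k * j"
          by (auto simp: \<Psi>_def M_def)
        then have "\<alpha> * (x - r) = of_nat k * j" by (simp add: algebra_simps)
        then have "x - r \<in> (\<lambda>z. of_nat k * z) ` Ord"
          using * N(4) by (intro cancel Ord_diff) auto
        then have "x - r \<in> N" using kM[OF olat_Ord N(1)] by blast
        then have "(x - r) + r \<in> N" using * by (intro subgrp_add N)
        then show "x \<in> N" by simp
      qed (use N(4) \<alpha>N in \<open>auto simp: \<Psi>_def\<close>)
      have "index J M = k" using \<Psi>_idx[OF Msub kJM] N(1) by (simp add: \<Psi> subs_def)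
      then have "M \<in> subs J k" using Msub MJ by (simp add: subs_def)
      moreover have "ospan M = J"
      proof
        show "ospan M \<subseteq> J" by (rule olat_ospan_least[OF J MJ])
        show "J \<subseteq> ospan M"
        proof
          fix z assume "z \<in> J"
          then obtain r j where *: "r \<in> Ord" "j \<in> J" "z - \<alpha> * r = of_nat k * j" using decomp by blast
          obtain r1 r2 where r: "r = r1 + tau * r2" "r1 \<in> N" "r2 \<in> N"
            using *(1) unfolding N(2)[symmetric] ospan_def by blast
          have "z = (\<alpha> * r1 + of_nat k * j) + tau * (\<alpha> * r2)"
            using *(3) by (simp add: r(1) algebra_simps)
          moreover have "\<alpha> * r1 + of_nat k * j \<in> M" "\<alpha> * r2 \<in> M"
            using r *(2) \<alpha>N by (auto simp: M_def)
          ultimately show "z \<in> ospan M" by (auto simp: ospan_def)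
        qed
      qed
      ultimately have "M \<in> gens J k" by (simp add: gens_def)
      then show "N \<in> \<Psi> ` gens J k" using \<Psi> by blast
    qed
  qed
  then show ?thesis by (rule bij_betw_same_card)
qed

end

section \<open>Maximality from the discriminant\<close>

lemma det_vector_2: "det (vector [vector [p, q], vector [r, t]] :: 'a::comm_ring_1^2^2) = p * t - q * r"
  by (simp add: det_2)

text \<open>The determinant in the discriminant is \<open>-2 * \<i>\<close> times the oriented area
  of an integral basis, so \<open>D\<close> is -4 times the squared covolume of the ring of
  integers. The covolume of \<open>Ord\<close> gives the same \<open>D\<close>, and
  \<open>Ord\<close> consists of integers; hence its index in them is 1.\<close>

lemma (in imaginary_quadratic) quadratic_order_if_discriminant:
  assumes "is_discriminant D F"
  shows "quadratic_order b n D F"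
proof
  fix z assume z: "z \<in> F" "algebraic_int z"
  obtain \<omega>1 \<omega>2 where bij: "bij_betw (\<lambda>(m, n). of_int m * \<omega>1 + of_int n * \<omega>2) (UNIV :: (int \<times> int) set) (\<O> F)"
    and det: "of_int D = (det (vector [vector [\<omega>1, \<omega>2], vector [cnj \<omega>1, cnj \<omega>2]] :: complex^2^2))\<^sup>2"
    using assms by (auto simp: is_discriminant_def)
  have O: "\<O> F = Zlat \<omega>1 \<omega>2"
    unfolding bij_betw_imp_surj_on[OF bij, symmetric] by (auto simp: Zlat_def image_iff)
  have "Ord \<subseteq> \<O> F" using Ord_F Ord_algebraic_int by (auto simp: integers_def)
  then have sub: "Zlat 1 tau \<subseteq> Zlat \<omega>1 \<omega>2" by (simp add: O Ord_def)
  have "\<omega>1 * cnj \<omega>2 - \<omega>2 * cnj \<omega>1 = - 2 * \<i> * of_real (cross \<omega>1 \<omega>2)"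
    by (rule complex_eqI) (simp_all add: cross_def algebra_simps)
  then have "of_int D = (- 2 * \<i> * of_real (cross \<omega>1 \<omega>2))\<^sup>2"
    using det unfolding det_vector_2 by simp
  then have "of_int D = - 4 * complex_of_real ((cross \<omega>1 \<omega>2)\<^sup>2)"
    by (simp add: power_mult_distrib)
  then have "Re (of_int D) = Re (- 4 * complex_of_real ((cross \<omega>1 \<omega>2)\<^sup>2))" by (rule arg_cong)
  then have "(cross \<omega>1 \<omega>2)\<^sup>2 = - of_int D / 4" by simp
  moreover have "(cross 1 tau)\<^sup>2 = - of_int D / 4"
    using D_neg by (simp add: cross_def Im_tau power_divide)
  ultimately have "(cross 1 tau)\<^sup>2 = (cross \<omega>1 \<omega>2)\<^sup>2" by (simp only:)
  then have eq: "\<bar>cross 1 tau\<bar> = \<bar>cross \<omega>1 \<omega>2\<bar>" unfolding power2_eq_iff abs_eq_iff .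
  then have nz: "cross \<omega>1 \<omega>2 \<noteq> 0" using cross_1_tau by auto
  have "index (Zlat \<omega>1 \<omega>2) (Zlat 1 tau) = 1"
    using index_cross(1)[OF nz cross_1_tau sub] eq nz by simp
  moreover have "planar (Zlat \<omega>1 \<omega>2)" using nz by (auto simp: planar_def)
  moreover have "z \<in> Zlat \<omega>1 \<omega>2" using z O by (auto simp: integers_def)
  ultimately have "of_nat 1 * z \<in> Zlat 1 tau"
    using index_multiple_mem[OF _ subgrp_Zlat sub, of z] by simp
  then show "z \<in> Ord" by (simp add: Ord_def)
qed

section \<open>Rotations, reflections and ideal classes\<close>

context quadratic_order
begin

definition U :: "complex set" where "U = {u \<in> F. cmod u = 1}"

lemma U_nonzero: "u \<in> U \<Longrightarrow> u \<noteq> 0"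
  by (auto simp: U_def)

lemma U_mult: "u \<in> U \<Longrightarrow> v \<in> U \<Longrightarrow> u * v \<in> U"
  and U_divide: "u \<in> U \<Longrightarrow> v \<in> U \<Longrightarrow> u / v \<in> U"
  by (auto simp: U_def norm_mult norm_divide F_mult F_divide)

lemma U_cnj: "u \<in> U \<Longrightarrow> cnj u \<in> U" and U_minus: "u \<in> U \<Longrightarrow> - u \<in> U"
  using F_mult[OF F_of_int[of "-1"], of u] by (auto simp: U_def F_cnj)

lemma one_U: "1 \<in> U"
  using F_of_int[of 1] by (simp add: U_def)

lemma cmul_image_cmul: "cmul u ` cmul v ` M = cmul (u * v) ` M"
  and cmul_image_ccmul: "cmul u ` ccmul v ` M = ccmul (u * v) ` M"
  and cmul_image_cnj: "cmul u ` cnj ` M = ccmul u ` M"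
  by (simp_all add: image_image cmul_def ccmul_def mult_ac)

lemma cmul_image_one: "cmul 1 ` M = M"
  by (simp add: cmul_def)

lemma subgrp_similar:
  "subgrp M \<Longrightarrow> subgrp (cmul u ` M)" "subgrp M \<Longrightarrow> subgrp (ccmul u ` M)"
  by (rule subgrp_image; simp add: cmul_def ccmul_def algebra_simps)+

lemma Ord_cmod:
  assumes "z \<in> Ord" obtains m :: int where "(cmod z)\<^sup>2 = of_int m"
proof -
  obtain m t where "z * cnj z = of_int m" using Ord_norm_trace[OF assms] by metis
  then have "complex_of_real ((cmod z)\<^sup>2) = complex_of_real (of_int m)"
    unfolding complex_norm_square by simp
  then show thesis using that by (simp only: of_real_eq_iff)
qed

text \<open>The imaginary part bounds \<open>j\<close> by \<open>2 * r\<close>, because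
  \<open>Im tau\<close> is at least 1/2 in absolute value; the real part then bounds
  \<open>i\<close>. The constant \<open>N\<close> exceeds both bounds.\<close>

lemma finite_Ord_cmod: "finite {z \<in> Ord. cmod z = r}"
proof -
  define N where "N = \<lceil>2 * r + 2 * r * (\<bar>of_int b\<bar> + 1)\<rceil>"
  have "{z \<in> Ord. cmod z = r} \<subseteq> (\<lambda>(i, j). of_int i + of_int j * tau) ` ({- N..N} \<times> {- N..N})"
  proof
    fix z assume z: "z \<in> {z \<in> Ord. cmod z = r}"
    then obtain i j where ij: "z = of_int i + of_int j * tau" by (auto elim: OrdE)
    have r: "r \<ge> 0" "\<bar>Re z\<bar> \<le> r" "\<bar>Im z\<bar> \<le> r"
      using z abs_Re_le_cmod[of z] abs_Im_le_cmod[of z] by auto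
    have "sqrt (- of_int D) \<ge> 1" using D_neg by simp
    then have "\<bar>of_int j\<bar> * 1 \<le> \<bar>of_int j\<bar> * sqrt (- of_int D)" by (intro mult_left_mono) auto
    also have "\<dots> = 2 * \<bar>Im z\<bar>" using D_neg by (simp add: ij Im_tau abs_mult)
    finally have j: "\<bar>real_of_int j\<bar> \<le> 2 * r" using r by simp
    have "Re z = of_int i + of_int j * of_int b / 2" by (simp add: ij Re_tau)
    then have "real_of_int i = Re z - of_int j * of_int b / 2" by simp
    then have "\<bar>real_of_int i\<bar> \<le> r + \<bar>of_int j * of_int b / 2\<bar>" using r by linarith
    also have "\<bar>real_of_int j * of_int b / 2\<bar> \<le> 2 * r * \<bar>of_int b\<bar>"
    proof -
      have "\<bar>real_of_int j\<bar> * \<bar>of_int b\<bar> \<le> 2 * r * \<bar>of_int b\<bar>" by (rule mult_right_mono[OF j]) simp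
      moreover have "0 \<le> r * \<bar>real_of_int b\<bar>" using r by simp
      ultimately show ?thesis by (simp add: abs_mult)
    qed
    finally have i: "\<bar>real_of_int i\<bar> \<le> r + 2 * r * \<bar>of_int b\<bar>" by simp
    have "0 \<le> 2 * r * \<bar>real_of_int b\<bar>" using r by simp
    then have "\<bar>real_of_int i\<bar> \<le> of_int N" "\<bar>real_of_int j\<bar> \<le> of_int N"
      using i j r le_of_int_ceiling[of "2 * r + 2 * r * (\<bar>real_of_int b\<bar> + 1)"]
      unfolding N_def[symmetric] by (simp_all add: algebra_simps)
    then have "\<bar>i\<bar> \<le> N" "\<bar>j\<bar> \<le> N" by (metis of_int_abs of_int_le_iff)+
    then show "z \<in> (\<lambda>(i, j). of_int i + of_int j * tau) ` ({- N..N} \<times> {- N..N})"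
      by (auto simp: ij intro!: image_eqI[of _ _ "(i, j)"])
  qed
  then show ?thesis by (rule finite_subset) auto
qed

text \<open>The factor \<open>u\<close> is determined by the image of one nonzero \<open>x\<close>,
  and that image is a point of \<open>Ord\<close> on the circle through \<open>x\<close>. This makes
  the cardinalities of such sets meaningful.\<close>

lemma finite_similarities:
  assumes "A \<subseteq> Ord" "x \<in> M" "x \<noteq> 0" and f: "f \<in> {cmul, ccmul}"
  shows "finite {u \<in> U. f u ` M \<subseteq> A}"
proof (rule finite_imageD)
  have "(\<lambda>u. f u x) ` {u \<in> U. f u ` M \<subseteq> A} \<subseteq> {z \<in> Ord. cmod z = cmod x}"
    using assms by (auto simp: U_def cmul_def ccmul_def norm_mult)
  then show "finite ((\<lambda>u. f u x) ` {u \<in> U. f u ` M \<subseteq> A})"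
    using finite_Ord_cmod finite_subset by blast
  show "inj_on (\<lambda>u. f u x) {u \<in> U. f u ` M \<subseteq> A}"
    using assms by (auto simp: inj_on_def cmul_def ccmul_def)
qed

lemma subs_similar:
  assumes A: "olat A" and m: "m > 0" and M: "M \<in> subs A m" and u: "u \<in> U"
    and f: "f \<in> {cmul, ccmul}" and sub: "f u ` M \<subseteq> A"
  shows "f u ` M \<in> subs A m"
proof -
  have "real (index A (f u ` M)) = (cmod u)\<^sup>2 * real (index A M)"
    by (rule index_similarity(2)[OF olat_planar[OF A]])
      (use M m f sub U_nonzero[OF u] in \<open>auto simp: subs_def\<close>)
  then have "index A (f u ` M) = m" using u M by (simp add: U_def subs_def)
  moreover have "subgrp (f u ` M)" using f M subgrp_similar by (auto simp: subs_def)
  ultimately show ?thesis using sub by (simp add: subs_def)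
qed

text \<open>Under \<open>ccmul u\<close>, multiplication of the image by \<open>tau\<close>
  corresponds to multiplication by \<open>cnj tau\<close> in \<open>J\<close>, and
  \<open>Ord\<close> is closed under conjugation.\<close>

lemma tau_closed_similar:
  assumes J: "olat J" and f: "f \<in> {cmul, ccmul}" and z: "z \<in> f u ` J"
  shows "tau * z \<in> f u ` J"
proof -
  obtain x where x: "x \<in> J" "z = f u x" using z by auto
  have "cmul u (tau * x) = tau * cmul u x" "ccmul u (cnj tau * x) = tau * ccmul u x"
    by (simp_all add: cmul_def ccmul_def)
  moreover have "tau * x \<in> J" "cnj tau * x \<in> J"
    using x J tau_Ord Ord_cnj olat_mult by auto
  ultimately show ?thesis using f x by (metis emptyE imageI insertE)
qed

lemma ideals_similar:
  assumes A: "olat A" and d: "d > 0" and J: "J \<in> ideals A d" and u: "u \<in> U"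
    and f: "f \<in> {cmul, ccmul}" and sub: "f u ` J \<subseteq> A"
  shows "f u ` J \<in> ideals A d"
  using subs_similar[OF A d _ u f sub] tau_closed_similar[OF ideals_olat[OF A d J] f] J
  by (auto simp: ideals_def)

section \<open>Ideals and ideal classes in algebraic terms\<close>

lemma integers_F: "\<O> F = Ord"
proof (intro equalityI subsetI)
  fix z assume "z \<in> \<O> F"
  then show "z \<in> Ord" using integral by (simp add: integers_def)
qed (use Ord_F Ord_algebraic_int in \<open>auto simp: integers_def\<close>)

lemma ring_integer_ring: "ring (integer_ring F)"
proof (rule ringI)
  let ?R = "integer_ring F"
  show "abelian_group ?R"
  proof (rule abelian_groupI)
    show "\<exists>y\<in>carrier ?R. y \<oplus>\<^bsub>?R\<^esub> x = \<zero>\<^bsub>?R\<^esub>" if "x \<in> carrier ?R" for x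
      using that subgrp_minus[OF subgrp_Ord, of x]
      by (auto simp: integer_ring_def integers_F intro!: bexI[of _ "- x"])
  qed (auto simp: integer_ring_def integers_F Ord_add subgrp_zero[OF subgrp_Ord] add_ac)
  show "Group.monoid ?R"
    by (rule monoidI) (auto simp: integer_ring_def integers_F Ord_mult one_Ord mult_ac)
qed (auto simp: integer_ring_def algebra_simps)

text \<open>The bridge from ideals of the ring structure to plain closure conditions on sets of
  complex numbers, which is the language of all counting arguments.\<close>

lemma ideal_integer_ring_iff:
  "ideal J (integer_ring F) \<longleftrightarrow> subgrp J \<and> J \<subseteq> Ord \<and> (\<forall>r\<in>Ord. \<forall>x\<in>J. r * x \<in> J)"
  (is "?L \<longleftrightarrow> ?R")
proof
  assume ?L
  then interpret ideal J "integer_ring F" .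
  have mult: "r * x \<in> J" if "r \<in> Ord" "x \<in> J" for r x
    using I_l_closed[of x r] that by (simp add: integer_ring_def integers_F)
  have add: "x + y \<in> J" if "x \<in> J" "y \<in> J" for x y
    using additive_subgroup.a_closed[OF additive_subgroup_axioms that] by (simp add: integer_ring_def)
  have "0 \<in> J" using additive_subgroup.zero_closed[OF additive_subgroup_axioms] by (simp add: integer_ring_def)
  moreover have "x - y \<in> J" if "x \<in> J" "y \<in> J" for x y
    using add[OF that(1) mult[OF Ord_of_int[of "-1"] that(2)]] by simp
  moreover have "J \<subseteq> Ord" using a_subset by (simp add: integer_ring_def integers_F)
  ultimately show ?R using mult by (auto simp: subgrp_def)
next
  assume R: ?R
  show ?L
  proof (rule idealI[OF ring_integer_ring])
    interpret ring "integer_ring F" by (rule ring_integer_ring)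
    show "subgroup J (add_monoid (integer_ring F))"
    proof (rule add.subgroupI)
      show "J \<subseteq> carrier (integer_ring F)" using R by (simp add: integer_ring_def integers_F)
      show "J \<noteq> {}" using R subgrp_zero by blast
      fix x assume x: "x \<in> J"
      then have "x \<in> carrier (integer_ring F)" using R by (auto simp: integer_ring_def integers_F)
      moreover have "- x \<in> J" using R x subgrp_minus by blast
      moreover have "- x \<in> carrier (integer_ring F)" "- x \<oplus>\<^bsub>integer_ring F\<^esub> x = \<zero>\<^bsub>integer_ring F\<^esub>"
        using R \<open>- x \<in> J\<close> by (auto simp: integer_ring_def integers_F)
      ultimately have "\<ominus>\<^bsub>integer_ring F\<^esub> x = - x" by (intro minus_equality)
      then show "\<ominus>\<^bsub>integer_ring F\<^esub> x \<in> J" using \<open>- x \<in> J\<close> by simp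
    next
      fix x y assume "x \<in> J" "y \<in> J"
      then show "x \<oplus>\<^bsub>integer_ring F\<^esub> y \<in> J" using R subgrp_add by (auto simp: integer_ring_def)
    qed
    fix a x assume "a \<in> J" "x \<in> carrier (integer_ring F)"
    then have "x * a \<in> J" using R by (auto simp: integer_ring_def integers_F)
    then show "x \<otimes>\<^bsub>integer_ring F\<^esub> a \<in> J" "a \<otimes>\<^bsub>integer_ring F\<^esub> x \<in> J"
      by (simp_all add: integer_ring_def mult.commute)
  qed
qed

lemma fractional_idealD:
  assumes "fractional_ideal F J"
  shows "subgrp J" "r \<in> Ord \<Longrightarrow> x \<in> J \<Longrightarrow> r * x \<in> J"
proof -
  obtain d where d: "d \<noteq> 0" "ideal ((*) d ` J) (integer_ring F)"
    using assms by (auto simp: fractional_ideal_def)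
  have inj: "inj ((*) d)" using d(1) by (simp add: inj_def)
  have dJ: "subgrp ((*) d ` J)" "\<And>r x. r \<in> Ord \<Longrightarrow> x \<in> J \<Longrightarrow> d * (r * x) \<in> (*) d ` J"
    using d(2) by (auto simp: ideal_integer_ring_iff mult.left_commute)
  have "inverse d * (d * x) = x" for x using d(1) by simp
  then have "(*) (inverse d) ` (*) d ` J = J" by (simp only: image_image image_ident)
  moreover have "subgrp ((*) (inverse d) ` (*) d ` J)"
    by (rule subgrp_image[OF dJ(1)]) (simp add: algebra_simps)
  ultimately show "subgrp J" by simp
  show "r * x \<in> J" if "r \<in> Ord" "x \<in> J"
    using dJ(2)[OF that] inj by (simp add: inj_image_mem_iff)
qed

text \<open>A fractional ideal inside \<open>A\<close> lies in \<open>Ord\<close>, so its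
  denominator can be taken to be 1; the ideals of the theorem are therefore those counted by
  \<open>ideals\<close>.\<close>

lemma ideals_iff_fractional:
  assumes A: "olat A" and d: "d > 0"
  shows "J \<in> ideals A d \<longleftrightarrow> fractional_ideal F J \<and> J \<subseteq> A \<and> index A J = d"
proof
  assume J: "J \<in> ideals A d"
  note oJ = ideals_olat[OF A d J]
  obtain x where "x \<in> J" "x \<noteq> 0" using planar_nonzero[OF olat_planar[OF oJ]] .
  then have "J \<noteq> {0}" by auto
  moreover have "ideal ((*) 1 ` J) (integer_ring F)"
    using oJ olat_mult[OF oJ] by (auto simp: ideal_integer_ring_iff olat_def)
  ultimately have "fractional_ideal F J"
    unfolding fractional_ideal_def integers_F using one_Ord
    by (intro conjI bexI[of _ 1]) auto
  then show "fractional_ideal F J \<and> J \<subseteq> A \<and> index A J = d"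
    using J by (auto simp: ideals_def subs_def)
next
  assume "fractional_ideal F J \<and> J \<subseteq> A \<and> index A J = d"
  then show "J \<in> ideals A d"
    using fractional_idealD tau_Ord by (auto simp: ideals_def subs_def)
qed

lemma fractional_ideal_cnj: "fractional_ideal F J \<Longrightarrow> fractional_ideal F (cnj ` J)"
proof -
  assume J: "fractional_ideal F J"
  then obtain d where d: "d \<in> Ord - {0}" "ideal ((*) d ` J) (integer_ring F)" "J \<noteq> {0}"
    by (auto simp: fractional_ideal_def integers_F)
  have eq: "(*) (cnj d) ` cnj ` J = cnj ` (*) d ` J" by (simp add: image_image)
  have K: "subgrp ((*) d ` J)" "(*) d ` J \<subseteq> Ord" "\<And>r x. r \<in> Ord \<Longrightarrow> x \<in> (*) d ` J \<Longrightarrow> r * x \<in> (*) d ` J"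
    using d(2) by (auto simp: ideal_integer_ring_iff)
  have "ideal (cnj ` (*) d ` J) (integer_ring F)"
    unfolding ideal_integer_ring_iff
  proof (intro conjI ballI)
    show "subgrp (cnj ` (*) d ` J)" by (rule subgrp_image[OF K(1)]) simp
    show "cnj ` (*) d ` J \<subseteq> Ord" using K(2) Ord_cnj by blast
    fix r x assume r: "r \<in> Ord" and "x \<in> cnj ` (*) d ` J"
    then obtain y where y: "y \<in> (*) d ` J" "x = cnj y" by blast
    have "r * x = cnj (cnj r * y)" by (simp add: y)
    then show "r * x \<in> cnj ` (*) d ` J" using K(3)[OF Ord_cnj[OF r] y(1)] by blast
  qed
  moreover have "cnj d \<in> Ord - {0}" using d(1) Ord_cnj by auto
  moreover have "cnj ` J \<noteq> {0}"
  proof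
    assume "cnj ` J = {0}"
    then have "cnj ` cnj ` J = {0}" by simp
    then show False using d(3) by (simp add: image_image)
  qed
  ultimately show ?thesis unfolding fractional_ideal_def integers_F eq[symmetric] by blast
qed

lemma ideal_class_eq_iff:
  assumes "fractional_ideal F J" "fractional_ideal F J'"
  shows "ideal_class F J = ideal_class F J' \<longleftrightarrow> (\<exists>\<alpha>\<in>F - {0}. J' = cmul \<alpha> ` J)"
proof -
  have mem: "K \<in> ideal_class F J \<longleftrightarrow> fractional_ideal F K \<and> (\<exists>\<alpha>\<in>F - {0}. K = cmul \<alpha> ` J)"
    if "fractional_ideal F J" for J K
    using that by (auto simp: ideal_class_def ideal_equiv_def cmul_def[abs_def])
  have trans: "\<exists>\<alpha>\<in>F - {0}. J3 = cmul \<alpha> ` J1"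
    if J: "\<exists>\<alpha>\<in>F - {0}. J2 = cmul \<alpha> ` J1" "\<exists>\<alpha>\<in>F - {0}. J3 = cmul \<alpha> ` J2" for J1 J2 J3
  proof -
    obtain \<alpha> \<beta> where *: "\<alpha> \<in> F - {0}" "\<beta> \<in> F - {0}" "J2 = cmul \<alpha> ` J1" "J3 = cmul \<beta> ` J2"
      using J by blast
    have "J3 = cmul (\<beta> * \<alpha>) ` J1" unfolding *(4) *(3) by (rule cmul_image_cmul)
    moreover have "\<beta> * \<alpha> \<in> F - {0}" using *(1,2) F_mult by simp
    ultimately show ?thesis by blast
  qed
  have sym: "\<exists>\<alpha>\<in>F - {0}. J1 = cmul \<alpha> ` J2" if J: "\<exists>\<alpha>\<in>F - {0}. J2 = cmul \<alpha> ` J1" for J1 J2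
  proof -
    obtain \<alpha> where *: "\<alpha> \<in> F - {0}" "J2 = cmul \<alpha> ` J1" using J by blast
    have "J1 = cmul (inverse \<alpha>) ` J2"
      using *(1) unfolding *(2) cmul_image_cmul by (simp add: cmul_image_one)
    moreover have "inverse \<alpha> \<in> F - {0}" using *(1) F_inverse by simp
    ultimately show ?thesis by blast
  qed
  have refl: "\<exists>\<alpha>\<in>F - {0}. J = cmul \<alpha> ` J" for J
    using F_of_int[of 1] by (intro bexI[of _ 1]) (simp_all add: cmul_image_one)
  show ?thesis
  proof
    assume "ideal_class F J = ideal_class F J'"
    moreover have "J' \<in> ideal_class F J'" unfolding mem[OF assms(2)] using refl[of J'] assms(2) by simp
    ultimately have "J' \<in> ideal_class F J" by simp
    then show "\<exists>\<alpha>\<in>F - {0}. J' = cmul \<alpha> ` J" unfolding mem[OF assms(1)] by simp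
  next
    assume *: "\<exists>\<alpha>\<in>F - {0}. J' = cmul \<alpha> ` J"
    show "ideal_class F J = ideal_class F J'"
    proof (rule Set.set_eqI)
      fix K
      show "K \<in> ideal_class F J \<longleftrightarrow> K \<in> ideal_class F J'"
        unfolding mem[OF assms(1)] mem[OF assms(2)]
      proof (rule conj_cong[OF HOL.refl], rule iffI)
        assume "\<exists>\<alpha>\<in>F - {0}. K = cmul \<alpha> ` J"
        then show "\<exists>\<alpha>\<in>F - {0}. K = cmul \<alpha> ` J'" by (rule trans[OF sym[OF *]])
      next
        assume "\<exists>\<alpha>\<in>F - {0}. K = cmul \<alpha> ` J'"
        then show "\<exists>\<alpha>\<in>F - {0}. K = cmul \<alpha> ` J" by (rule trans[OF *])
      qed
    qed
  qed
qed

text \<open>The conjugate class. Taken elementwise on arbitrary families of sets, conjugation is an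
  involution without side conditions, as \<open>sum_involution\<close> requires.\<close>

definition bar :: "complex set set \<Rightarrow> complex set set"
  where "bar C = (`) cnj ` C"

lemma bar_bar: "bar (bar C) = C"
  by (simp add: bar_def image_image)

text \<open>One inclusion suffices: applied to the conjugate ideal and transported by
  \<open>bar\<close>, it yields the other.\<close>

lemma bar_ideal_class:
  assumes "fractional_ideal F J"
  shows "bar (ideal_class F J) = ideal_class F (cnj ` J)"
proof -
  have sub: "bar (ideal_class F J) \<subseteq> ideal_class F (cnj ` J)" if J: "fractional_ideal F J" for J
  proof
    fix K assume "K \<in> bar (ideal_class F J)"
    then obtain K0 where "K = cnj ` K0" "K0 \<in> ideal_class F J" unfolding bar_def by (rule imageE)
    then obtain \<alpha> where K: "K = cnj ` K0" "fractional_ideal F K0" "\<alpha> \<in> F - {0}" "K0 = (*) \<alpha> ` J"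
      by (auto simp: ideal_class_def ideal_equiv_def)
    have "K = (*) (cnj \<alpha>) ` cnj ` J" using K by (simp add: image_image)
    moreover have "cnj \<alpha> \<in> F - {0}" using K F_cnj by auto
    ultimately show "K \<in> ideal_class F (cnj ` J)"
      using fractional_ideal_cnj[OF J] fractional_ideal_cnj[OF K(2)] K(1)
      by (auto simp: ideal_class_def ideal_equiv_def)
  qed
  have "bar (ideal_class F (cnj ` J)) \<subseteq> ideal_class F J"
    using sub[OF fractional_ideal_cnj[OF assms]] by (simp add: image_image)
  then have "bar (bar (ideal_class F (cnj ` J))) \<subseteq> bar (ideal_class F J)"
    unfolding bar_def by (rule image_mono)
  then show ?thesis using sub[OF assms] unfolding bar_bar by blast
qed

text \<open>A factor that carries an ideal to another one of the same index in \<open>A\<close>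
  scales areas by 1, so it has absolute value 1. Within \<open>ideals A d\<close>, ideal classes are
  therefore orbits of rotations.\<close>

lemma ideal_class_similar_iff:
  assumes A: "olat A" and d: "d > 0" and J: "J \<in> ideals A d" "J' \<in> ideals A d"
  shows "ideal_class F J' = ideal_class F J \<longleftrightarrow> (\<exists>u\<in>U. J' = cmul u ` J)"
    and "ideal_class F J' = bar (ideal_class F J) \<longleftrightarrow> (\<exists>u\<in>U. J' = ccmul u ` J)"
proof -
  have fr: "fractional_ideal F J" "fractional_ideal F J'" and sub: "J \<subseteq> A" "J' \<subseteq> A"
    and idx: "index A J = d" "index A J' = d" and sg: "subgrp J"
    using J ideals_iff_fractional[OF A d] fractional_idealD by auto
  have unit: "\<alpha> \<in> U" if "\<alpha> \<in> F - {0}" "J' = f \<alpha> ` J" "f \<in> {cmul, ccmul}" for \<alpha> f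
  proof -
    have "real (index A (f \<alpha> ` J)) = (cmod \<alpha>)\<^sup>2 * real (index A J)"
      by (rule index_similarity(2)[OF olat_planar[OF A]]) (use that sub idx sg d in auto)
    then have "(cmod \<alpha>)\<^sup>2 = 1" using idx d that(2) by simp
    then have "cmod \<alpha> = 1" using norm_ge_zero[of \<alpha>] by (simp add: power2_eq_1_iff)
    then show ?thesis using that(1) by (simp add: U_def)
  qed
  have UF: "u \<in> F - {0}" if "u \<in> U" for u using that by (auto simp: U_def)
  have "ideal_class F J' = ideal_class F J \<longleftrightarrow> (\<exists>\<alpha>\<in>F - {0}. J' = cmul \<alpha> ` J)"
    using ideal_class_eq_iff[OF fr] by auto
  then show "ideal_class F J' = ideal_class F J \<longleftrightarrow> (\<exists>u\<in>U. J' = cmul u ` J)"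
    using unit[of _ cmul] UF by blast
  have "ideal_class F J' = bar (ideal_class F J) \<longleftrightarrow> (\<exists>\<alpha>\<in>F - {0}. J' = cmul \<alpha> ` cnj ` J)"
    unfolding bar_ideal_class[OF fr(1)]
    using ideal_class_eq_iff[OF fractional_ideal_cnj[OF fr(1)] fr(2)] by auto
  then show "ideal_class F J' = bar (ideal_class F J) \<longleftrightarrow> (\<exists>u\<in>U. J' = ccmul u ` J)"
    unfolding cmul_image_cnj using unit[of _ ccmul] UF by blast
qed

section \<open>Counting rotations and reflections into an ideal\<close>

definition nrot :: "complex set \<Rightarrow> complex set \<Rightarrow> nat"
  where "nrot A M = card {u \<in> U. cmul u ` M \<subseteq> A}"

definition nref :: "complex set \<Rightarrow> complex set \<Rightarrow> nat"
  where "nref A M = card {u \<in> U. ccmul u ` M \<subseteq> A}"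

definition rstab :: "complex set \<Rightarrow> nat"
  where "rstab M = card {u \<in> U. cmul u ` M = M}"

definition class_asym :: "complex set \<Rightarrow> nat \<Rightarrow> nat"
  where "class_asym A d = card (ideal_class F ` ideals A d - bar ` ideal_class F ` ideals A d)"

text \<open>Both kinds of maps are linear over \<open>Ord\<close>, up to conjugation of scalars, and
  \<open>A\<close> is an ideal. So an image of \<open>M\<close> inside \<open>A\<close> brings the
  image of the ideal spanned by \<open>M\<close> with it.\<close>

lemma nrot_ospan:
  assumes "olat A" "subgrp M"
  shows "nrot A (ospan M) = nrot A M" "nref A (ospan M) = nref A M"
proof -
  have *: "f u ` ospan M \<subseteq> A \<longleftrightarrow> f u ` M \<subseteq> A" if f: "f \<in> {cmul, ccmul}" for f u
  proof
    assume "f u ` ospan M \<subseteq> A"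
    then show "f u ` M \<subseteq> A" using ospan_superset[OF assms(2)] by blast
  next
    assume sub: "f u ` M \<subseteq> A"
    show "f u ` ospan M \<subseteq> A"
    proof clarify
      fix z assume "z \<in> ospan M"
      then obtain x y where z: "z = x + tau * y" "x \<in> M" "y \<in> M" by (auto simp: ospan_def)
      have "cmul u z = cmul u x + tau * cmul u y" "ccmul u z = ccmul u x + cnj tau * ccmul u y"
        by (simp_all add: z cmul_def ccmul_def algebra_simps)
      moreover have "r * f u y \<in> A" if "r \<in> Ord" for r
        using olat_mult[OF assms(1) that] sub z by blast
      moreover have "f u x \<in> A" using sub z by blast
      ultimately show "f u z \<in> A"
        using f assms(1) tau_Ord Ord_cnj[OF tau_Ord] by (auto simp: olat_def intro!: subgrp_add)
    qed
  qed
  show "nrot A (ospan M) = nrot A M" "nref A (ospan M) = nref A M"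
    using *[of cmul] *[of ccmul] by (simp_all add: nrot_def nref_def)
qed

text \<open>On a basis of \<open>M\<close> the factor \<open>u\<close> acts by an integer matrix and
  is a root of its characteristic polynomial. Hence \<open>u\<close> is in the maximal order and has
  norm 1, even if \<open>M\<close> is not an ideal; for \<open>D < -4\<close> there are only two
  such elements.\<close>

lemma stabilizer_trivial:
  assumes D: "D < -4" and M: "planar M"
  shows "{u \<in> U. cmul u ` M = M} = {1, -1}"
proof (intro equalityI subsetI)
  fix u assume "u \<in> {u \<in> U. cmul u ` M = M}"
  then have u: "u \<in> U" "cmul u ` M = M" by auto
  obtain x y where xy: "cross x y \<noteq> 0" "M = Zlat x y" using M by (rule planarE)
  have "u * x \<in> Zlat x y" "u * y \<in> Zlat x y"
    using u(2) Zlat_basis xy(2) unfolding cmul_def[abs_def] by blast+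
  then obtain p q r t where pq: "u * x = of_int p * x + of_int q * y" "u * y = of_int r * x + of_int t * y"
    by (elim ZlatE)
  then have "(u - of_int p) * x = of_int q * y" "(u - of_int t) * y = of_int r * x"
    by (simp_all add: algebra_simps)
  then have "((u - of_int p) * x) * ((u - of_int t) * y) = (of_int q * y) * (of_int r * x)" by simp
  then have "((u - of_int p) * (u - of_int t) - of_int (q * r)) * (x * y) = 0"
    by (simp add: algebra_simps)
  moreover have "x * y \<noteq> 0" using xy(1) by (auto simp: cross_def)
  ultimately have "(u - of_int p) * (u - of_int t) = of_int (q * r)" by simp
  then have "u * u = of_int (p + t) * u - of_int (p * t - q * r)" by (simp add: algebra_simps)
  moreover have "u \<in> F" using u(1) by (simp add: U_def)
  ultimately have "u \<in> Ord" by (rule quadratic_integral[rotated])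
  then obtain i j where ij: "u = of_int i + of_int j * tau" by (rule OrdE)
  have "u * cnj u = of_int (i * i + i * j * b + j * j * n)" unfolding ij by (rule norm_Ord_elem)
  moreover have "u * cnj u = of_int 1" using u(1) complex_norm_square[of u] by (simp add: U_def)
  ultimately have n1: "i * i + i * j * b + j * j * n = 1" by (metis of_int_eq_iff)
  \<comment> \<open>Four times the norm equation with the square completed. Since \<open>- D\<close>
    exceeds 4, any nonzero \<open>j\<close> makes the left side too large.\<close>
  have four: "(2 * i + j * b)\<^sup>2 + (- D) * j\<^sup>2 = 4"
    using n1 unfolding D_eq by (simp add: power2_eq_square algebra_simps)
  have "j = 0"
  proof (rule ccontr)
    assume "j \<noteq> 0"
    then have "1 \<le> j\<^sup>2" by (simp add: zero_less_power2 int_one_le_iff_zero_less)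
    then have "(- D) * 1 \<le> (- D) * j\<^sup>2" using D by (intro mult_left_mono) auto
    then show False using four D zero_le_power2[of "2 * i + j * b"] by linarith
  qed
  then have "i * i = 1" using n1 by simp
  then have "i = 1 \<or> i = -1" by (metis square_eq_1_iff)
  then show "u \<in> {1, -1}" using ij \<open>j = 0\<close> by auto
next
  fix u :: complex assume "u \<in> {1, -1}"
  moreover have "cmul (-1) ` M = M"
    using subgrp_minus[OF planar_subgrp[OF M]] by (force simp: cmul_def image_iff)
  ultimately show "u \<in> {u \<in> U. cmul u ` M = M}"
    using one_U U_minus[OF one_U] cmul_image_one by auto
qed

text \<open>The map from \<open>u\<close> to the image of \<open>J\<close> reaches exactly the
  ideals of index \<open>d\<close> in the orbit. Two factors with the same image differ by an
  element of its stabiliser, so each fibre is a pair \<open>u\<close>, \<open>-u\<close>.\<close>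

lemma card_similarities:
  assumes D: "D < -4" and A: "olat A" and d: "d > 0" and J: "J \<in> ideals A d" and f: "f \<in> {cmul, ccmul}"
  shows "card {u \<in> U. f u ` J \<subseteq> A} = 2 * card {J' \<in> ideals A d. \<exists>u\<in>U. J' = f u ` J}"
proof -
  let ?S = "{u \<in> U. f u ` J \<subseteq> A}"
  note oJ = ideals_olat[OF A d J]
  obtain x where x: "x \<in> J" "x \<noteq> 0" using planar_nonzero[OF olat_planar[OF oJ]] .
  have fin: "finite ?S" by (rule finite_similarities[OF _ x f]) (use A in \<open>auto simp: olat_def\<close>)
  have im: "(\<lambda>u. f u ` J) ` ?S = {J' \<in> ideals A d. \<exists>u\<in>U. J' = f u ` J}"
    using ideals_similar[OF A d J _ f] by (auto simp: ideals_def subs_def)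
  have fibre: "card {v \<in> ?S. f v ` J = J'} = 2" if J': "J' \<in> (\<lambda>u. f u ` J) ` ?S" for J'
  proof -
    obtain u where u: "u \<in> U" "J' = f u ` J" "f u ` J \<subseteq> A" using J' by auto
    have pl: "planar J'"
      using olat_planar[OF ideals_olat[OF A d ideals_similar[OF A d J u(1) f u(3)]]] u(2) by simp
    have "cmul w ` f u ` J = f (w * u) ` J" for w
      using f by (elim insertE emptyE) (simp_all only: cmul_image_cmul cmul_image_ccmul)
    from this[of "_ / u"] have mul: "f v ` J = cmul (v / u) ` J'" for v
      using U_nonzero[OF u(1)] u(2) by simp
    have "{v \<in> ?S. f v ` J = J'} = (\<lambda>w. w * u) ` {w \<in> U. cmul w ` J' = J'}"
    proof (intro equalityI subsetI)
      fix v assume "v \<in> {v \<in> ?S. f v ` J = J'}"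
      then have "v / u \<in> {w \<in> U. cmul w ` J' = J'}" "v = (v / u) * u"
        using mul[of v] U_divide[OF _ u(1)] U_nonzero[OF u(1)] by auto
      then show "v \<in> (\<lambda>w. w * u) ` {w \<in> U. cmul w ` J' = J'}" by blast
    next
      fix v assume "v \<in> (\<lambda>w. w * u) ` {w \<in> U. cmul w ` J' = J'}"
      then obtain w where w: "w \<in> U" "cmul w ` J' = J'" "v = w * u" by blast
      then have "f v ` J = J'" using mul[of v] U_nonzero[OF u(1)] by simp
      then show "v \<in> {v \<in> ?S. f v ` J = J'}" using w U_mult[OF _ u(1)] u by simp
    qed
    also have "\<dots> = {u, -u}" unfolding stabilizer_trivial[OF D pl] by auto
    finally show ?thesis using U_nonzero[OF u(1)] by simp
  qed
  have "card ?S = (\<Sum>u\<in>?S. 1)" by simp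
  also have "\<dots> = (\<Sum>J'\<in>(\<lambda>u. f u ` J) ` ?S. \<Sum>v | v \<in> ?S \<and> f v ` J = J'. 1)"
    by (rule sum.image_gen[OF fin])
  also have "\<dots> = (\<Sum>J'\<in>(\<lambda>u. f u ` J) ` ?S. 2)"
    by (intro sum.cong refl) (use fibre in simp)
  finally show ?thesis unfolding im by simp
qed

text \<open>Division with remainder by an \<alpha> of least nonzero norm in \<open>J\<close>. As the
  square of \<open>Im tau\<close> is at most 1, rounding the quotient leaves an error of squared
  absolute value at most 1/4 + 1/4, so the remainder is smaller than \<alpha> and must
  vanish.\<close>

lemma principal:
  assumes D: "D \<ge> -4" and J: "olat J"
  obtains \<alpha> where "\<alpha> \<in> J" "\<alpha> \<noteq> 0" "J = cmul \<alpha> ` Ord"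
proof -
  have JO: "J \<subseteq> Ord" using J by (simp add: olat_def)
  define m where "m z = nat \<lfloor>(cmod z)\<^sup>2\<rfloor>" for z
  have m: "(cmod z)\<^sup>2 = real (m z)" if z: "z \<in> J" for z
  proof -
    obtain k where "(cmod z)\<^sup>2 = of_int k" using Ord_cmod JO z by blast
    moreover have "0 \<le> (cmod z)\<^sup>2" by simp
    ultimately show ?thesis by (simp add: m_def)
  qed
  obtain x where "x \<in> J \<and> x \<noteq> 0" using planar_nonzero[OF olat_planar[OF J]] by metis
  then obtain \<alpha> where \<alpha>: "\<alpha> \<in> J" "\<alpha> \<noteq> 0" and least: "\<And>y. y \<in> J \<Longrightarrow> y \<noteq> 0 \<Longrightarrow> m \<alpha> \<le> m y"
    using ex_has_least_nat[of "\<lambda>z. z \<in> J \<and> z \<noteq> 0" x m] by auto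
  have "J \<subseteq> cmul \<alpha> ` Ord"
  proof
    fix z assume z: "z \<in> J"
    define w where "w = z / \<alpha>"
    \<comment> \<open>The coordinate along \<open>tau\<close> is rounded first, by means of the
      imaginary part; \<open>i\<close> then absorbs what this does to the real part.\<close>
    define j where "j = round (Im w / Im tau)"
    define i where "i = round (Re (w - of_int j * tau))"
    define r where "r = of_int i + of_int j * tau"
    have s: "Im tau \<noteq> 0" "(Im tau)\<^sup>2 \<le> 1"
      using D D_neg by (auto simp: Im_tau power_divide)
    have "Im (w - r) = Im tau * (Im w / Im tau - of_int j)"
      using s(1) by (simp add: r_def algebra_simps)
    moreover have "\<bar>Im w / Im tau - of_int j\<bar> \<le> 1 / 2"
      unfolding j_def by (subst abs_minus_commute) (rule of_int_round_abs_le)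
    then have "(Im w / Im tau - of_int j)\<^sup>2 \<le> (1 / 2)\<^sup>2" by (rule power2_le_iff_abs_le[THEN iffD2, rotated]) simp
    ultimately have im: "(Im (w - r))\<^sup>2 \<le> 1 * (1 / 2)\<^sup>2"
      unfolding \<open>Im (w - r) = _\<close> power_mult_distrib by (intro mult_mono s) auto
    have "Re (w - r) = Re (w - of_int j * tau) - of_int i" by (simp add: r_def)
    then have "\<bar>Re (w - r)\<bar> \<le> 1 / 2"
      unfolding i_def by (metis abs_minus_commute of_int_round_abs_le)
    then have re: "(Re (w - r))\<^sup>2 \<le> (1 / 2)\<^sup>2" by (rule power2_le_iff_abs_le[THEN iffD2, rotated]) simp
    have "(cmod (w - r))\<^sup>2 < 1"
      unfolding cmod_power2 using re im by (simp add: power2_eq_square)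
    moreover have zr: "z - r * \<alpha> = (w - r) * \<alpha>" using \<alpha>(2) by (simp add: w_def algebra_simps)
    ultimately have "(cmod (z - r * \<alpha>))\<^sup>2 < (cmod \<alpha>)\<^sup>2"
      using \<alpha>(2) by (simp add: norm_mult power_mult_distrib)
    moreover have rO: "r \<in> Ord" unfolding r_def by (intro Ord_add Ord_mult Ord_of_int tau_Ord)
    then have zJ: "z - r * \<alpha> \<in> J"
      using z olat_mult[OF J _ \<alpha>(1)] J by (auto simp: olat_def intro: subgrp_diff)
    ultimately have "m (z - r * \<alpha>) < m \<alpha>" using m[OF zJ] m[OF \<alpha>(1)] by simp
    then have "z - r * \<alpha> = 0" using least[OF zJ] by auto
    then have "z = cmul \<alpha> r" by (simp add: cmul_def mult.commute)
    then show "z \<in> cmul \<alpha> ` Ord" using rO by blast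
  qed
  moreover have "cmul \<alpha> ` Ord \<subseteq> J"
    using olat_mult[OF J _ \<alpha>(1)] by (auto simp: cmul_def mult.commute)
  ultimately show thesis using that[OF \<alpha>] by blast
qed

text \<open>If \<alpha> generates \<open>J\<close>, then its conjugate generates the conjugate
  ideal, and their quotient has absolute value 1.\<close>

lemma cnj_similar_small:
  assumes D: "D \<ge> -4" and J: "olat J"
  obtains v where "v \<in> U" "cnj ` J = cmul v ` J"
proof -
  obtain \<alpha> where \<alpha>: "\<alpha> \<in> J" "\<alpha> \<noteq> 0" "J = cmul \<alpha> ` Ord" using principal[OF D J] .
  have "cnj ` Ord = Ord" using Ord_cnj by (force simp: image_iff intro: bexI[of _ "cnj _"])
  then have "cnj ` J = cmul (cnj \<alpha>) ` Ord"
    unfolding \<alpha>(3) cmul_def[abs_def] by (simp add: image_image) (metis (no_types, lifting) image_cong image_image)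
  then have "cnj ` J = cmul (cnj \<alpha> / \<alpha>) ` J"
    unfolding \<alpha>(3) cmul_image_cmul using \<alpha>(2) by simp
  moreover have "\<alpha> \<in> F" using \<alpha>(1) J by (auto simp: olat_def intro: Ord_F)
  then have "cnj \<alpha> / \<alpha> \<in> U"
    using \<alpha>(2) by (simp add: U_def F_divide F_cnj norm_divide)
  ultimately show thesis by (rule that[rotated])
qed

text \<open>Since \<open>J\<close> is a rotation of its conjugate by \<open>v\<close>, the
  reflection of \<open>J\<close> with factor \<open>u\<close> has the same image as the rotation
  with factor \<open>u * v\<close>.\<close>

lemma nref_eq_nrot_small:
  assumes D: "D \<ge> -4" and J: "olat J"
  shows "nref A J = nrot A J"
proof -
  obtain v where v: "v \<in> U" "cnj ` J = cmul v ` J" using cnj_similar_small[OF D J] .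
  have eq: "ccmul u ` J = cmul (u * v) ` J" for u
    unfolding cmul_image_cnj[symmetric] v(2) cmul_image_cmul ..
  have "bij_betw (\<lambda>u. u * v) {u \<in> U. ccmul u ` J \<subseteq> A} {u \<in> U. cmul u ` J \<subseteq> A}"
    by (rule bij_betw_byWitness[where f' = "\<lambda>u. u / v"])
      (use v(1) U_nonzero[OF v(1)] in \<open>auto simp: eq U_mult U_divide\<close>)
  then show ?thesis unfolding nref_def nrot_def by (rule bij_betw_same_card)
qed

lemma class_asym_small:
  assumes D: "D \<ge> -4" and A: "olat A" and d: "d > 0"
  shows "class_asym A d = 0"
proof -
  have "bar (ideal_class F J) = ideal_class F J" if J: "J \<in> ideals A d" for J
  proof -
    have fr: "fractional_ideal F J" using J ideals_iff_fractional[OF A d] by blast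
    obtain v where v: "v \<in> U" "cnj ` J = cmul v ` J"
      using cnj_similar_small[OF D ideals_olat[OF A d J]] .
    have "v \<in> F - {0}" using v(1) by (auto simp: U_def)
    then have "ideal_class F J = ideal_class F (cnj ` J)"
      using ideal_class_eq_iff[OF fr fractional_ideal_cnj[OF fr]] v(2) by blast
    then show ?thesis using bar_ideal_class[OF fr] by simp
  qed
  then have "bar ` ideal_class F ` ideals A d = ideal_class F ` ideals A d"
    by (simp add: image_image)
  then show ?thesis by (simp add: class_asym_def)
qed

text \<open>The involution pairs each class \<open>C\<close> with \<open>bar C\<close>: if both occur, their contributions add
  up to 1, and a class whose conjugate does not occur contributes 1 alone.\<close>

lemma sum_involution:
  fixes N :: "'c \<Rightarrow> nat" and bar :: "'c \<Rightarrow> 'c"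
  assumes Y: "finite Y" and N: "\<And>C. N C > 0 \<longleftrightarrow> C \<in> Y" and bar: "\<And>C. bar (bar C) = C"
  shows "(\<Sum>C\<in>Y. of_nat (N C) / of_nat (N C + N (bar C)))
    = (of_nat (card Y) + of_nat (card (Y - bar ` Y))) / (2 :: complex)"
proof -
  define t where "t C = (of_nat (N C) / of_nat (N C + N (bar C)) :: complex)" for C
  define Z where "Z = Y \<inter> bar ` Y"
  have YZ: "Y = Z \<union> (Y - bar ` Y)" "Z \<inter> (Y - bar ` Y) = {}" by (auto simp: Z_def)
  have fin: "finite Z" "finite (Y - bar ` Y)" using Y by (auto simp: Z_def)
  have one: "t C = 1" if C: "C \<in> Y - bar ` Y" for C
  proof -
    have "bar C \<notin> Y" using C bar by (metis DiffD2 imageI)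
    then have "N (bar C) = 0" using N by blast
    moreover have "N C > 0" using C N by blast
    ultimately show ?thesis by (simp add: t_def)
  qed
  have "sum t Z = (\<Sum>C\<in>Z. t (bar C))"
    by (rule sum.reindex_bij_witness[where i = bar and j = bar]) (auto simp: Z_def bar image_iff)
  then have "2 * sum t Z = (\<Sum>C\<in>Z. t C + t (bar C))" by (simp add: sum.distrib)
  also have "\<dots> = (\<Sum>C\<in>Z. 1)"
  proof (rule sum.cong)
    fix C assume "C \<in> Z"
    then have "N C > 0" using N by (auto simp: Z_def)
    then have "of_nat (N C + N (bar C)) \<noteq> (0 :: complex)" by (simp only: of_nat_eq_0_iff)
    moreover have "t (bar C) = of_nat (N (bar C)) / of_nat (N C + N (bar C))"
      by (simp only: t_def bar add.commute)
    then have "t C + t (bar C) = of_nat (N C + N (bar C)) / of_nat (N C + N (bar C))"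
      by (simp only: t_def[of C] of_nat_add add_divide_distrib)
    ultimately show "t C + t (bar C) = 1" by (simp only: divide_self not_False_eq_True)
  qed simp
  finally have "2 * sum t Z = of_nat (card Z)" by simp
  then have Zsum: "sum t Z = of_nat (card Z) / 2" by (simp add: eq_divide_eq mult.commute)
  have "sum t Y = sum t Z + sum t (Y - bar ` Y)"
    using YZ fin by (metis sum.union_disjoint)
  also have "\<dots> = of_nat (card Z) / 2 + of_nat (card (Y - bar ` Y))"
    using Zsum one by simp
  also have "of_nat (card Z) = (of_nat (card Y) - of_nat (card (Y - bar ` Y)) :: complex)"
    using card_Un_disjoint[OF fin YZ(2)] YZ(1) by simp
  finally show ?thesis unfolding t_def by (simp add: field_simps)
qed

text \<open>The leading 2 is the order of the stabiliser. With \<open>N C\<close> ideals in the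
  class \<open>C\<close>, one ideal contributes
  \<open>1 / (N C + N (bar C)) - 1 / (2 * N C)\<close>, so the class contributes
  \<open>N C / (N C + N (bar C)) - 1 / 2\<close>. By \<open>sum_involution\<close>, half the number
  of asymmetric classes remains.\<close>

lemma rotation_excess_large:
  assumes D: "D < -4" and A: "olat A" and d: "d > 0"
  shows "(\<Sum>J\<in>ideals A d. 2 * (1 / of_nat (nrot A J + nref A J) - 1 / of_nat (2 * nrot A J)))
    = (of_nat (class_asym A d) / 2 :: complex)"
proof -
  let ?X = "ideals A d"
  let ?cl = "ideal_class F"
  define N where "N C = card {J \<in> ?X. ?cl J = C}" for C
  have fin: "finite ?X" by (rule finite_ideals[OF A d])
  have N: "N C > 0 \<longleftrightarrow> C \<in> ?cl ` ?X" for C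
    using fin by (auto simp: N_def card_gt_0_iff)
  have rot: "nrot A J = 2 * N (?cl J)" "nref A J = 2 * N (bar (?cl J))" if J: "J \<in> ?X" for J
  proof -
    have "{J' \<in> ?X. ?cl J' = ?cl J} = {J' \<in> ?X. \<exists>u\<in>U. J' = cmul u ` J}"
      "{J' \<in> ?X. ?cl J' = bar (?cl J)} = {J' \<in> ?X. \<exists>u\<in>U. J' = ccmul u ` J}"
      by (rule Collect_cong, rule conj_cong[OF HOL.refl], erule ideal_class_similar_iff[OF A d J])+
    then show "nrot A J = 2 * N (?cl J)" "nref A J = 2 * N (bar (?cl J))"
      using card_similarities[OF D A d J] by (simp_all add: nrot_def nref_def N_def)
  qed
  have "(\<Sum>J\<in>?X. 2 * (1 / of_nat (nrot A J + nref A J) - 1 / of_nat (2 * nrot A J)))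
      = (\<Sum>J\<in>?X. 1 / of_nat (N (?cl J) + N (bar (?cl J))) - 1 / (2 * of_nat (N (?cl J))) :: complex)"
  proof (rule sum.cong)
    fix J assume J: "J \<in> ?X"
    have "2 * (1 / of_nat (2 * k) :: complex) = 1 / of_nat k" for k :: nat by simp
    from this[of "N (?cl J) + N (bar (?cl J))"] this[of "2 * N (?cl J)"]
    show "2 * (1 / of_nat (nrot A J + nref A J) - 1 / of_nat (2 * nrot A J))
      = (1 / of_nat (N (?cl J) + N (bar (?cl J))) - 1 / (2 * of_nat (N (?cl J))) :: complex)"
      unfolding rot[OF J] distrib_left[symmetric] right_diff_distrib by simp
  qed simp
  also have "\<dots> = (\<Sum>C\<in>?cl ` ?X. \<Sum>J | J \<in> ?X \<and> ?cl J = C.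
      1 / of_nat (N (?cl J) + N (bar (?cl J))) - 1 / (2 * of_nat (N (?cl J))))"
    by (rule sum.image_gen[OF fin])
  also have "\<dots> = (\<Sum>C\<in>?cl ` ?X. of_nat (N C) / of_nat (N C + N (bar C)) - 1 / 2)"
  proof (rule sum.cong)
    fix C assume "C \<in> ?cl ` ?X"
    then have "N C > 0" using N by blast
    have "(\<Sum>J | J \<in> ?X \<and> ?cl J = C. 1 / of_nat (N (?cl J) + N (bar (?cl J))) - 1 / (2 * of_nat (N (?cl J))))
      = (\<Sum>J | J \<in> ?X \<and> ?cl J = C. 1 / of_nat (N C + N (bar C)) - 1 / (2 * of_nat (N C)) :: complex)"
      by (rule sum.cong) auto
    also have "\<dots> = of_nat (N C) * (1 / of_nat (N C + N (bar C)) - 1 / (2 * of_nat (N C)))"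
      by (simp add: N_def)
    also have "\<dots> = of_nat (N C) / of_nat (N C + N (bar C)) - 1 / 2"
      using \<open>N C > 0\<close> by (simp add: right_diff_distrib)
    finally show "(\<Sum>J | J \<in> ?X \<and> ?cl J = C. 1 / of_nat (N (?cl J) + N (bar (?cl J))) - 1 / (2 * of_nat (N (?cl J))))
      = (of_nat (N C) / of_nat (N C + N (bar C)) - 1 / 2 :: complex)" .
  qed simp
  also have "\<dots> = of_nat (class_asym A d) / 2"
    unfolding sum_subtractf sum_involution[of "?cl ` ?X" N bar, OF finite_imageI[OF fin] N bar_bar]
    by (simp add: class_asym_def field_simps)
  finally show ?thesis .
qed

text \<open>For \<open>D < -4\<close> the summand depends only on \<open>ospan M\<close>, and each
  ideal is spanned by equally many \<open>M\<close>, by \<open>card_gens\<close>. Otherwise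
  \<open>rstab M\<close> may vary among subgroups with the same span, but its cofactor is 0.\<close>

lemma rotation_excess:
  assumes A: "olat A" and m: "m > 0"
  shows "(\<Sum>M\<in>subs A m. of_nat (rstab M) * (1 / of_nat (nrot A M + nref A M) - 1 / of_nat (2 * nrot A M)))
    = ((\<Sum>d | d dvd m. of_nat (card (gens Ord (m div d))) * of_nat (class_asym A d)) / 2 :: complex)"
proof -
  let ?g = "\<lambda>M. of_nat (rstab M) * (1 / of_nat (nrot A M + nref A M) - 1 / of_nat (2 * nrot A M)) :: complex"
  have pos: "d > 0" "m div d > 0" if "d dvd m" for d
    using that m by (auto elim!: dvdE)
  have key: "(\<Sum>J\<in>ideals A d. \<Sum>M\<in>gens J (m div d). ?g M)
      = of_nat (card (gens Ord (m div d))) * of_nat (class_asym A d) / 2" if dm: "d dvd m" for d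
  proof (cases "D < -4")
    case True
    let ?h = "\<lambda>J. 2 * (1 / of_nat (nrot A J + nref A J) - 1 / of_nat (2 * nrot A J)) :: complex"
    have "(\<Sum>J\<in>ideals A d. \<Sum>M\<in>gens J (m div d). ?g M)
      = (\<Sum>J\<in>ideals A d. of_nat (card (gens Ord (m div d))) * ?h J)"
    proof (rule sum.cong)
      fix J assume J: "J \<in> ideals A d"
      note oJ = ideals_olat[OF A pos(1)[OF dm] J]
      have gh: "?g M = ?h J" if M: "M \<in> gens J (m div d)" for M
      proof -
        have M': "subgrp M" "ospan M = J" "M \<subseteq> J" "index J M > 0"
          using M pos[OF dm] by (auto simp: gens_def subs_def)
        have "planar M" by (rule planar_sub[OF olat_planar[OF oJ] M'(1,3,4)])
        then have "rstab M = 2" by (simp add: rstab_def stabilizer_trivial[OF True])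
        moreover have "nrot A M = nrot A J" "nref A M = nref A J"
          using nrot_ospan[OF A M'(1)] by (simp_all only: M'(2))
        ultimately show ?thesis by (simp only: of_nat_numeral)
      qed
      have "(\<Sum>M\<in>gens J (m div d). ?g M) = (\<Sum>M\<in>gens J (m div d). ?h J)"
        by (rule sum.cong[OF HOL.refl gh])
      then show "(\<Sum>M\<in>gens J (m div d). ?g M) = of_nat (card (gens Ord (m div d))) * ?h J"
        by (simp only: sum_constant card_gens[OF oJ pos(2)[OF dm]])
    qed simp
    also have "\<dots> = of_nat (card (gens Ord (m div d))) * sum ?h (ideals A d)"
      by (rule sum_distrib_left[symmetric])
    also have "\<dots> = of_nat (card (gens Ord (m div d))) * (of_nat (class_asym A d) / 2)"
      by (rule arg_cong[OF rotation_excess_large[OF True A pos(1)[OF dm]]])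
    finally show ?thesis by (simp only: times_divide_eq_right)
  next
    case False
    have "?g M = 0" if J: "J \<in> ideals A d" and M: "M \<in> gens J (m div d)" for J M
    proof -
      have M': "subgrp M" "ospan M = J" using M by (auto simp: gens_def subs_def)
      have "nref A J = nrot A J"
        using nref_eq_nrot_small[OF _ ideals_olat[OF A pos(1)[OF dm] J]] False by simp
      then have "nref A M = nrot A M"
        using nrot_ospan[OF A M'(1)] by (simp only: M'(2))
      then show ?thesis unfolding mult_2 by simp
    qed
    then have "(\<Sum>J\<in>ideals A d. \<Sum>M\<in>gens J (m div d). ?g M) = 0"
      by (intro sum.neutral ballI)
    then show ?thesis using class_asym_small[OF _ A pos(1)[OF dm]] False by simp
  qed
  show ?thesis
    unfolding sum_subs[OF A m] sum_divide_distrib by (rule sum.cong[OF HOL.refl]) (rule key, simp)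
qed

text \<open>The arithmetic source of \<zeta>(s) \<zeta>(s - 1) / \<zeta>F(s): all subgroups of
  \<open>Ord\<close> are counted twice, by normal forms and by the ideals that they span.\<close>

lemma card_subs_Ord:
  assumes m: "m > 0"
  shows "(\<Sum>d | d dvd m. card (ideals Ord d) * card (gens Ord (m div d))) = \<Sum>{d. d dvd m}"
proof -
  have "card (subs Ord m) = (\<Sum>d | d dvd m. \<Sum>J\<in>ideals Ord d. card (gens J (m div d)))"
    using sum_subs[OF olat_Ord m, of "\<lambda>_. 1::nat"] by simp
  also have "\<dots> = (\<Sum>d | d dvd m. card (ideals Ord d) * card (gens Ord (m div d)))"
  proof (rule sum.cong)
    fix d assume "d \<in> {d. d dvd m}"
    then have pos: "d > 0" "m div d > 0" using m by (auto elim!: dvdE)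
    have "card (gens J (m div d)) = card (gens Ord (m div d))" if "J \<in> ideals Ord d" for J
      using card_gens[OF ideals_olat[OF olat_Ord pos(1) that] pos(2)] .
    then show "(\<Sum>J\<in>ideals Ord d. card (gens J (m div d))) = card (ideals Ord d) * card (gens Ord (m div d))"
      by simp
  qed simp
  finally show ?thesis using card_subs(2)[OF planar_Ord m] by simp
qed

end

section \<open>Dirichlet series\<close>

lemma of_nat_powr_mult:
  "(of_nat (m * n) :: complex) powr s = of_nat m powr s * of_nat n powr s"
  unfolding of_nat_mult by (rule powr_times_real) auto

lemma norm_of_nat_powr: "norm ((of_nat n :: complex) powr s) = real n powr Re s"
  by (subst norm_powr_real_powr) auto

lemma nat_powr_abs_summable:
  assumes "Re s > 1"
  shows "(\<lambda>n::nat. norm ((of_nat n :: complex) powr (- s))) summable_on {1..}"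
proof -
  have "summable (\<lambda>n. real n powr (- Re s))" using assms by (simp add: summable_real_powr_iff)
  then have "(\<lambda>n. real n powr (- Re s)) summable_on UNIV"
    by (subst summable_on_UNIV_nonneg_real_iff) auto
  then show ?thesis
    unfolding norm_of_nat_powr uminus_complex.sel by (rule summable_on_subset_banach) auto
qed

text \<open>Regroups an absolutely convergent sum over ideals or lattices into a Dirichlet series.
  Summability is asked for in the grouped form, where the divisor sums provide a bound.\<close>

lemma infsum_by_index:
  fixes w :: "'a \<Rightarrow> complex" and h :: "'a \<Rightarrow> nat"
  assumes h: "\<And>x. x \<in> T \<Longrightarrow> h x \<ge> 1" and fin: "\<And>m. m \<ge> 1 \<Longrightarrow> finite {x \<in> T. h x = m}"
    and abs: "(\<lambda>m. \<Sum>x | x \<in> T \<and> h x = m. norm (w x)) summable_on {1..}"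
  shows "(\<lambda>x. norm (w x)) summable_on T"
    and "infsum w T = (\<Sum>\<^sub>\<infinity>m\<in>{1..}. \<Sum>x | x \<in> T \<and> h x = m. w x)"
proof -
  let ?S = "SIGMA m:{1..}. {x \<in> T. h x = m}"
  have bij: "bij_betw snd ?S T"
    unfolding bij_betw_def using h by (auto simp: inj_on_def image_iff)
  have *: "(\<lambda>p. norm (w (snd p))) summable_on ?S"
    by (rule summable_on_SigmaI[where g = "\<lambda>m. \<Sum>x | x \<in> T \<and> h x = m. norm (w x)"])
      (use fin abs in \<open>auto intro!: has_sum_finiteI\<close>)
  then show "(\<lambda>x. norm (w x)) summable_on T"
    unfolding summable_on_reindex_bij_betw[OF bij, of "\<lambda>x. norm (w x)"] .
  have sm: "(\<lambda>p. w (snd p)) summable_on ?S" by (rule abs_summable_summable[OF *])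
  have "infsum w T = infsum (\<lambda>p. w (snd p)) ?S"
    by (rule infsum_reindex_bij_betw[OF bij, symmetric])
  also have "\<dots> = (\<Sum>\<^sub>\<infinity>m\<in>{1..}. \<Sum>\<^sub>\<infinity>x\<in>{x \<in> T. h x = m}. w x)"
    using infsum_Sigma_banach[OF sm] by simp
  also have "\<dots> = (\<Sum>\<^sub>\<infinity>m\<in>{1..}. \<Sum>x | x \<in> T \<and> h x = m. w x)"
    by (rule infsum_cong) (use fin in auto)
  finally show "infsum w T = (\<Sum>\<^sub>\<infinity>m\<in>{1..}. \<Sum>x | x \<in> T \<and> h x = m. w x)" .
qed

text \<open>The absolutely convergent double sum over pairs of factors, rearranged by sending a pair
  to its product and first factor.\<close>

lemma dirichlet_product:
  fixes f g :: "nat \<Rightarrow> complex"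
  assumes f: "(\<lambda>n. norm (f n * of_nat n powr (- s))) summable_on {1..}"
    and g: "(\<lambda>n. norm (g n * of_nat n powr (- s))) summable_on {1..}"
  shows "(\<lambda>n. norm ((\<Sum>d | d dvd n. f d * g (n div d)) * of_nat n powr (- s))) summable_on {1..}"
    and "(\<Sum>\<^sub>\<infinity>n\<in>{1..}. (\<Sum>d | d dvd n. f d * g (n div d)) * of_nat n powr (- s))
      = (\<Sum>\<^sub>\<infinity>n\<in>{1..}. f n * of_nat n powr (- s)) * (\<Sum>\<^sub>\<infinity>n\<in>{1..}. g n * of_nat n powr (- s))"
proof -
  define u where "u n = f n * of_nat n powr (- s)" for n
  define v where "v n = g n * of_nat n powr (- s)" for n
  define h where "h = (\<lambda>(m, d). u d * v (m div d))"
  let ?P = "{1..} \<times> {1..} :: (nat \<times> nat) set"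
  let ?D = "SIGMA m:{1..}. {d. d dvd m}"
  have fin: "finite {d. d dvd m}" if "m \<in> {1..}" for m :: nat
    using that by (simp add: finite_divisors_nat)
  have uv: "(\<lambda>n. norm (u n)) summable_on {1..}" "(\<lambda>n. norm (v n)) summable_on {1..}"
    using f g by (simp_all add: u_def v_def)
  have P: "(\<lambda>p. norm (u (fst p) * v (snd p))) summable_on ?P"
    by (rule summable_on_SigmaI[where g = "\<lambda>m. norm (u m) * infsum (\<lambda>n. norm (v n)) {1..}"])
      (use uv in \<open>auto simp: norm_mult intro!: has_sum_cmult_right summable_on_cmult_left has_sum_infsum\<close>)
  have bij: "bij_betw (\<lambda>p. (fst p * snd p, fst p)) ?P ?D"
    by (rule bij_betw_byWitness[where f' = "\<lambda>p. (snd p, fst p div snd p)"])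
      (auto elim!: dvdE)
  have hP: "h (fst p * snd p, fst p) = u (fst p) * v (snd p)" if "p \<in> ?P" for p
    using that by (auto simp: h_def)
  have "(\<lambda>p. norm (h (fst p * snd p, fst p))) summable_on ?P"
    by (rule summable_on_cong[THEN iffD2, OF _ P]) (simp only: hP)
  then have habs: "(\<lambda>q. norm (h q)) summable_on ?D"
    unfolding summable_on_reindex_bij_betw[OF bij, of "\<lambda>q. norm (h q)"] .
  note hsum = abs_summable_summable[OF habs]
  have coeff: "(\<Sum>d | d dvd n. f d * g (n div d)) * of_nat n powr (- s) = (\<Sum>d | d dvd n. h (n, d))" for n
    unfolding sum_distrib_right
  proof (rule sum.cong)
    fix d assume "d \<in> {d. d dvd n}"
    then have "n = d * (n div d)" by simp
    then have "of_nat n powr (- s) = (of_nat d powr (- s) * of_nat (n div d) powr (- s) :: complex)"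
      by (metis of_nat_powr_mult)
    then show "f d * g (n div d) * of_nat n powr (- s) = h (n, d)"
      by (simp add: h_def u_def v_def mult_ac)
  qed simp
  have "(\<lambda>n. \<Sum>\<^sub>\<infinity>d\<in>{d. d dvd n}. norm (h (n, d))) summable_on {1..}"
    using summable_on_Sigma_banach[of "\<lambda>m d. norm (h (m, d))" "{1..}" "\<lambda>m. {d. d dvd m}"] habs
    by (simp add: case_prod_unfold)
  then have "(\<lambda>n. \<Sum>d | d dvd n. norm (h (n, d))) summable_on {1..}"
    by (rule summable_on_cong[THEN iffD1, rotated]) (use fin in auto)
  then show "(\<lambda>n. norm ((\<Sum>d | d dvd n. f d * g (n div d)) * of_nat n powr (- s))) summable_on {1..}"
    unfolding coeff by (rule Infinite_Sum.abs_summable_on_comparison_test') (rule norm_sum)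
  have "(\<Sum>\<^sub>\<infinity>n\<in>{1..}. (\<Sum>d | d dvd n. f d * g (n div d)) * of_nat n powr (- s))
      = (\<Sum>\<^sub>\<infinity>n\<in>{1..}. \<Sum>\<^sub>\<infinity>d\<in>{d. d dvd n}. h (n, d))"
    unfolding coeff by (rule infsum_cong) (use fin in auto)
  also have "\<dots> = infsum h ?D" by (rule infsum_Sigma_banach[OF hsum])
  also have "\<dots> = infsum (\<lambda>p. h (fst p * snd p, fst p)) ?P"
    by (rule infsum_reindex_bij_betw[OF bij, symmetric])
  also have "\<dots> = infsum (\<lambda>p. u (fst p) * v (snd p)) ?P"
    by (rule infsum_cong) (rule hP)
  also have "\<dots> = (\<Sum>\<^sub>\<infinity>m\<in>{1..}. \<Sum>\<^sub>\<infinity>n\<in>{1..}. u m * v n)"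
    using infsum_Sigma_banach[OF abs_summable_summable[OF P]] by simp
  also have "\<dots> = infsum u {1..} * infsum v {1..}"
    by (simp add: infsum_cmult_right' infsum_cmult_left')
  finally show "(\<Sum>\<^sub>\<infinity>n\<in>{1..}. (\<Sum>d | d dvd n. f d * g (n div d)) * of_nat n powr (- s))
      = (\<Sum>\<^sub>\<infinity>n\<in>{1..}. f n * of_nat n powr (- s)) * (\<Sum>\<^sub>\<infinity>n\<in>{1..}. g n * of_nat n powr (- s))"
    by (simp add: u_def[abs_def] v_def[abs_def])
qed

text \<open>Sieving the primes up to \<open>N\<close> out of the series multiplies it by a finite Euler product and leaves
  1 plus a tail of the absolutely convergent series.\<close>

lemma riemann_zeta_nonzero:
  assumes s: "Re s > 1"
  shows "riemann_zeta s \<noteq> 0"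
proof
  assume zero: "riemann_zeta s = 0"
  define t where "t n = (of_nat n :: complex) powr (- s)" for n :: nat
  define A where "A N = {n::nat. n \<ge> 1 \<and> (\<forall>p. prime p \<and> p \<le> N \<longrightarrow> \<not> p dvd n)}" for N :: nat
  have abs: "(\<lambda>n. norm (t n)) summable_on {1..}" unfolding t_def by (rule nat_powr_abs_summable[OF s])
  have sub: "X \<subseteq> {1..} \<Longrightarrow> (\<lambda>n. norm (t n)) summable_on X" for X
    using abs by (rule summable_on_subset_banach)
  have smb: "X \<subseteq> {1..} \<Longrightarrow> t summable_on X" for X by (rule abs_summable_summable[OF sub])
  have A1: "A N \<subseteq> {1..}" for N by (auto simp: A_def)
  have tmult: "t (m * n) = t m * t n" for m n unfolding t_def by (rule of_nat_powr_mult)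
  have sieved: "infsum t (A N) = 0" for N
  proof (induction N)
    case 0
    have "A 0 = {1..}" by (auto simp: A_def)
    then show ?case using zero by (simp add: riemann_zeta_def t_def[abs_def])
  next
    case (Suc N)
    show ?case
    proof (cases "prime (Suc N)")
      case False
      then have "A (Suc N) = A N" by (auto simp: A_def le_Suc_eq)
      then show ?thesis using Suc by simp
    next
      case True
      define p where "p = Suc N"
      have p: "prime p" using True by (simp add: p_def)
      have nd: "\<not> q dvd p" if "prime q" "q \<le> N" for q
        using that p primes_dvd_imp_eq[of q p] by (auto simp: p_def)
      have split: "A N = A (Suc N) \<union> (*) p ` A N"
      proof (intro equalityI subsetI)
        fix n assume n: "n \<in> A N"
        show "n \<in> A (Suc N) \<union> (*) p ` A N"
        proof (cases "p dvd n")
          case True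
          then obtain k where "n = p * k" by auto
          with n have "k \<in> A N" by (auto simp: A_def)
          then show ?thesis using \<open>n = p * k\<close> by blast
        next
          case False
          then show ?thesis using n by (auto simp: A_def le_Suc_eq p_def)
        qed
      next
        fix n assume "n \<in> A (Suc N) \<union> (*) p ` A N"
        then show "n \<in> A N"
        proof
          assume "n \<in> (*) p ` A N"
          then obtain k where k: "k \<in> A N" "n = p * k" by auto
          then show "n \<in> A N"
            using nd p by (auto simp: A_def prime_dvd_mult_iff prime_gt_0_nat Suc_le_eq)
        qed (auto simp: A_def)
      qed
      have disj: "A (Suc N) \<inter> (*) p ` A N = {}"
      proof -
        have "p * k \<notin> A (Suc N)" for k using p by (auto simp: A_def simp flip: p_def)
        then show ?thesis by blast
      qed
      have "(*) p ` A N \<subseteq> {1..}" using split A1 by blast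
      then have "infsum t (A N) = infsum t (A (Suc N)) + infsum t ((*) p ` A N)"
        by (subst split, intro infsum_Un_disjoint smb A1 disj)
      moreover have "infsum t ((*) p ` A N) = (\<Sum>\<^sub>\<infinity>n\<in>A N. t p * t n)"
        by (subst infsum_reindex) (use p in \<open>auto simp: inj_on_def o_def tmult\<close>)
      moreover have "(\<Sum>\<^sub>\<infinity>n\<in>A N. t p * t n) = 0" using Suc by (simp add: infsum_cmult_right')
      ultimately show ?thesis using Suc by simp
    qed
  qed
  \<comment> \<open>Outside \<open>X\<close> the norms sum to at most 1/2. For \<open>N\<close>
    beyond \<open>X\<close>, all sieved terms except the term 1 lie outside \<open>X\<close>, so
    they cannot cancel it.\<close>
  obtain X where X: "finite X" "X \<subseteq> {1..}"
    "dist (sum (\<lambda>n. norm (t n)) X) (infsum (\<lambda>n. norm (t n)) {1..}) \<le> 1 / 2"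
    using infsum_finite_approximation[OF abs, of "1 / 2"] by auto
  define N where "N = Max (insert 1 X)"
  have N: "x \<le> N" if "x \<in> X" for x using X(1) that by (simp add: N_def)
  have AX: "A N - {1} \<subseteq> {1..} - X"
  proof
    fix n assume n: "n \<in> A N - {1}"
    then obtain q where "prime q" "q dvd n" using prime_factor_nat[of n] by auto
    then have "\<not> q \<le> N" "q \<le> n" using n by (auto simp: A_def intro: dvd_imp_le)
    then show "n \<in> {1..} - X" using n N[of n] by (auto simp: A_def)
  qed
  have 1: "1 \<in> A N" by (auto simp: A_def)
  have "infsum t (A N) = infsum t {1} + infsum t (A N - {1})"
    using infsum_Un_disjoint[of t "{1}" "A N - {1}"] smb[of "A N - {1}"] A1[of N] 1
    by (auto simp: insert_absorb)
  then have "infsum t (A N - {1}) = - 1" using sieved[of N] by (simp add: t_def eq_neg_iff_add_eq_0 add.commute)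
  then have "1 = norm (infsum t (A N - {1}))" by simp
  also have "\<dots> \<le> infsum (\<lambda>n. norm (t n)) (A N - {1})"
    by (rule norm_infsum_bound) (use sub[of "A N - {1}"] A1[of N] in auto)
  also have "\<dots> \<le> infsum (\<lambda>n. norm (t n)) ({1..} - X)"
    by (rule infsum_mono2[OF sub sub AX]) (use A1[of N] in auto)
  also have "\<dots> = infsum (\<lambda>n. norm (t n)) {1..} - infsum (\<lambda>n. norm (t n)) X"
    by (rule infsum_Diff[OF abs]) (use X in auto)
  also have "\<dots> \<le> 1 / 2"
    using X(3) unfolding dist_real_def infsum_finite[OF X(1)] by linarith
  finally show False by simp
qed

text \<open>The divisor sum is the convolution of the identity with the constant 1. The identity
  shifts \<open>s\<close> to \<open>s - 1\<close>, whence the bound 2 on the real part.\<close>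

lemma divisor_sum_series:
  assumes s: "Re s > 2"
  shows "(\<lambda>n. norm (of_nat (\<Sum>{d. d dvd n}) * (of_nat n :: complex) powr (- s))) summable_on {1..}"
    and "(\<Sum>\<^sub>\<infinity>n\<in>{1..}. of_nat (\<Sum>{d. d dvd n}) * of_nat n powr (- s)) = riemann_zeta s * riemann_zeta (s - 1)"
proof -
  have shift: "of_nat n * (of_nat n :: complex) powr (- s) = of_nat n powr (- (s - 1))" if "n \<in> {1..}" for n :: nat
  proof -
    have "(of_nat n :: complex) powr (1 + - s) = of_nat n powr 1 * of_nat n powr (- s)"
      by (rule powr_add)
    then show ?thesis using that by simp
  qed
  have f: "(\<lambda>n. norm (of_nat n * (of_nat n :: complex) powr (- s))) summable_on {1..}"
    by (rule summable_on_cong[THEN iffD2, OF _ nat_powr_abs_summable[of "s - 1"]])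
      (use s shift in auto)
  have g: "(\<lambda>n. norm (1 * (of_nat n :: complex) powr (- s))) summable_on {1..}"
    using nat_powr_abs_summable[of s] s by simp
  have eq: "(\<Sum>d | d dvd n. of_nat d * 1) = (of_nat (\<Sum>{d. d dvd n}) :: complex)" for n :: nat
    by simp
  have "(\<Sum>\<^sub>\<infinity>n\<in>{1..}. of_nat n * (of_nat n :: complex) powr (- s)) = riemann_zeta (s - 1)"
    unfolding riemann_zeta_def by (rule infsum_cong) (rule shift)
  then show "(\<Sum>\<^sub>\<infinity>n\<in>{1..}. of_nat (\<Sum>{d. d dvd n}) * of_nat n powr (- s)) = riemann_zeta s * riemann_zeta (s - 1)"
    using dirichlet_product(2)[OF f g, unfolded eq] by (simp add: riemann_zeta_def)
  show "(\<lambda>n. norm (of_nat (\<Sum>{d. d dvd n}) * (of_nat n :: complex) powr (- s))) summable_on {1..}"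
    using dirichlet_product(1)[OF f g, unfolded eq] .
qed

text \<open>The common majorant of all coefficient sequences in the final identity.\<close>

lemma divisor_sum_bounded_summable:
  assumes s: "Re s > 2" and f: "\<And>n. n \<ge> 1 \<Longrightarrow> norm (f n) \<le> real (\<Sum>{d. d dvd n})"
  shows "(\<lambda>n. norm (f n * (of_nat n :: complex) powr (- s))) summable_on {1..}"
proof (rule Infinite_Sum.abs_summable_on_comparison_test[OF divisor_sum_series(1)[OF s]])
  fix n :: nat assume "n \<in> {1..}"
  then show "norm (f n * (of_nat n :: complex) powr (- s))
      \<le> norm (of_nat (\<Sum>{d. d dvd n}) * (of_nat n :: complex) powr (- s))"
    unfolding norm_mult norm_of_nat using f[of n] by (intro mult_right_mono) auto
qed

section \<open>Classes of sublattices\<close>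

text \<open>Each class contributes 1, spread evenly over its elements.\<close>

lemma card_quotient_weighted:
  assumes S: "finite S" and r: "equiv S r"
  shows "(of_nat (card (S // r)) :: complex) = (\<Sum>K\<in>S. 1 / of_nat (card (r `` {K})))"
proof -
  have Q: "S // r = (\<lambda>K. r `` {K}) ` S" by (auto simp: quotient_def)
  have "(\<Sum>K\<in>S. 1 / of_nat (card (r `` {K})) :: complex)
      = (\<Sum>C\<in>S // r. \<Sum>K | K \<in> S \<and> r `` {K} = C. 1 / of_nat (card (r `` {K})))"
    unfolding Q by (rule sum.image_gen[OF S])
  also have "\<dots> = (\<Sum>C\<in>S // r. 1)"
  proof (rule sum.cong)
    fix C assume C: "C \<in> S // r"
    have "C \<noteq> {}" "C \<subseteq> S" using in_quotient_imp_non_empty[OF r C] in_quotient_imp_subset[OF r C] .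
    then have pos: "card C > 0" using S finite_subset by (auto simp: card_gt_0_iff)
    have "{K \<in> S. r `` {K} = C} = C"
    proof (intro equalityI subsetI)
      fix K assume "K \<in> C"
      then have "K \<in> S" using \<open>C \<subseteq> S\<close> by blast
      moreover from this have "K \<in> r `` {K}" "r `` {K} \<in> S // r"
        using equiv_class_self[OF r] quotientI by auto
      ultimately show "K \<in> {K \<in> S. r `` {K} = C}"
        using quotient_disj[OF r C] \<open>K \<in> C\<close> by blast
    qed (use equiv_class_self[OF r] in auto)
    moreover have "(\<Sum>K | K \<in> S \<and> r `` {K} = C. 1 / of_nat (card (r `` {K})) :: complex)
        = (\<Sum>K | K \<in> S \<and> r `` {K} = C. 1 / of_nat (card C))"
      by (rule sum.cong) auto
    ultimately show "(\<Sum>K | K \<in> S \<and> r `` {K} = C. 1 / of_nat (card (r `` {K})) :: complex) = 1"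
      using pos by simp
  qed simp
  finally show ?thesis by simp
qed

text \<open>Orbit and stabiliser for a possibly infinite group \<open>G\<close>: the finite set of
  \<sigma> that map \<open>K\<close> into \<open>L\<close> is sent onto the class of
  \<open>K\<close> by taking images, and every fibre is a coset of the stabiliser of
  \<open>K\<close>. Hence the weight 1 / (size of the class) is the quotient of the two
  cardinalities.\<close>

lemma num_classes_orbits:
  fixes L :: "'v::pos_def_quadratic_space set"
  assumes id: "id \<in> G" and comp: "\<And>\<sigma> \<tau>. \<sigma> \<in> G \<Longrightarrow> \<tau> \<in> G \<Longrightarrow> \<sigma> \<circ> \<tau> \<in> G"
    and inv: "\<And>\<sigma>. \<sigma> \<in> G \<Longrightarrow> \<exists>\<tau>\<in>G. \<tau> \<circ> \<sigma> = id \<and> \<sigma> \<circ> \<tau> = id"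
    and S: "finite (sublattices L m)"
    and closed: "\<And>\<sigma> K. \<sigma> \<in> G \<Longrightarrow> K \<in> sublattices L m \<Longrightarrow> \<sigma> ` K \<subseteq> L \<Longrightarrow> \<sigma> ` K \<in> sublattices L m"
    and fin: "\<And>K. K \<in> sublattices L m \<Longrightarrow> finite {\<sigma> \<in> G. \<sigma> ` K \<subseteq> L}"
  shows "(of_nat (num_classes G L m) :: complex) = (\<Sum>K\<in>sublattices L m.
    of_nat (card {\<sigma> \<in> G. \<sigma> ` K = K}) / of_nat (card {\<sigma> \<in> G. \<sigma> ` K \<subseteq> L}))"
    and "num_classes G L m \<le> card (sublattices L m)"
proof -
  let ?S = "sublattices L m"
  define r where "r = {(K1, K2). K1 \<in> ?S \<and> K2 \<in> ?S \<and> (\<exists>\<sigma>\<in>G. \<sigma> ` K1 = K2)}"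
  have eq: "equiv ?S r"
  proof (rule equivI)
    show "r \<subseteq> ?S \<times> ?S" by (auto simp: r_def)
    show "refl_on ?S r"
    proof (rule refl_onI)
      fix K assume "K \<in> ?S"
      moreover have "id ` K = K" by simp
      ultimately show "(K, K) \<in> r" unfolding r_def using id by blast
    qed
    show "sym r"
    proof (rule symI)
      fix K1 K2 assume "(K1, K2) \<in> r"
      then obtain \<sigma> where *: "K1 \<in> ?S" "K2 \<in> ?S" "\<sigma> \<in> G" "\<sigma> ` K1 = K2" by (auto simp: r_def)
      obtain \<tau> where \<tau>: "\<tau> \<in> G" "\<tau> \<circ> \<sigma> = id" using inv[OF *(3)] by blast
      have "\<tau> ` K2 = (\<tau> \<circ> \<sigma>) ` K1" unfolding *(4)[symmetric] by (rule image_comp)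
      then have "\<tau> ` K2 = K1" by (simp add: \<tau>(2))
      then show "(K2, K1) \<in> r" using * \<tau>(1) by (auto simp: r_def)
    qed
    show "trans r"
    proof (rule transI)
      fix K1 K2 K3 assume "(K1, K2) \<in> r" "(K2, K3) \<in> r"
      then obtain \<sigma> \<tau> where *: "K1 \<in> ?S" "K3 \<in> ?S" "\<sigma> \<in> G" "\<tau> \<in> G" "\<sigma> ` K1 = K2" "\<tau> ` K2 = K3"
        by (auto simp: r_def)
      have "(\<tau> \<circ> \<sigma>) ` K1 = K3" unfolding image_comp[symmetric] *(5) by (rule *(6))
      then show "(K1, K3) \<in> r" unfolding r_def using *(1,2) comp[OF *(4,3)] by blast
    qed
  qed
  have nc: "num_classes G L m = card (?S // r)" by (simp add: num_classes_def r_def)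
  then show "num_classes G L m \<le> card ?S"
    using card_image_le[OF S, of "\<lambda>K. r `` {K}"] by (simp only: quotient_def UNION_singleton_eq_range)
  have orbit: "card {\<sigma> \<in> G. \<sigma> ` K \<subseteq> L} = card (r `` {K}) * card {\<sigma> \<in> G. \<sigma> ` K = K}" if K: "K \<in> ?S" for K
  proof -
    let ?T = "{\<sigma> \<in> G. \<sigma> ` K \<subseteq> L}"
    have im: "(\<lambda>\<sigma>. \<sigma> ` K) ` ?T = r `` {K}"
    proof (intro equalityI subsetI)
      fix K' assume "K' \<in> (\<lambda>\<sigma>. \<sigma> ` K) ` ?T"
      then show "K' \<in> r `` {K}" unfolding r_def using K closed by blast
    next
      fix K' assume "K' \<in> r `` {K}"
      then obtain \<sigma> where "\<sigma> \<in> G" "\<sigma> ` K = K'" "K' \<in> ?S" by (auto simp: r_def)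
      moreover have "K' \<subseteq> L" using \<open>K' \<in> ?S\<close> by (simp add: sublattices_def)
      ultimately show "K' \<in> (\<lambda>\<sigma>. \<sigma> ` K) ` ?T" by blast
    qed
    have fibre: "card {\<sigma> \<in> ?T. \<sigma> ` K = K'} = card {\<sigma> \<in> G. \<sigma> ` K = K}" if K': "K' \<in> (\<lambda>\<sigma>. \<sigma> ` K) ` ?T" for K'
    proof -
      obtain \<sigma>0 where s0: "\<sigma>0 \<in> G" "K' = \<sigma>0 ` K" "\<sigma>0 ` K \<subseteq> L" using K' by auto
      obtain \<tau>0 where t0: "\<tau>0 \<in> G" "\<tau>0 \<circ> \<sigma>0 = id" "\<sigma>0 \<circ> \<tau>0 = id" using inv[OF s0(1)] by blast
      have "bij_betw (\<lambda>\<tau>. \<sigma>0 \<circ> \<tau>) {\<sigma> \<in> G. \<sigma> ` K = K} {\<sigma> \<in> ?T. \<sigma> ` K = K'}"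
      proof (rule bij_betw_byWitness[where f' = "\<lambda>\<tau>. \<tau>0 \<circ> \<tau>"])
        show "\<forall>\<tau>\<in>{\<sigma> \<in> G. \<sigma> ` K = K}. \<tau>0 \<circ> (\<sigma>0 \<circ> \<tau>) = \<tau>"
          by (simp add: fun_eq_iff) (metis comp_apply id_apply t0(2,3))
        show "\<forall>\<tau>\<in>{\<sigma> \<in> ?T. \<sigma> ` K = K'}. \<sigma>0 \<circ> (\<tau>0 \<circ> \<tau>) = \<tau>"
          by (simp add: fun_eq_iff) (metis comp_apply id_apply t0(2,3))
        show "(\<lambda>\<tau>. \<sigma>0 \<circ> \<tau>) ` {\<sigma> \<in> G. \<sigma> ` K = K} \<subseteq> {\<sigma> \<in> ?T. \<sigma> ` K = K'}"
        proof (rule image_subsetI)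
          fix \<tau> assume "\<tau> \<in> {\<sigma> \<in> G. \<sigma> ` K = K}"
          then show "\<sigma>0 \<circ> \<tau> \<in> {\<sigma> \<in> ?T. \<sigma> ` K = K'}"
            using s0 comp[OF s0(1)] image_comp[of \<sigma>0 \<tau> K] by simp
        qed
        show "(\<lambda>\<tau>. \<tau>0 \<circ> \<tau>) ` {\<sigma> \<in> ?T. \<sigma> ` K = K'} \<subseteq> {\<sigma> \<in> G. \<sigma> ` K = K}"
        proof (rule image_subsetI)
          fix \<tau> assume "\<tau> \<in> {\<sigma> \<in> ?T. \<sigma> ` K = K'}"
          then have "\<tau> \<in> G" "\<tau> ` K = \<sigma>0 ` K" using s0 by auto
          moreover have "\<tau>0 ` \<sigma>0 ` K = K" using t0(2) by (simp add: image_comp)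
          ultimately show "\<tau>0 \<circ> \<tau> \<in> {\<sigma> \<in> G. \<sigma> ` K = K}"
            using comp[OF t0(1) \<open>\<tau> \<in> G\<close>] image_comp[of \<tau>0 \<tau> K] by simp
        qed
      qed
      then show ?thesis by (rule bij_betw_same_card[symmetric])
    qed
    have "card ?T = (\<Sum>\<sigma>\<in>?T. 1)" by simp
    also have "\<dots> = (\<Sum>K'\<in>(\<lambda>\<sigma>. \<sigma> ` K) ` ?T. \<Sum>\<sigma> | \<sigma> \<in> ?T \<and> \<sigma> ` K = K'. 1)"
      by (rule sum.image_gen[OF fin[OF K]])
    also have "\<dots> = (\<Sum>K'\<in>(\<lambda>\<sigma>. \<sigma> ` K) ` ?T. card {\<sigma> \<in> G. \<sigma> ` K = K})"
    proof (rule sum.cong)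
      fix K' assume "K' \<in> (\<lambda>\<sigma>. \<sigma> ` K) ` ?T"
      from fibre[OF this] show "(\<Sum>\<sigma> | \<sigma> \<in> ?T \<and> \<sigma> ` K = K'. 1) = card {\<sigma> \<in> G. \<sigma> ` K = K}"
        unfolding card_eq_sum .
    qed simp
    finally show ?thesis unfolding im by (simp only: sum_constant of_nat_id)
  qed
  have weight: "1 / of_nat (card (r `` {K})) =
    (of_nat (card {\<sigma> \<in> G. \<sigma> ` K = K}) / of_nat (card {\<sigma> \<in> G. \<sigma> ` K \<subseteq> L}) :: complex)" if K: "K \<in> ?S" for K
  proof -
    have KL: "K \<subseteq> L" using K by (auto simp: sublattices_def)
    have "{\<sigma> \<in> G. \<sigma> ` K = K} \<subseteq> {\<sigma> \<in> G. \<sigma> ` K \<subseteq> L}" using KL by auto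
    moreover have "id \<in> {\<sigma> \<in> G. \<sigma> ` K = K}" using id by simp
    ultimately have "finite {\<sigma> \<in> G. \<sigma> ` K = K}" "{\<sigma> \<in> G. \<sigma> ` K = K} \<noteq> {}"
      using finite_subset[OF _ fin[OF K]] by auto
    then have "card {\<sigma> \<in> G. \<sigma> ` K = K} \<noteq> 0" by (simp only: card_0_eq not_False_eq_True)
    then have "of_nat (card {\<sigma> \<in> G. \<sigma> ` K = K}) \<noteq> (0 :: complex)" by (simp only: of_nat_eq_0_iff not_False_eq_True)
    then show ?thesis unfolding orbit[OF K] of_nat_mult
      by (rule nonzero_divide_mult_cancel_right[symmetric])
  qed
  show "(of_nat (num_classes G L m) :: complex) = (\<Sum>K\<in>?S.
    of_nat (card {\<sigma> \<in> G. \<sigma> ` K = K}) / of_nat (card {\<sigma> \<in> G. \<sigma> ` K \<subseteq> L}))"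
    unfolding nc card_quotient_weighted[OF S eq] by (rule sum.cong[OF refl weight])
qed

section \<open>Bases and Gram determinants of the quadratic plane\<close>

lemma bform_add_right: "bform x (y + z) = bform x y + bform x z"
  by (metis bform_add_left bform_sym)

lemma bform_scaleQ_right: "bform x (r *\<^sub>Q y) = r * bform x y"
  by (metis bform_scaleQ_left bform_sym)

lemma Z_spanI: "of_int i *\<^sub>Q x + of_int j *\<^sub>Q y \<in> Z_span x y"
  by (auto simp: Z_span_def)

lemma Z_spanE:
  assumes "v \<in> Z_span x y" obtains i j where "v = of_int i *\<^sub>Q x + of_int j *\<^sub>Q y"
  using assms by (auto simp: Z_span_def)

lemma Z_span_basis: "x \<in> Z_span x y" "y \<in> Z_span x y"
  using Z_spanI[of 1 x 0 y] Z_spanI[of 0 x 1 y] by (auto simp: scaleQ_one)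

lemma subgrp_Z_span: "subgrp (Z_span x y)"
  unfolding subgrp_def
proof (intro conjI ballI)
  show "0 \<in> Z_span x y" using Z_spanI[of 0 x 0 y] by simp
  fix v w assume "v \<in> Z_span x y" "w \<in> Z_span x y"
  then obtain i j k l where "v = of_int i *\<^sub>Q x + of_int j *\<^sub>Q y" "w = of_int k *\<^sub>Q x + of_int l *\<^sub>Q y"
    by (elim Z_spanE)
  then have "v - w = of_int (i - k) *\<^sub>Q x + of_int (j - l) *\<^sub>Q y"
    by (simp add: qspace.scale_left_diff_distrib)
  then show "v - w \<in> Z_span x y" by (metis Z_spanI)
qed

lemma plane_basis_coords:
  assumes "plane_basis x y" obtains p q where "v = p *\<^sub>Q x + q *\<^sub>Q y"
proof -
  have "v \<in> qspace.span {x, y}" using assms by (simp add: plane_basis_def)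
  then obtain p where "v - p *\<^sub>Q x \<in> qspace.span {y}"
    using qspace.span_breakdown_eq by blast
  then obtain q where "v - p *\<^sub>Q x = q *\<^sub>Q y" by (auto simp: qspace.span_singleton)
  then show thesis using that[of p q] by (simp add: algebra_simps)
qed

lemma det_gram: "det (gram_matrix x y) = bform x x * bform y y - bform x y * bform y x"
  unfolding gram_matrix_def by (rule det_vector_2)

text \<open>The component \<open>v\<close> of \<open>y\<close> orthogonal to \<open>x\<close>,
  scaled to avoid division, is nonzero, and \<open>bform v v\<close> is \<open>bform x x\<close>
  times the determinant.\<close>

lemma det_gram_pos:
  assumes "plane_basis x y" shows "det (gram_matrix x y) > 0"
proof -
  have ind: "qspace.independent {x, y}" "x \<noteq> y" using assms by (auto simp: plane_basis_def)
  have x0: "x \<noteq> 0" using ind(1) qspace.dependent_zero[of "{x, y}"] by auto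
  then have pos: "bform x x > 0" by (rule bform_pos)
  define v where "v = bform x x *\<^sub>Q y + (- bform x y) *\<^sub>Q x"
  have "v \<noteq> 0"
  proof
    assume "v = 0"
    then have "bform x x *\<^sub>Q y = bform x y *\<^sub>Q x" by (simp add: v_def)
    then have "(1 / bform x x) *\<^sub>Q (bform x x *\<^sub>Q y) = (1 / bform x x) *\<^sub>Q (bform x y *\<^sub>Q x)" by simp
    then have "y = (bform x y / bform x x) *\<^sub>Q x" using pos by (simp add: scaleQ_scaleQ scaleQ_one)
    then have "y \<in> qspace.span {x}" by (metis qspace.span_scale qspace.span_base insertI1)
    moreover have "qspace.independent (insert y {x})" using ind(1) by (simp add: insert_commute)
    ultimately show False using ind(2) unfolding qspace.independent_insert by simp
  qed
  then have "bform v v > 0" by (rule bform_pos)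
  also have "bform v v = bform x x * det (gram_matrix x y)"
    unfolding v_def det_gram bform_add_left bform_add_right bform_scaleQ_left bform_scaleQ_right bform_sym[of y x]
    by (simp add: algebra_simps)
  finally show ?thesis using pos by (simp add: zero_less_mult_iff)
qed

lemma det_gram_comb:
  "det (gram_matrix (p *\<^sub>Q x + q *\<^sub>Q y) (r *\<^sub>Q x + t *\<^sub>Q y)) = (p * t - q * r)\<^sup>2 * det (gram_matrix x y)"
  unfolding det_gram
  by (simp add: bform_add_left bform_add_right bform_scaleQ_left bform_scaleQ_right bform_sym[of y x])
    (simp add: power2_eq_square algebra_simps)

text \<open>The definite description is legitimate: base changes between two bases of
  \<open>L\<close> are integral in both directions, so the squares of their determinants have
  product 1 and are 1.\<close>

lemma lattice_det_eq:
  assumes e: "Z_basis e1 e2 L"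
  shows "lattice_det L = det (gram_matrix e1 e2)"
  unfolding lattice_det_def
proof (rule the_equality)
  show "\<exists>f1 f2. Z_basis f1 f2 L \<and> det (gram_matrix e1 e2) = det (gram_matrix f1 f2)" using e by blast
  fix d assume "\<exists>f1 f2. Z_basis f1 f2 L \<and> d = det (gram_matrix f1 f2)"
  then obtain f1 f2 where f: "Z_basis f1 f2 L" and d: "d = det (gram_matrix f1 f2)" by blast
  have L: "L = Z_span e1 e2" "L = Z_span f1 f2" using e f by (auto simp: Z_basis_def)
  have "f1 \<in> Z_span e1 e2" "f2 \<in> Z_span e1 e2" "e1 \<in> Z_span f1 f2" "e2 \<in> Z_span f1 f2"
    using L Z_span_basis by metis+
  then obtain p q r t p' q' r' t' where
    1: "f1 = of_int p *\<^sub>Q e1 + of_int q *\<^sub>Q e2" "f2 = of_int r *\<^sub>Q e1 + of_int t *\<^sub>Q e2" and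
    2: "e1 = of_int p' *\<^sub>Q f1 + of_int q' *\<^sub>Q f2" "e2 = of_int r' *\<^sub>Q f1 + of_int t' *\<^sub>Q f2"
    by (elim Z_spanE)
  define \<Delta> where "\<Delta> = (p * t - q * r)\<^sup>2"
  define \<Delta>' where "\<Delta>' = (p' * t' - q' * r')\<^sup>2"
  let ?e = "det (gram_matrix e1 e2)" and ?f = "det (gram_matrix f1 f2)"
  have f_e: "?f = of_int \<Delta> * ?e"
    using det_gram_comb[of "of_int p" e1 "of_int q" e2 "of_int r" "of_int t"]
    unfolding 1[symmetric] by (simp add: \<Delta>_def)
  have e_f: "?e = of_int \<Delta>' * ?f"
    using det_gram_comb[of "of_int p'" f1 "of_int q'" f2 "of_int r'" "of_int t'"]
    unfolding 2[symmetric] by (simp add: \<Delta>'_def)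
  have e0: "?e \<noteq> 0" using det_gram_pos[of e1 e2] e by (simp add: Z_basis_def)
  have "1 * ?e = of_int (\<Delta>' * \<Delta>) * ?e"
    unfolding of_int_mult mult.assoc mult_1 f_e[symmetric] by (rule e_f)
  then have "rat_of_int (\<Delta>' * \<Delta>) = 1" unfolding mult_right_cancel[OF e0] by (rule sym)
  then have "\<Delta>' * \<Delta> = 1" by (simp only: of_int_eq_1_iff)
  moreover have "0 \<le> \<Delta>" by (simp add: \<Delta>_def)
  ultimately have "\<Delta> = 1" by (metis abs_of_nonneg abs_zmult_eq_1 abs_1 mult.commute)
  then show "d = ?e" using d f_e by simp
qed

lemma independent_pair:
  assumes "y \<noteq> 0" "\<And>k. x \<noteq> k *\<^sub>Q y"
  shows "qspace.independent {x, y}"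
proof -
  have "x \<notin> qspace.span {y}" using assms(2) by (auto simp: qspace.span_singleton)
  moreover have "qspace.independent {y}"
    using assms(1) by (simp add: qspace.independent_insert)
  ultimately show ?thesis using qspace.span_base[of x "{y}"] by (auto simp: qspace.independent_insert)
qed

lemma plane_basis_exchange:
  fixes e1 e2 f1 f2 :: "'v::pos_def_quadratic_space"
  assumes e: "plane_basis e1 e2" and f: "f1 \<noteq> f2" "qspace.independent {f1, f2}"
  shows "plane_basis f1 f2"
proof -
  have "v \<in> qspace.span {f1, f2}" for v
  proof (rule ccontr)
    assume v: "v \<notin> qspace.span {f1, f2}"
    then have "v \<notin> {f1, f2}" using qspace.span_base[of v "{f1, f2}"] by argo
    then have "card {v, f1, f2} = 3" using f(1) by simp
    moreover have "qspace.independent {v, f1, f2}" using v f(2) by (rule qspace.independent_insertI)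
    moreover have "{v, f1, f2} \<subseteq> qspace.span {e1, e2}" using e by (simp add: plane_basis_def)
    ultimately have "3 \<le> card {e1, e2}"
      using qspace.independent_span_bound[of "{e1, e2}" "{v, f1, f2}"] by simp
    also have "card {e1, e2} \<le> 2" by (simp add: card_insert_if)
    finally show False by simp
  qed
  then show ?thesis using f by (auto simp: plane_basis_def)
qed

lemma cross_rat_comb:
  "cross (of_rat p * x + of_rat q * y) (of_rat r * x + of_rat t * y) = of_rat (p * t - q * r) * cross x y"
proof -
  have "of_rat k = complex_of_real (of_rat k)" for k
    by (cases k) (simp add: of_rat_rat)
  then have Re_Im: "Re (of_rat k) = of_rat k" "Im (of_rat k) = 0" for k
    by (metis Re_complex_of_real Im_complex_of_real)+
  show ?thesis
    by (simp add: cross_def Re_Im of_rat_diff of_rat_mult algebra_simps)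
qed

section \<open>The lattice as an ideal\<close>

lemma bform_of_form:
  assumes form: "\<And>x y :: int. qform (of_int x *\<^sub>Q e1 + of_int y *\<^sub>Q e2)
    = of_int (a * x\<^sup>2 + b * x * y + c * y\<^sup>2)"
  shows "bform e1 e1 = of_int a" "bform e2 e2 = of_int c"
    "bform e1 e2 = of_int b / 2" "bform e2 e1 = of_int b / 2"
proof -
  show 1: "bform e1 e1 = of_int a" and 2: "bform e2 e2 = of_int c"
    using form[of 1 0] form[of 0 1] by (simp_all add: qform_def scaleQ_one)
  have "bform e1 e1 + 2 * bform e1 e2 + bform e2 e2 = of_int a + of_int b + of_int c"
    using form[of 1 1]
    by (simp add: qform_def scaleQ_one bform_add_left bform_add_right bform_sym[of e2 e1])
  then show "bform e1 e2 = of_int b / 2" "bform e2 e1 = of_int b / 2"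
    unfolding 1 2 bform_sym[of e2 e1] by simp_all
qed

locale quadratic_lattice = quadratic_order b "a * c" D F
  for a b c D :: int and F :: "complex set" +
  fixes e1 e2 :: "'v::pos_def_quadratic_space" and L :: "'v set"
  assumes a_pos: "a > 0" and basis: "Z_basis e1 e2 L" and integral_form: "qform ` L \<subseteq> \<int>"
    and form: "\<And>x y :: int. qform (of_int x *\<^sub>Q e1 + of_int y *\<^sub>Q e2)
      = of_int (a * x\<^sup>2 + b * x * y + c * y\<^sup>2)"
begin

lemmas bform_basis = bform_of_form[OF form]

text \<open>Reading the coordinates off by \<open>bform\<close>, \<open>phi\<close> is the map \<open>x e1 + y e2 \<mapsto> a x + tau y\<close>.\<close>

definition phi :: "'v \<Rightarrow> complex"
  where "phi v = of_rat (bform v e1)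
    + of_rat ((4 * of_int a * bform v e2 - 2 * of_int b * bform v e1) / (2 * of_int D)) * csqrt (of_int D)"

lemma phi_add: "phi (v + w) = phi v + phi w"
proof -
  have "(4 * of_int a * bform (v + w) e2 - 2 * of_int b * bform (v + w) e1) / (2 * of_int D)
    = (4 * of_int a * bform v e2 - 2 * of_int b * bform v e1) / (2 * of_int D)
      + (4 * of_int a * bform w e2 - 2 * of_int b * bform w e1) / (2 * of_int D)"
    unfolding bform_add_left add_divide_distrib[symmetric] by (simp add: algebra_simps)
  then show ?thesis unfolding phi_def bform_add_left[of v w e1] by (simp only: of_rat_add ring_distribs add_ac)
qed

lemma phi_scale: "phi (r *\<^sub>Q v) = of_rat r * phi v"
proof -
  have "(4 * of_int a * bform (r *\<^sub>Q v) e2 - 2 * of_int b * bform (r *\<^sub>Q v) e1) / (2 * of_int D)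
    = r * ((4 * of_int a * bform v e2 - 2 * of_int b * bform v e1) / (2 * of_int D))"
    unfolding bform_scaleQ_left times_divide_eq_right by (simp add: algebra_simps)
  then show ?thesis unfolding phi_def bform_scaleQ_left[of r v e1]
    by (simp only: of_rat_mult ring_distribs mult.assoc)
qed

lemma phi_diff: "phi (v - w) = phi v - phi w"
  using phi_add[of "v - w" w] by simp

lemma phi_basis: "phi e1 = of_int a" "phi e2 = tau"
proof -
  show "phi e1 = of_int a" by (simp add: phi_def bform_basis)
  have "(4 * of_int a * bform e2 e2 - 2 * of_int b * bform e2 e1) / (2 * of_int D)
      = (4 * of_int a * of_int c - of_int b * of_int b) / (2 * of_int D :: rat)"
    by (simp add: bform_basis)
  also have "\<dots> = (- of_int D) / (2 * of_int D)" by (simp add: D_eq power2_eq_square)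
  also have "\<dots> = - 1 / 2" using D_neg by simp
  finally show "phi e2 = tau"
    unfolding phi_def bform_basis tau_def
    by (simp add: of_rat_divide of_rat_minus diff_divide_distrib)
qed

lemma phi_comb: "phi (x *\<^sub>Q v + y *\<^sub>Q w) = of_rat x * phi v + of_rat y * phi w"
  by (simp add: phi_add phi_scale)

lemma basis_coords: obtains x y where "v = x *\<^sub>Q e1 + y *\<^sub>Q e2"
  using plane_basis_coords[of e1 e2 v] basis by (auto simp: Z_basis_def)

lemma cross_a_tau: "cross (of_int a) tau \<noteq> 0"
  using cross_1_tau a_pos by (simp add: cross_def)

lemma phi_inj: "inj phi"
proof (rule injI)
  fix v w assume "phi v = phi w"
  then have 0: "phi (v - w) = 0" by (simp add: phi_diff)
  obtain x y where xy: "v - w = x *\<^sub>Q e1 + y *\<^sub>Q e2" by (rule basis_coords)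
  have z: "of_rat x * of_int a + of_rat y * tau = 0"
    using 0 unfolding xy phi_comb phi_basis .
  have "of_rat x * cross (of_int a) tau = 0"
    using cross_rat_comb[of x "of_int a" y tau 0 1] unfolding z by (simp add: cross_def)
  moreover have "of_rat y * cross (of_int a) tau = 0"
    using cross_rat_comb[of 1 "of_int a" 0 tau x y] unfolding z by (simp add: cross_def)
  ultimately have "x = 0" "y = 0" using cross_a_tau by auto
  then show "v = w" using xy by simp
qed

text \<open>Being onto \<open>F\<close> allows every element of norm 1 to act on the quadratic space
  through \<open>phi\<close>. The preimage comes from solving for the coordinates with the square
  root of \<open>D\<close> equal to \<open>b - 2 * tau\<close>.\<close>

lemma range_phi: "range phi = F"
proof (intro equalityI subsetI)
  fix z assume "z \<in> range phi"
  then show "z \<in> F" by (auto simp: phi_def F_I)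
next
  fix z assume "z \<in> F"
  then obtain p q where z: "z = of_rat p + of_rat q * csqrt (of_int D)" by (rule F_E)
  have cs: "csqrt (of_int D) = of_int b - 2 * tau" by (simp add: tau_def field_simps)
  have "phi (((p + q * of_int b) / of_int a) *\<^sub>Q e1 + (- 2 * q) *\<^sub>Q e2)
      = of_rat (p + q * of_int b) + of_rat (- 2 * q) * tau"
    using a_pos unfolding phi_comb phi_basis by (simp add: of_rat_divide)
  also have "\<dots> = z"
    unfolding z cs by (simp add: of_rat_add of_rat_mult of_rat_minus algebra_simps)
  finally have "z = phi (((p + q * of_int b) / of_int a) *\<^sub>Q e1 + (- 2 * q) *\<^sub>Q e2)" by (rule sym)
  then show "z \<in> range phi" by blast
qed

text \<open>Since \<open>tau\<close> has trace \<open>b\<close> and norm \<open>a * c\<close>, the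
  norm of \<open>a * x + tau * y\<close> is \<open>a\<close> times the form of \<open>L\<close>. So
  \<open>phi\<close> is a similitude with factor \<open>a\<close>, and isometries correspond to maps
  that preserve absolute values.\<close>

lemma phi_norm: "complex_of_real ((cmod (phi v))\<^sup>2) = of_rat (of_int a * qform v)"
proof -
  obtain x y where v: "v = x *\<^sub>Q e1 + y *\<^sub>Q e2" by (rule basis_coords)
  have q: "qform v = x * x * of_int a + x * y * of_int b + y * y * of_int c"
    unfolding qform_def v bform_add_left bform_add_right bform_scaleQ_left bform_scaleQ_right bform_basis
    by (simp add: algebra_simps)
  have "phi v * cnj (phi v)
      = (of_rat x * of_int a + of_rat y * tau) * (of_rat x * of_int a + of_rat y * (of_int b - tau))"
    unfolding v phi_comb phi_basis by (simp add: cnj_of_rat cnj_tau)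
  also have "\<dots> = of_rat x * of_rat x * of_int a * of_int a + of_rat x * of_rat y * of_int a * of_int b
      + of_rat y * of_rat y * (of_int b * tau - tau * tau)"
    by (simp add: algebra_simps)
  also have "of_int b * tau - tau * tau = of_int a * of_int c" by (simp add: tau_sq)
  also have "of_rat x * of_rat x * of_int a * of_int a + of_rat x * of_rat y * of_int a * of_int b
      + of_rat y * of_rat y * (of_int a * of_int c) = (of_rat (of_int a * qform v) :: complex)"
    unfolding q by (simp add: of_rat_add of_rat_mult algebra_simps)
  finally show ?thesis unfolding complex_norm_square .
qed

lemma qform_eq_iff: "qform v = qform w \<longleftrightarrow> cmod (phi v) = cmod (phi w)"
proof -
  have "cmod (phi v) = cmod (phi w) \<longleftrightarrow> (cmod (phi v))\<^sup>2 = (cmod (phi w))\<^sup>2"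
    by (simp add: power2_eq_iff_nonneg)
  also have "\<dots> \<longleftrightarrow> complex_of_real ((cmod (phi v))\<^sup>2) = complex_of_real ((cmod (phi w))\<^sup>2)"
    by (simp only: of_real_eq_iff)
  also have "\<dots> \<longleftrightarrow> of_int a * qform v = of_int a * qform w"
    unfolding phi_norm by (simp only: of_rat_eq_iff)
  also have "\<dots> \<longleftrightarrow> qform v = qform w" using a_pos by simp
  finally show ?thesis by simp
qed

section \<open>The orthogonal group in terms of elements of norm 1\<close>

definition iso :: "(complex \<Rightarrow> complex \<Rightarrow> complex) \<Rightarrow> complex \<Rightarrow> 'v \<Rightarrow> 'v"
  where "iso f u v = inv_into UNIV phi (f u (phi v))"

lemma phi_F: "phi v \<in> F"
  using range_phi by blast

lemma phi_iso:
  assumes "u \<in> U" "f \<in> {cmul, ccmul}"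
  shows "phi (iso f u v) = f u (phi v)"
proof -
  have "f u (phi v) \<in> range phi"
    unfolding range_phi using assms phi_F[of v] by (auto simp: cmul_def ccmul_def U_def F_mult F_cnj)
  then show ?thesis unfolding iso_def by (rule f_inv_into_f)
qed

lemma iso_eqI:
  assumes "u \<in> U" "f \<in> {cmul, ccmul}" "\<And>v. phi (\<sigma> v) = f u (phi v)"
  shows "\<sigma> = iso f u"
proof
  fix v
  have "phi (\<sigma> v) = phi (iso f u v)" unfolding assms(3) phi_iso[OF assms(1,2)] ..
  then show "\<sigma> v = iso f u v" by (rule injD[OF phi_inj])
qed

lemma iso_comp:
  assumes "u \<in> U" "v \<in> U"
  shows "iso cmul u \<circ> iso cmul v = iso cmul (u * v)" "iso cmul u \<circ> iso ccmul v = iso ccmul (u * v)"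
    "iso ccmul u \<circ> iso cmul v = iso ccmul (u * cnj v)" "iso ccmul u \<circ> iso ccmul v = iso cmul (u * cnj v)"
  using assms
  by (auto intro!: iso_eqI U_mult U_cnj simp: phi_iso) (simp_all add: cmul_def ccmul_def mult_ac)

lemma iso_one: "iso cmul 1 = id"
  by (rule iso_eqI[symmetric]) (simp_all add: one_U cmul_def)

lemma iso_inverse:
  assumes "u \<in> U"
  shows "iso cmul (1 / u) \<circ> iso cmul u = id" "iso cmul u \<circ> iso cmul (1 / u) = id"
    "iso ccmul u \<circ> iso ccmul u = id"
proof -
  have "u * cnj u = 1" using assms complex_norm_square[of u] by (simp add: U_def)
  then show "iso cmul (1 / u) \<circ> iso cmul u = id" "iso cmul u \<circ> iso cmul (1 / u) = id"
    "iso ccmul u \<circ> iso ccmul u = id"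
    using assms U_nonzero[OF assms] U_divide[OF one_U assms] by (simp_all add: iso_comp iso_one)
qed

lemma bform_polar: "bform x y = (qform (x + y) - qform x - qform y) / 2"
  by (simp add: qform_def bform_add_left bform_add_right bform_sym[of y x])

lemma linear_scaleQ_iff:
  "Vector_Spaces.linear scaleQ scaleQ (\<sigma> :: 'v \<Rightarrow> 'v) \<longleftrightarrow>
    (\<forall>x y. \<sigma> (x + y) = \<sigma> x + \<sigma> y) \<and> (\<forall>r x. \<sigma> (r *\<^sub>Q x) = r *\<^sub>Q \<sigma> x)"
  unfolding Vector_Spaces.linear_iff using qspace.vector_space_axioms by blast

lemma iso_orth:
  assumes u: "u \<in> U" and f: "f \<in> {cmul, ccmul}"
  shows "iso f u \<in> O\<^sub>V"
proof -
  have add: "iso f u (x + y) = iso f u x + iso f u y" for x y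
  proof (rule injD[OF phi_inj])
    show "phi (iso f u (x + y)) = phi (iso f u x + iso f u y)"
      using f by (auto simp: phi_add phi_iso[OF u f]) (simp_all add: cmul_def ccmul_def algebra_simps)
  qed
  have scale: "iso f u (r *\<^sub>Q x) = r *\<^sub>Q iso f u x" for r x
  proof (rule injD[OF phi_inj])
    show "phi (iso f u (r *\<^sub>Q x)) = phi (r *\<^sub>Q iso f u x)"
      using f by (auto simp: phi_scale phi_iso[OF u f]) (simp_all add: cmul_def ccmul_def cnj_of_rat)
  qed
  have q: "qform (iso f u x) = qform x" for x
    unfolding qform_eq_iff phi_iso[OF u f] using u f by (auto simp: U_def cmul_def ccmul_def norm_mult)
  have "\<exists>\<tau>. \<tau> \<circ> iso f u = id \<and> iso f u \<circ> \<tau> = id"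
    using f iso_inverse[OF u] by blast
  then have "bij (iso f u)" by (metis o_bij)
  moreover have "bform (iso f u x) (iso f u y) = bform x y" for x y
    unfolding bform_polar add[symmetric] q ..
  ultimately show ?thesis
    unfolding orth_group_def linear_scaleQ_iff using add scale by blast
qed

text \<open>After division by the factor \<open>p\<close> that \<sigma> applies to
  \<open>phi e1\<close>, the image \<open>q\<close> of \<open>tau\<close> has the absolute value of
  \<open>tau\<close> and, by comparing \<open>a + q\<close> with \<open>a + tau\<close>, also its
  real part. So \<open>q\<close> is \<open>tau\<close> or its conjugate.\<close>

lemma orth_cases:
  assumes "\<sigma> \<in> O\<^sub>V"
  shows "\<exists>u\<in>U. \<sigma> = iso cmul u \<or> \<sigma> = iso ccmul u"
proof -
  have add: "\<sigma> (x + y) = \<sigma> x + \<sigma> y" and scale: "\<sigma> (r *\<^sub>Q x) = r *\<^sub>Q \<sigma> x"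
    and bf: "bform (\<sigma> x) (\<sigma> y) = bform x y" for x y r
    using assms unfolding orth_group_def linear_scaleQ_iff by blast+
  have norm: "cmod (phi (\<sigma> v)) = cmod (phi v)" for v
    unfolding qform_eq_iff[symmetric] by (simp add: qform_def bf)
  define p where "p = phi (\<sigma> e1) / of_int a"
  have a0: "of_int a \<noteq> (0 :: complex)" using a_pos by simp
  have "cmod p = 1" using norm[of e1] a_pos by (simp add: p_def norm_divide phi_basis)
  then have p: "p \<in> U" unfolding U_def p_def by (simp add: F_divide phi_F F_of_int)
  have p0: "p \<noteq> 0" by (rule U_nonzero[OF p])
  define q where "q = phi (\<sigma> e2) / p"
  have s1: "phi (\<sigma> e1) = p * of_int a" using a0 by (simp add: p_def)
  have s2: "phi (\<sigma> e2) = p * q" using p0 by (simp add: q_def)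
  have "cmod q = cmod tau" using norm[of e2] \<open>cmod p = 1\<close> by (simp add: s2 norm_mult phi_basis)
  then have n1: "(Re q)\<^sup>2 + (Im q)\<^sup>2 = (Re tau)\<^sup>2 + (Im tau)\<^sup>2"
    unfolding cmod_power2[symmetric] by simp
  have "phi (\<sigma> (e1 + e2)) = p * (of_int a + q)" by (simp add: add phi_add s1 s2 ring_distribs)
  then have "cmod (of_int a + q) = cmod (of_int a + tau)"
    using norm[of "e1 + e2"] \<open>cmod p = 1\<close> by (simp add: norm_mult phi_basis phi_add)
  then have "(cmod (of_int a + q))\<^sup>2 = (cmod (of_int a + tau))\<^sup>2" by simp
  then have "(of_int a + Re q)\<^sup>2 + (Im q)\<^sup>2 = (of_int a + Re tau)\<^sup>2 + (Im tau)\<^sup>2"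
    unfolding cmod_power2 by simp
  then have "2 * of_int a * Re q = 2 * of_int a * Re tau"
    unfolding power2_sum using n1 by linarith
  then have re: "Re q = Re tau" using a_pos by simp
  then have "(Im q)\<^sup>2 = (Im tau)\<^sup>2" using n1 by simp
  then have "Im q = Im tau \<or> Im q = - Im tau" by (simp add: power2_eq_iff)
  then have q: "q = tau \<or> q = cnj tau" using re by (auto simp: complex_eq_iff)
  have \<sigma>: "phi (\<sigma> (x *\<^sub>Q e1 + y *\<^sub>Q e2)) = p * (of_rat x * of_int a + of_rat y * q)" for x y
    by (simp add: add scale phi_add phi_scale s1 s2 algebra_simps)
  show ?thesis
  proof (cases "q = tau")
    case True
    have "\<sigma> = iso cmul p"
    proof (rule iso_eqI[OF p])
      fix v obtain x y where v: "v = x *\<^sub>Q e1 + y *\<^sub>Q e2" by (rule basis_coords)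
      show "phi (\<sigma> v) = cmul p (phi v)"
        unfolding v \<sigma> phi_comb phi_basis True cmul_def ..
    qed simp
    then show ?thesis using p by blast
  next
    case False
    then have q: "q = cnj tau" using q by blast
    have "\<sigma> = iso ccmul p"
    proof (rule iso_eqI[OF p])
      fix v obtain x y where v: "v = x *\<^sub>Q e1 + y *\<^sub>Q e2" by (rule basis_coords)
      show "phi (\<sigma> v) = ccmul p (phi v)"
        unfolding v \<sigma> phi_comb phi_basis q ccmul_def by (simp add: cnj_of_rat)
    qed simp
    then show ?thesis using p by blast
  qed
qed

lemma cross_phi_matrix:
  assumes "v' = p *\<^sub>Q v + q *\<^sub>Q w" "w' = r *\<^sub>Q v + t *\<^sub>Q w"
  shows "cross (phi v') (phi w') = of_rat (p * t - q * r) * cross (phi v) (phi w)"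
  unfolding assms phi_comb by (rule cross_rat_comb)

text \<open>A rational base change multiplies the area by its determinant. Expressing
  \<open>e1\<close> and \<open>e2\<close> in a basis gives one direction; a linear relation makes
  the area 0, which gives the other.\<close>

lemma plane_basis_cross: "plane_basis f1 f2 \<longleftrightarrow> cross (phi f1) (phi f2) \<noteq> 0"
proof
  assume f: "plane_basis f1 f2"
  obtain p q where 1: "e1 = p *\<^sub>Q f1 + q *\<^sub>Q f2" using plane_basis_coords[OF f] .
  obtain r t where 2: "e2 = r *\<^sub>Q f1 + t *\<^sub>Q f2" using plane_basis_coords[OF f] .
  have "cross (of_int a) tau = of_rat (p * t - q * r) * cross (phi f1) (phi f2)"
    using cross_phi_matrix[OF 1 2] unfolding phi_basis .
  then show "cross (phi f1) (phi f2) \<noteq> 0" using cross_a_tau by auto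
next
  assume nz: "cross (phi f1) (phi f2) \<noteq> 0"
  have phi0: "phi 0 = 0" using phi_diff[of 0 0] by simp
  have "f1 \<noteq> f2" using nz by (auto simp: cross_def)
  moreover have "qspace.independent {f1, f2}"
  proof (rule independent_pair)
    show "f2 \<noteq> 0" using nz phi0 by (auto simp: cross_def)
    show "f1 \<noteq> k *\<^sub>Q f2" for k
    proof
      assume "f1 = k *\<^sub>Q f2"
      then have "f1 = 0 *\<^sub>Q f1 + k *\<^sub>Q f2" "f2 = 0 *\<^sub>Q f1 + 1 *\<^sub>Q f2" by (simp_all add: scaleQ_one)
      from cross_phi_matrix[OF this] nz show False by simp
    qed
  qed
  moreover have "plane_basis e1 e2" using basis by (simp add: Z_basis_def)
  ultimately show "plane_basis f1 f2" using plane_basis_exchange by blast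
qed

text \<open>Determinants are read off from oriented areas: a rotation preserves the area, so its
  matrix has determinant 1. A reflection reverses the sign, which rules out determinant 1 in any
  basis.\<close>

lemma SL_cmul:
  assumes u: "u \<in> U" shows "iso cmul u \<in> SL_plane"
proof -
  have e: "plane_basis e1 e2" using basis by (simp add: Z_basis_def)
  obtain p q where 1: "iso cmul u e1 = p *\<^sub>Q e1 + q *\<^sub>Q e2" by (rule basis_coords)
  obtain r t where 2: "iso cmul u e2 = r *\<^sub>Q e1 + t *\<^sub>Q e2" by (rule basis_coords)
  have "of_rat (p * t - q * r) * cross (phi e1) (phi e2) = cross (cmul u (phi e1)) (cmul u (phi e2))"
    using cross_phi_matrix[OF 1 2] phi_iso[OF u, of cmul] by simp
  also have "\<dots> = 1 * cross (phi e1) (phi e2)" using u by (simp add: cross_similar U_def)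
  finally have "real_of_rat (p * t - q * r) = 1"
    using e plane_basis_cross mult_right_cancel by blast
  then have det: "p * t - q * r = 1" by simp
  define A :: "rat^2^2" where "A = vector [vector [p, r], vector [q, t]]"
  have "det A = 1" using det unfolding A_def det_vector_2 by (simp add: mult.commute)
  moreover have "A$1$1 = p" "A$2$1 = q" "A$1$2 = r" "A$2$2 = t" by (simp_all add: A_def)
  ultimately have "\<exists>A :: rat^2^2. plane_basis e1 e2 \<and>
       iso cmul u e1 = A$1$1 *\<^sub>Q e1 + A$2$1 *\<^sub>Q e2 \<and>
       iso cmul u e2 = A$1$2 *\<^sub>Q e1 + A$2$2 *\<^sub>Q e2 \<and> det A = 1"
    using e 1 2 by (intro exI[of _ A]) simp
  moreover have "Vector_Spaces.linear scaleQ scaleQ (iso cmul u)"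
    using iso_orth[OF u, of cmul] by (simp add: orth_group_def)
  ultimately show ?thesis unfolding SL_plane_def by blast
qed

lemma not_SL_ccmul:
  assumes u: "u \<in> U" shows "iso ccmul u \<notin> SL_plane"
proof
  assume "iso ccmul u \<in> SL_plane"
  then obtain f1 f2 and A :: "rat^2^2" where f: "plane_basis f1 f2"
    and 1: "iso ccmul u f1 = A$1$1 *\<^sub>Q f1 + A$2$1 *\<^sub>Q f2"
    and 2: "iso ccmul u f2 = A$1$2 *\<^sub>Q f1 + A$2$2 *\<^sub>Q f2" and det: "det A = 1"
    unfolding SL_plane_def by blast
  have "cross (ccmul u (phi f1)) (ccmul u (phi f2)) = of_rat (A$1$1 * A$2$2 - A$2$1 * A$1$2) * cross (phi f1) (phi f2)"
    using cross_phi_matrix[OF 1 2] phi_iso[OF u, of ccmul] by simp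
  also have "A$1$1 * A$2$2 - A$2$1 * A$1$2 = 1" using det by (simp add: det_2 mult.commute)
  finally have "cross (phi f1) (phi f2) = 0" using u by (simp add: cross_similar U_def)
  then show False using f plane_basis_cross by blast
qed

lemma orth_plus_eq: "O\<^sub>V\<^sup>+ = iso cmul ` U"
  and orth_minus_eq: "O\<^sub>V - O\<^sub>V\<^sup>+ = iso ccmul ` U"
  and orth_eq: "O\<^sub>V = iso cmul ` U \<union> iso ccmul ` U"
  unfolding orth_group_plus_def
  using orth_cases iso_orth[of _ cmul] iso_orth[of _ ccmul] SL_cmul not_SL_ccmul by blast+

lemma iso_disjoint: "iso cmul ` U \<inter> iso ccmul ` U = {}"
  using orth_plus_eq orth_minus_eq by blast

lemma iso_inj:
  assumes f: "f \<in> {cmul, ccmul}" shows "inj_on (iso f) U"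
proof (rule inj_onI)
  fix u v assume uv: "u \<in> U" "v \<in> U" "iso f u = iso f v"
  then have "f u (phi e1) = f v (phi e1)" using phi_iso[OF _ f] by metis
  then have "u * of_int a = v * of_int a" using f by (auto simp: phi_basis cmul_def ccmul_def)
  then show "u = v" using a_pos by simp
qed

section \<open>Sublattices of \<open>L\<close> as subgroups of the ideal\<close>

definition lideal :: "complex set" where "lideal = Zlat (of_int a) tau"

text \<open>As the norm of \<open>tau\<close> is a multiple of \<open>a\<close>, the relation
  \<open>tau * tau = b * tau - a * c\<close> keeps multiples by \<open>tau\<close> inside.\<close>

lemma olat_lideal: "olat lideal"
proof -
  have "planar lideal" using cross_a_tau by (auto simp: lideal_def planar_def)
  moreover have sub: "lideal \<subseteq> Ord"
    unfolding lideal_def by (intro Zlat_subset subgrp_Ord Ord_of_int tau_Ord)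
  moreover have "tau * z \<in> lideal" if zI: "z \<in> lideal" for z
  proof -
    obtain i j where z: "z = of_int i * of_int a + of_int j * tau"
      using zI unfolding lideal_def by (rule ZlatE)
    have "tau * z = of_int i * of_int a * tau + of_int j * (tau * tau)" by (simp add: z algebra_simps)
    also have "\<dots> = of_int (- (j * c)) * of_int a + of_int (i * a + j * b) * tau"
      by (simp add: tau_sq algebra_simps)
    also have "\<dots> \<in> lideal" unfolding lideal_def by (rule ZlatI)
    finally show ?thesis .
  qed
  ultimately show ?thesis
    unfolding olat_def using planar_subgrp planar_index_pos[OF planar_Ord] by blast
qed

lemma phi_Z_span: "phi ` Z_span f1 f2 = Zlat (phi f1) (phi f2)"
proof (intro equalityI subsetI)
  fix z assume "z \<in> phi ` Z_span f1 f2"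
  then obtain i j where "z = phi (of_int i *\<^sub>Q f1 + of_int j *\<^sub>Q f2)" by (auto elim: Z_spanE)
  then have "z = of_int i * phi f1 + of_int j * phi f2" by (simp add: phi_comb)
  then show "z \<in> Zlat (phi f1) (phi f2)" by blast
next
  fix z assume "z \<in> Zlat (phi f1) (phi f2)"
  then obtain i j where "z = of_int i * phi f1 + of_int j * phi f2" by (rule ZlatE)
  then have "z = phi (of_int i *\<^sub>Q f1 + of_int j *\<^sub>Q f2)" by (simp add: phi_comb)
  then show "z \<in> phi ` Z_span f1 f2" using Z_spanI by blast
qed

lemma phi_L: "phi ` L = lideal"
  using basis phi_Z_span[of e1 e2] by (simp add: Z_basis_def phi_basis lideal_def)

lemma index_phi: "subgrp K \<Longrightarrow> index lideal (phi ` K) = index L K"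
  unfolding phi_L[symmetric] by (rule index_image) (auto simp: phi_diff phi_inj)

lemma phi_subset_iff: "phi ` K \<subseteq> lideal \<longleftrightarrow> K \<subseteq> L"
  unfolding phi_L[symmetric] by (rule inj_image_subset_iff[OF phi_inj])

lemma sublattice_subgrp: "binary_Z_lattice K \<Longrightarrow> subgrp K"
  by (auto simp: binary_Z_lattice_def Z_basis_def subgrp_Z_span)

text \<open>A subgroup of finite index has full rank, which supplies a basis of the preimage, and
  integrality of the form is inherited from \<open>L\<close>.\<close>

lemma bij_sublattices:
  assumes m: "m > 0"
  shows "bij_betw ((`) phi) (sublattices L m) (subs lideal m)"
  unfolding bij_betw_def
proof
  show "inj_on ((`) phi) (sublattices L m)"
    by (rule inj_onI) (simp add: inj_image_eq_iff[OF phi_inj])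
  show "(`) phi ` sublattices L m = subs lideal m"
  proof (intro equalityI subsetI)
    fix M assume "M \<in> (`) phi ` sublattices L m"
    then obtain K where K: "binary_Z_lattice K" "K \<subseteq> L" "index L K = m" "M = phi ` K"
      by (auto simp: sublattices_def)
    have "subgrp M" unfolding K(4) by (rule subgrp_image[OF sublattice_subgrp[OF K(1)] phi_diff])
    then show "M \<in> subs lideal m"
      using K phi_subset_iff index_phi[OF sublattice_subgrp[OF K(1)]] by (simp add: subs_def)
  next
    fix M assume "M \<in> subs lideal m"
    then have M: "subgrp M" "M \<subseteq> lideal" "index lideal M = m" by (auto simp: subs_def)
    have "planar M" by (rule planar_sub[OF olat_planar[OF olat_lideal] M(1,2)]) (use M m in simp)
    then obtain x y where xy: "cross x y \<noteq> 0" "M = Zlat x y" by (rule planarE)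
    have "x \<in> range phi" "y \<in> range phi"
      using M(2) Zlat_basis xy(2) unfolding phi_L[symmetric] by blast+
    then obtain f1 f2 where f: "x = phi f1" "y = phi f2" by blast
    define K where "K = Z_span f1 f2"
    have MK: "M = phi ` K" unfolding K_def phi_Z_span xy(2) f ..
    have KL: "K \<subseteq> L" using M(2) unfolding MK phi_subset_iff .
    have "plane_basis f1 f2" unfolding plane_basis_cross using xy(1) f by simp
    then have "Z_basis f1 f2 K" by (simp add: Z_basis_def K_def)
    moreover have "qform ` K \<subseteq> \<int>" using KL integral_form by blast
    ultimately have "binary_Z_lattice K" unfolding binary_Z_lattice_def by blast
    moreover have "index L K = m"
      using M(3) index_phi[OF subgrp_Z_span, of f1 f2] unfolding MK K_def by simp
    ultimately show "M \<in> (`) phi ` sublattices L m" using KL MK by (auto simp: sublattices_def)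
  qed
qed

lemma phi_iso_image:
  assumes "u \<in> U" "f \<in> {cmul, ccmul}"
  shows "phi ` iso f u ` K = f u ` phi ` K"
  unfolding image_image phi_iso[OF assms] ..

lemma iso_subset_iff: "u \<in> U \<Longrightarrow> f \<in> {cmul, ccmul} \<Longrightarrow> iso f u ` K \<subseteq> L \<longleftrightarrow> f u ` phi ` K \<subseteq> lideal"
  using phi_subset_iff[of "iso f u ` K"] by (simp only: phi_iso_image)

lemma iso_fix_iff: "u \<in> U \<Longrightarrow> f \<in> {cmul, ccmul} \<Longrightarrow> iso f u ` K = K \<longleftrightarrow> f u ` phi ` K = phi ` K"
  using inj_image_eq_iff[OF phi_inj, of "iso f u ` K" K] by (simp only: phi_iso_image)

text \<open>An isometry preserves areas, so an image of \<open>K\<close> inside \<open>L\<close>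
  automatically has the same index.\<close>

lemma iso_closed:
  assumes m: "m > 0" and \<sigma>: "\<sigma> \<in> O\<^sub>V" and K: "K \<in> sublattices L m" and sub: "\<sigma> ` K \<subseteq> L"
  shows "\<sigma> ` K \<in> sublattices L m"
proof -
  obtain u f where u: "u \<in> U" "f \<in> {cmul, ccmul}" "\<sigma> = iso f u" using orth_cases[OF \<sigma>] by blast
  have "phi ` K \<in> subs lideal m" using bij_betwE[OF bij_sublattices[OF m]] K by blast
  then have "f u ` phi ` K \<in> subs lideal m"
    using subs_similar[OF olat_lideal m _ u(1,2)] sub iso_subset_iff[OF u(1,2)] u(3) by simp
  then have "phi ` \<sigma> ` K \<in> (`) phi ` sublattices L m"
    unfolding u(3) phi_iso_image[OF u(1,2)] bij_betw_imp_surj_on[OF bij_sublattices[OF m]] .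
  then obtain K' where K': "phi ` \<sigma> ` K = phi ` K'" "K' \<in> sublattices L m" by (rule imageE)
  then have "\<sigma> ` K = K'" unfolding inj_image_eq_iff[OF phi_inj] by blast
  then show ?thesis using K'(2) by blast
qed

definition fstab :: "complex set \<Rightarrow> nat"
  where "fstab M = card {u \<in> U. ccmul u ` M = M}"

lemma card_iso_set:
  assumes f: "f \<in> {cmul, ccmul}"
  shows "card {\<sigma> \<in> iso f ` U. P \<sigma>} = card {u \<in> U. P (iso f u)}"
    and "finite {u \<in> U. P (iso f u)} \<Longrightarrow> finite {\<sigma> \<in> iso f ` U. P \<sigma>}"
proof -
  have eq: "{\<sigma> \<in> iso f ` U. P \<sigma>} = iso f ` {u \<in> U. P (iso f u)}" by blast
  have "inj_on (iso f) {u \<in> U. P (iso f u)}" by (rule inj_on_subset[OF iso_inj[OF f]]) blast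
  then show "card {\<sigma> \<in> iso f ` U. P \<sigma>} = card {u \<in> U. P (iso f u)}"
    unfolding eq by (rule card_image)
  show "finite {u \<in> U. P (iso f u)} \<Longrightarrow> finite {\<sigma> \<in> iso f ` U. P \<sigma>}"
    unfolding eq by (rule finite_imageI)
qed

section \<open>Isometries of a fixed sublattice\<close>

context
  fixes m :: nat and K :: "'v set"
  assumes m: "m > 0" and K: "K \<in> sublattices L m"
begin

lemma phi_K: "phi ` K \<in> subs lideal m"
  using bij_betwE[OF bij_sublattices[OF m]] K by blast

lemma finite_iso_subset:
  assumes f: "f \<in> {cmul, ccmul}"
  shows "finite {u \<in> U. f u ` phi ` K \<subseteq> lideal}"
proof -
  have "planar (phi ` K)"
    by (rule planar_sub[OF olat_planar[OF olat_lideal]]) (use phi_K m in \<open>simp_all add: subs_def\<close>)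
  then obtain x where "x \<in> phi ` K" "x \<noteq> 0" by (rule planar_nonzero)
  then show ?thesis using finite_similarities[OF _ _ _ f] olat_lideal by (simp add: olat_def)
qed

lemma card_into:
  "card {\<sigma> \<in> O\<^sub>V\<^sup>+. \<sigma> ` K \<subseteq> L} = nrot lideal (phi ` K)" "finite {\<sigma> \<in> O\<^sub>V\<^sup>+. \<sigma> ` K \<subseteq> L}"
  "card {\<sigma> \<in> O\<^sub>V. \<sigma> ` K \<subseteq> L} = nrot lideal (phi ` K) + nref lideal (phi ` K)" "finite {\<sigma> \<in> O\<^sub>V. \<sigma> ` K \<subseteq> L}"
proof -
  have eq: "{u \<in> U. iso f u ` K \<subseteq> L} = {u \<in> U. f u ` phi ` K \<subseteq> lideal}" if "f \<in> {cmul, ccmul}" for f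
    using iso_subset_iff[OF _ that] by blast
  have c: "card {\<sigma> \<in> iso cmul ` U. \<sigma> ` K \<subseteq> L} = nrot lideal (phi ` K)"
    "card {\<sigma> \<in> iso ccmul ` U. \<sigma> ` K \<subseteq> L} = nref lideal (phi ` K)"
    unfolding nrot_def nref_def eq[of cmul, simplified, symmetric] eq[of ccmul, simplified, symmetric]
    by (rule card_iso_set(1), simp)+
  have fin: "finite {\<sigma> \<in> iso f ` U. \<sigma> ` K \<subseteq> L}" if f: "f \<in> {cmul, ccmul}" for f
    by (rule card_iso_set(2)[OF f]) (simp only: eq[OF f] finite_iso_subset[OF f])
  have un: "{\<sigma> \<in> O\<^sub>V. \<sigma> ` K \<subseteq> L} = {\<sigma> \<in> iso cmul ` U. \<sigma> ` K \<subseteq> L} \<union> {\<sigma> \<in> iso ccmul ` U. \<sigma> ` K \<subseteq> L}"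
    unfolding orth_eq by blast
  show "card {\<sigma> \<in> O\<^sub>V\<^sup>+. \<sigma> ` K \<subseteq> L} = nrot lideal (phi ` K)" "finite {\<sigma> \<in> O\<^sub>V\<^sup>+. \<sigma> ` K \<subseteq> L}"
    unfolding orth_plus_eq by (rule c(1), rule fin, simp)
  show "finite {\<sigma> \<in> O\<^sub>V. \<sigma> ` K \<subseteq> L}" unfolding un using fin[of cmul] fin[of ccmul] by simp
  have "{\<sigma> \<in> iso cmul ` U. \<sigma> ` K \<subseteq> L} \<inter> {\<sigma> \<in> iso ccmul ` U. \<sigma> ` K \<subseteq> L} = {}"
    using iso_disjoint by blast
  then show "card {\<sigma> \<in> O\<^sub>V. \<sigma> ` K \<subseteq> L} = nrot lideal (phi ` K) + nref lideal (phi ` K)"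
    unfolding un using fin[of cmul] fin[of ccmul] by (simp add: card_Un_disjoint c)
qed

lemma card_fix:
  "card {\<sigma> \<in> O\<^sub>V\<^sup>+. \<sigma> ` K = K} = rstab (phi ` K)"
  "card {\<sigma> \<in> O\<^sub>V - O\<^sub>V\<^sup>+. \<sigma> ` K = K} = fstab (phi ` K)"
  "card {\<sigma> \<in> O\<^sub>V. \<sigma> ` K = K} = rstab (phi ` K) + fstab (phi ` K)"
proof -
  have eq: "{u \<in> U. iso f u ` K = K} = {u \<in> U. f u ` phi ` K = phi ` K}" if "f \<in> {cmul, ccmul}" for f
    by (rule Collect_cong, rule conj_cong[OF HOL.refl], erule iso_fix_iff[OF _ that])
  have c: "card {\<sigma> \<in> iso cmul ` U. \<sigma> ` K = K} = rstab (phi ` K)"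
    "card {\<sigma> \<in> iso ccmul ` U. \<sigma> ` K = K} = fstab (phi ` K)"
    unfolding rstab_def fstab_def eq[of cmul, simplified, symmetric] eq[of ccmul, simplified, symmetric]
    by (rule card_iso_set(1), simp)+
  then show "card {\<sigma> \<in> O\<^sub>V\<^sup>+. \<sigma> ` K = K} = rstab (phi ` K)"
    "card {\<sigma> \<in> O\<^sub>V - O\<^sub>V\<^sup>+. \<sigma> ` K = K} = fstab (phi ` K)"
    unfolding orth_minus_eq unfolding orth_plus_eq .
  have KL: "K \<subseteq> L" using K by (simp add: sublattices_def)
  have un: "{\<sigma> \<in> O\<^sub>V. \<sigma> ` K = K} = {\<sigma> \<in> iso cmul ` U. \<sigma> ` K = K} \<union> {\<sigma> \<in> iso ccmul ` U. \<sigma> ` K = K}"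
    unfolding orth_eq by blast
  have "finite {\<sigma> \<in> O\<^sub>V. \<sigma> ` K = K}"
    by (rule finite_subset[OF _ card_into(4)]) (intro Collect_mono, use KL in argo)
  then have "finite {\<sigma> \<in> iso cmul ` U. \<sigma> ` K = K}" "finite {\<sigma> \<in> iso ccmul ` U. \<sigma> ` K = K}"
    unfolding un finite_Un by (rule conjunct1, rule conjunct2)
  moreover have "{\<sigma> \<in> iso cmul ` U. \<sigma> ` K = K} \<inter> {\<sigma> \<in> iso ccmul ` U. \<sigma> ` K = K} = {}"
    using iso_disjoint by blast
  ultimately show "card {\<sigma> \<in> O\<^sub>V. \<sigma> ` K = K} = rstab (phi ` K) + fstab (phi ` K)"
    unfolding un by (simp add: card_Un_disjoint c)
qed

end

lemma card_sublattices:
  assumes m: "m > 0"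
  shows "finite (sublattices L m)" "card (sublattices L m) = \<Sum>{d. d dvd m}"
  using bij_betw_finite[OF bij_sublattices[OF m]] bij_betw_same_card[OF bij_sublattices[OF m]]
    card_subs[OF olat_planar[OF olat_lideal] m] by simp_all

lemma num_classes_eq:
  assumes m: "m > 0"
  shows "(of_nat (num_classes O\<^sub>V L m) :: complex) = (\<Sum>M\<in>subs lideal m.
      of_nat (rstab M + fstab M) / of_nat (nrot lideal M + nref lideal M))"
    and "(of_nat (num_classes O\<^sub>V\<^sup>+ L m) :: complex) = (\<Sum>M\<in>subs lideal m.
      of_nat (rstab M) / of_nat (nrot lideal M))"
    and "num_classes O\<^sub>V\<^sup>+ L m \<le> \<Sum>{d. d dvd m}"
proof -
  have plus: "O\<^sub>V\<^sup>+ \<subseteq> O\<^sub>V" by (simp add: orth_group_plus_def)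
  have one: "(id :: 'v \<Rightarrow> 'v) \<in> O\<^sub>V\<^sup>+" unfolding orth_plus_eq iso_one[symmetric] using one_U by blast
  have comp_plus: "\<sigma> \<circ> \<tau> \<in> O\<^sub>V\<^sup>+" if "\<sigma> \<in> O\<^sub>V\<^sup>+" "\<tau> \<in> O\<^sub>V\<^sup>+" for \<sigma> \<tau> :: "'v \<Rightarrow> 'v"
    using that unfolding orth_plus_eq by (auto simp: iso_comp U_mult)
  have comp: "\<sigma> \<circ> \<tau> \<in> O\<^sub>V" if "\<sigma> \<in> O\<^sub>V" "\<tau> \<in> O\<^sub>V" for \<sigma> \<tau> :: "'v \<Rightarrow> 'v"
    using that unfolding orth_eq by (auto simp: iso_comp U_mult U_cnj)
  have inv_plus: "\<exists>\<tau>\<in>O\<^sub>V\<^sup>+. \<tau> \<circ> \<sigma> = id \<and> \<sigma> \<circ> \<tau> = id" if "\<sigma> \<in> O\<^sub>V\<^sup>+" for \<sigma> :: "'v \<Rightarrow> 'v"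
    using that iso_inverse U_divide[OF one_U] unfolding orth_plus_eq by blast
  have inv: "\<exists>\<tau>\<in>O\<^sub>V. \<tau> \<circ> \<sigma> = id \<and> \<sigma> \<circ> \<tau> = id" if "\<sigma> \<in> O\<^sub>V" for \<sigma> :: "'v \<Rightarrow> 'v"
    using that iso_inverse U_divide[OF one_U] unfolding orth_eq by blast
  have reindex: "(\<Sum>K\<in>sublattices L m. g (phi ` K)) = (\<Sum>M\<in>subs lideal m. g M)" for g :: "complex set \<Rightarrow> complex"
    by (rule sum.reindex_bij_betw[OF bij_sublattices[OF m]])
  have "(of_nat (num_classes O\<^sub>V L m) :: complex) = (\<Sum>K\<in>sublattices L m.
      of_nat (card {\<sigma> \<in> O\<^sub>V. \<sigma> ` K = K}) / of_nat (card {\<sigma> \<in> O\<^sub>V. \<sigma> ` K \<subseteq> L}))"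
  proof (rule num_classes_orbits(1))
    show "(id :: 'v \<Rightarrow> 'v) \<in> O\<^sub>V" using one plus by blast
  qed (use comp inv iso_closed[OF m] card_into(4)[OF m] card_sublattices(1)[OF m] in blast)+
  also have "\<dots> = (\<Sum>K\<in>sublattices L m. of_nat (rstab (phi ` K) + fstab (phi ` K))
      / of_nat (nrot lideal (phi ` K) + nref lideal (phi ` K)))"
    by (rule sum.cong) (simp_all only: card_fix(3)[OF m] card_into(3)[OF m])
  also have "\<dots> = (\<Sum>M\<in>subs lideal m. of_nat (rstab M + fstab M) / of_nat (nrot lideal M + nref lideal M))"
    by (rule reindex)
  finally show "(of_nat (num_classes O\<^sub>V L m) :: complex) = (\<Sum>M\<in>subs lideal m.
      of_nat (rstab M + fstab M) / of_nat (nrot lideal M + nref lideal M))" .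
  have closed_plus: "\<sigma> ` K \<in> sublattices L m" if "\<sigma> \<in> O\<^sub>V\<^sup>+" "K \<in> sublattices L m" "\<sigma> ` K \<subseteq> L" for \<sigma> K
    by (rule iso_closed[OF m _ that(2,3)]) (use that(1) plus in blast)
  note orbits = num_classes_orbits[OF one comp_plus inv_plus card_sublattices(1)[OF m] closed_plus card_into(2)[OF m]]
  have "(of_nat (num_classes O\<^sub>V\<^sup>+ L m) :: complex) = (\<Sum>K\<in>sublattices L m.
      of_nat (card {\<sigma> \<in> O\<^sub>V\<^sup>+. \<sigma> ` K = K}) / of_nat (card {\<sigma> \<in> O\<^sub>V\<^sup>+. \<sigma> ` K \<subseteq> L}))"
    by (rule orbits(1))
  also have "\<dots> = (\<Sum>K\<in>sublattices L m. of_nat (rstab (phi ` K)) / of_nat (nrot lideal (phi ` K)))"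
    by (rule sum.cong) (simp_all only: card_fix(1)[OF m] card_into(1)[OF m])
  also have "\<dots> = (\<Sum>M\<in>subs lideal m. of_nat (rstab M) / of_nat (nrot lideal M))"
    by (rule reindex)
  finally show "(of_nat (num_classes O\<^sub>V\<^sup>+ L m) :: complex) = (\<Sum>M\<in>subs lideal m.
      of_nat (rstab M) / of_nat (nrot lideal M))" .
  show "num_classes O\<^sub>V\<^sup>+ L m \<le> \<Sum>{d. d dvd m}"
    using orbits(2) card_sublattices(2)[OF m] by simp
qed

end

section \<open>Assembling the zeta functions\<close>

context quadratic_lattice
begin

definition refl_coeff :: "nat \<Rightarrow> complex"
  where "refl_coeff m = (\<Sum>M\<in>subs lideal m. of_nat (fstab M) / of_nat (nrot lideal M + nref lideal M))"

definition excess_coeff :: "nat \<Rightarrow> complex"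
  where "excess_coeff m = (\<Sum>d | d dvd m. of_nat (class_asym lideal d) * of_nat (card (gens Ord (m div d))))"

text \<open>For each \<open>M\<close> the rotations in the stabiliser have weight
  \<open>1 / (n1 + n2)\<close>, which is split into \<open>1 / (2 * n1)\<close>, half of the weight
  in the count by rotations, and the excess; the reflections in the stabiliser are kept as they
  are.\<close>

lemma num_classes_split:
  assumes m: "m > 0"
  shows "(of_nat (num_classes O\<^sub>V L m) :: complex)
    = 1 / 2 * of_nat (num_classes O\<^sub>V\<^sup>+ L m) + 1 / 2 * excess_coeff m + refl_coeff m"
proof -
  let ?nr = "\<lambda>M. nrot lideal M" and ?nf = "\<lambda>M. nref lideal M"
  have split: "of_nat (rstab M + fstab M) / of_nat (?nr M + ?nf M)
    = 1 / 2 * (of_nat (rstab M) / of_nat (?nr M))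
      + of_nat (rstab M) * (1 / of_nat (?nr M + ?nf M) - 1 / of_nat (2 * ?nr M))
      + of_nat (fstab M) / (of_nat (?nr M + ?nf M) :: complex)" for M
  proof -
    have "1 / 2 * (r / t) = r * (1 / (2 * t))" for r t :: complex by simp
    then show ?thesis
      by (simp only: of_nat_add[of "rstab M"] add_divide_distrib right_diff_distrib of_nat_mult of_nat_numeral)
        simp
  qed
  have half: "(\<Sum>M\<in>subs lideal m. 1 / 2 * (of_nat (rstab M) / of_nat (?nr M)))
      = (1 / 2 * of_nat (num_classes O\<^sub>V\<^sup>+ L m) :: complex)"
    unfolding num_classes_eq(2)[OF m] by (rule sum_distrib_left[symmetric])
  have "(\<Sum>d | d dvd m. of_nat (card (gens Ord (m div d))) * of_nat (class_asym lideal d)) = excess_coeff m"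
    unfolding excess_coeff_def by (simp only: mult.commute)
  then have ex: "(\<Sum>M\<in>subs lideal m. of_nat (rstab M) * (1 / of_nat (?nr M + ?nf M) - 1 / of_nat (2 * ?nr M)))
      = 1 / 2 * excess_coeff m"
    unfolding rotation_excess[OF olat_lideal m] by simp
  show ?thesis
    unfolding num_classes_eq(1)[OF m] split sum.distrib half ex refl_coeff_def ..
qed

text \<open>Reflections that fix \<open>M\<close> map it into the ideal. So the weights of the
  reflection part are at most 1, and its coefficients at most the number of subgroups.\<close>

lemma fstab_le:
  assumes m: "m > 0" and M: "M \<in> subs lideal m"
  shows "fstab M \<le> nrot lideal M + nref lideal M"
proof -
  obtain K where K: "K \<in> sublattices L m" "M = phi ` K"
    using M bij_betw_imp_surj_on[OF bij_sublattices[OF m]] by blast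
  have "M \<subseteq> lideal" using M by (simp add: subs_def)
  then have "{u \<in> U. ccmul u ` M = M} \<subseteq> {u \<in> U. ccmul u ` M \<subseteq> lideal}" by auto
  moreover have "finite {u \<in> U. ccmul u ` M \<subseteq> lideal}"
    unfolding K(2) by (rule finite_iso_subset[OF m K(1)]) simp
  ultimately show ?thesis unfolding fstab_def nref_def by (meson card_mono trans_le_add2)
qed

lemma weight_bound:
  assumes m: "m > 0" and M: "M \<in> subs lideal m"
  shows "norm (of_nat (fstab M) / of_nat (nrot lideal M + nref lideal M) :: complex) \<le> 1"
proof -
  have "real (fstab M) \<le> real (nrot lideal M + nref lideal M)" using fstab_le[OF m M] by linarith
  then show ?thesis
    unfolding norm_divide norm_of_nat
    by (cases "nrot lideal M + nref lideal M = 0")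
      (simp_all only: of_nat_0 div_by_0 zero_le_one divide_le_eq_1_pos of_nat_0_less_iff neq0_conv)
qed

lemma card_subs_lideal: "m > 0 \<Longrightarrow> card (subs lideal m) = \<Sum>{d. d dvd m}"
  by (rule card_subs(2)[OF olat_planar[OF olat_lideal]])

lemma norm_refl_coeff:
  assumes m: "m > 0" shows "norm (refl_coeff m) \<le> real (\<Sum>{d. d dvd m})"
proof -
  have "norm (refl_coeff m) \<le> of_nat (card (subs lideal m)) * 1"
    unfolding refl_coeff_def by (rule sum_norm_bound) (rule weight_bound[OF m])
  then show ?thesis by (simp add: card_subs_lideal[OF m])
qed

lemma class_asym_le:
  assumes A: "olat A" and m: "m > 0" shows "class_asym A m \<le> \<Sum>{d. d dvd m}"
proof -
  have fin: "finite (ideals A m)" by (rule finite_ideals[OF A m])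
  have "class_asym A m \<le> card (ideal_class F ` ideals A m)"
    unfolding class_asym_def by (rule card_mono) (use fin in auto)
  also have "\<dots> \<le> card (ideals A m)" by (rule card_image_le[OF fin])
  also have "\<dots> \<le> card (subs A m)"
    by (rule card_mono[OF card_subs(1)[OF olat_planar[OF A] m]]) (auto simp: ideals_def)
  finally show ?thesis unfolding card_subs(2)[OF olat_planar[OF A] m] .
qed

lemma card_gens_le: "m > 0 \<Longrightarrow> card (gens Ord m) \<le> \<Sum>{d. d dvd m}"
  and card_ideals_le: "m > 0 \<Longrightarrow> card (ideals Ord m) \<le> \<Sum>{d. d dvd m}"
proof -
  assume m: "m > 0"
  have "gens Ord m \<subseteq> subs Ord m" "ideals Ord m \<subseteq> subs Ord m" by (auto simp: gens_def ideals_def)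
  then show "card (gens Ord m) \<le> \<Sum>{d. d dvd m}" "card (ideals Ord m) \<le> \<Sum>{d. d dvd m}"
    unfolding card_subs(2)[OF planar_Ord m, symmetric] by (auto intro: card_mono card_subs(1)[OF planar_Ord m])
qed

lemma sublattices_of_index:
  assumes m: "m \<ge> 1"
  shows "{K. K \<in> {K. binary_Z_lattice K \<and> K \<subseteq> L \<and> index L K > 0} \<and> index L K = m} = sublattices L m"
  using m by (auto simp: sublattices_def)

text \<open>Interchanges the sum over reflections with the sum over sublattices. The double family
  \<open>g\<close> vanishes unless \<rho> fixes \<open>K\<close>, so each \<open>K\<close> meets
  finitely many \<rho>, and summing norms over them first leaves a series dominated by the divisor
  sums.\<close>

lemma zeta_Refl_eq:
  assumes s: "Re s > 2"
  shows "zeta_Refl L s = (\<Sum>\<^sub>\<infinity>m\<in>{1..}. refl_coeff m * of_nat m powr (- s))"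
proof -
  let ?T = "{K. binary_Z_lattice K \<and> K \<subseteq> L \<and> index L K > 0}"
  let ?R = "O\<^sub>V - O\<^sub>V\<^sup>+ :: ('v \<Rightarrow> 'v) set"
  define w where "w K = (of_nat (index L K) powr (- s) / of_nat (card {\<sigma>\<in>O\<^sub>V. \<sigma> ` K \<subseteq> L}) :: complex)" for K
  define W where "W K = of_nat (card {\<rho> \<in> ?R. \<rho> ` K = K}) * w K" for K
  define g where "g K \<rho> = (if \<rho> ` K = K then w K else 0)" for K and \<rho> :: "'v \<Rightarrow> 'v"
  have inT: "K \<in> sublattices L (index L K)" "index L K > 0" if "K \<in> ?T" for K
    using that by (simp_all add: sublattices_def)
  have Wm: "W K = of_nat (fstab (phi ` K)) / of_nat (nrot lideal (phi ` K) + nref lideal (phi ` K)) * of_nat m powr (- s)"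
    if m: "m \<ge> 1" and K: "K \<in> sublattices L m" for m K
  proof -
    have m0: "m > 0" using m by simp
    have "index L K = m" using K by (simp add: sublattices_def)
    then show ?thesis
      unfolding W_def w_def card_fix(2)[OF m0 K] card_into(3)[OF m0 K] by simp
  qed
  have sumW: "(\<Sum>K\<in>sublattices L m. W K) = refl_coeff m * of_nat m powr (- s)" if m: "m \<ge> 1" for m
  proof -
    have m0: "m > 0" using m by simp
    have "(\<Sum>K\<in>sublattices L m. W K) = (\<Sum>K\<in>sublattices L m. (\<lambda>M. of_nat (fstab M)
        / of_nat (nrot lideal M + nref lideal M) * of_nat m powr (- s)) (phi ` K))"
      by (rule sum.cong) (simp_all only: Wm[OF m])
    also have "\<dots> = (\<Sum>M\<in>subs lideal m. of_nat (fstab M)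
        / of_nat (nrot lideal M + nref lideal M) * of_nat m powr (- s))"
      by (rule sum.reindex_bij_betw[OF bij_sublattices[OF m0]])
    finally show ?thesis unfolding refl_coeff_def sum_distrib_right .
  qed
  have normW: "(\<Sum>K\<in>sublattices L m. norm (W K))
      \<le> norm (of_nat (\<Sum>{d. d dvd m}) * (of_nat m :: complex) powr (- s))" if m: "m \<ge> 1" for m
  proof -
    have m0: "m > 0" using m by simp
    have "norm (W K) \<le> 1 * norm ((of_nat m :: complex) powr (- s))" if K: "K \<in> sublattices L m" for K
      unfolding Wm[OF m K] norm_mult
      by (rule mult_right_mono[OF weight_bound[OF m0 phi_K[OF m0 K]]]) simp
    then have "(\<Sum>K\<in>sublattices L m. norm (W K)) \<le> of_nat (card (sublattices L m)) * (1 * norm ((of_nat m :: complex) powr (- s)))"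
      by (rule sum_bounded_above)
    then show ?thesis unfolding card_sublattices(2)[OF m0] norm_mult norm_of_nat by simp
  qed
  have h1: "index L K \<ge> 1" if "K \<in> ?T" for K using inT(2)[OF that] by simp
  have fin: "finite {K \<in> ?T. index L K = m}" if "m \<ge> 1" for m
    unfolding sublattices_of_index[OF that] using card_sublattices(1)[of m] that by simp
  have abs: "(\<lambda>m. \<Sum>K | K \<in> ?T \<and> index L K = m. norm (W K)) summable_on {1..}"
  proof (rule summable_on_comparison_test[OF divisor_sum_series(1)[OF s]])
    fix m :: nat assume "m \<in> {1..}"
    then have m: "m \<ge> 1" by simp
    show "(\<Sum>K | K \<in> ?T \<and> index L K = m. norm (W K))
        \<le> norm (of_nat (\<Sum>{d. d dvd m}) * (of_nat m :: complex) powr (- s))"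
      unfolding sublattices_of_index[OF m] by (rule normW[OF m])
  qed (rule sum_nonneg, rule norm_ge_zero)
  note by_index = infsum_by_index[OF h1 fin abs]
  \<comment> \<open>Stated for a function \<open>x\<close> that vanishes at 0, to serve both for the
    norms, which give summability, and for the values themselves.\<close>
  have g_sum: "((\<lambda>\<rho>. x (g K \<rho>)) has_sum (of_nat (card {\<rho> \<in> ?R. \<rho> ` K = K}) * x (w K))) ?R"
    if K: "K \<in> ?T" and x0: "x 0 = 0" for K and x :: "complex \<Rightarrow> 'z::real_normed_field"
  proof -
    have "finite {\<rho> \<in> ?R. \<rho> ` K = K}"
    proof (rule finite_subset[OF _ card_into(4)[OF inT(2,1)[OF K]]])
      have "K \<subseteq> L" using K by simp
      then show "{\<rho> \<in> ?R. \<rho> ` K = K} \<subseteq> {\<sigma> \<in> O\<^sub>V. \<sigma> ` K \<subseteq> L}"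
        by (intro subsetI) simp
    qed
    moreover have "(\<Sum>\<rho> | \<rho> \<in> ?R \<and> \<rho> ` K = K. x (g K \<rho>)) = (\<Sum>\<rho> | \<rho> \<in> ?R \<and> \<rho> ` K = K. x (w K))"
      by (rule sum.cong) (simp_all add: g_def)
    ultimately have "((\<lambda>\<rho>. x (g K \<rho>)) has_sum (of_nat (card {\<rho> \<in> ?R. \<rho> ` K = K}) * x (w K))) {\<rho> \<in> ?R. \<rho> ` K = K}"
      by (intro has_sum_finiteI) simp_all
    moreover have "((\<lambda>\<rho>. x (g K \<rho>)) has_sum v) {\<rho> \<in> ?R. \<rho> ` K = K} \<longleftrightarrow> ((\<lambda>\<rho>. x (g K \<rho>)) has_sum v) ?R" for v
    proof (rule has_sum_cong_neutral)
      fix \<rho> assume "\<rho> \<in> ?R - {\<rho> \<in> ?R. \<rho> ` K = K}"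
      then have "\<rho> ` K \<noteq> K" by blast
      then show "x (g K \<rho>) = 0" by (simp add: g_def x0)
    next
      fix \<rho> assume "\<rho> \<in> {\<rho> \<in> ?R. \<rho> ` K = K} - ?R"
      then show "x (g K \<rho>) = 0" by blast
    qed (rule HOL.refl)
    ultimately show ?thesis by (simp only:)
  qed
  have "(\<lambda>(K, \<rho>). norm (g K \<rho>)) summable_on ?T \<times> ?R"
  proof (rule summable_on_SigmaI)
    show "((\<lambda>\<rho>. case (K, \<rho>) of (K, \<rho>) \<Rightarrow> norm (g K \<rho>)) has_sum norm (W K)) ?R" if K: "K \<in> ?T" for K
      using g_sum[OF K, of norm] by (simp add: W_def norm_mult)
    show "(\<lambda>K. norm (W K)) summable_on ?T" by (rule by_index(1))
  qed auto
  then have sm: "(\<lambda>(K, \<rho>). g K \<rho>) summable_on ?T \<times> ?R"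
    unfolding case_prod_unfold by (rule abs_summable_summable)
  have "zeta_Refl L s = (\<Sum>\<^sub>\<infinity>\<rho>\<in>?R. \<Sum>\<^sub>\<infinity>K\<in>?T. g K \<rho>)"
    unfolding zeta_Refl_def Z_aut_def
  proof (rule infsum_cong)
    fix \<rho> :: "'v \<Rightarrow> 'v"
    show "(\<Sum>\<^sub>\<infinity>K\<in>{K. binary_Z_lattice K \<and> K \<subseteq> L \<and> index L K > 0 \<and> \<rho> ` K = K}.
        of_nat (index L K) powr (- s) / of_nat (card {\<sigma>\<in>O\<^sub>V. \<sigma> ` K \<subseteq> L})) = (\<Sum>\<^sub>\<infinity>K\<in>?T. g K \<rho>)"
    proof (rule infsum_cong_neutral)
      fix K assume "K \<in> ?T - {K. binary_Z_lattice K \<and> K \<subseteq> L \<and> index L K > 0 \<and> \<rho> ` K = K}"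
      then have "\<rho> ` K \<noteq> K" by blast
      then show "g K \<rho> = 0" by (simp add: g_def)
    qed (simp_all add: g_def w_def)
  qed
  also have "\<dots> = (\<Sum>\<^sub>\<infinity>K\<in>?T. \<Sum>\<^sub>\<infinity>\<rho>\<in>?R. g K \<rho>)"
    by (rule infsum_swap_banach[OF sm, symmetric])
  also have "\<dots> = (\<Sum>\<^sub>\<infinity>K\<in>?T. W K)"
  proof (rule infsum_cong)
    fix K assume "K \<in> ?T"
    from g_sum[OF this, of "\<lambda>x. x"] show "(\<Sum>\<^sub>\<infinity>\<rho>\<in>?R. g K \<rho>) = W K"
      unfolding W_def by (intro infsumI) simp
  qed
  also have "\<dots> = (\<Sum>\<^sub>\<infinity>m\<in>{1..}. \<Sum>K | K \<in> ?T \<and> index L K = m. W K)" by (rule by_index(2))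
  also have "\<dots> = (\<Sum>\<^sub>\<infinity>m\<in>{1..}. refl_coeff m * of_nat m powr (- s))"
  proof (rule infsum_cong)
    fix m :: nat assume "m \<in> {1..}"
    then have m: "m \<ge> 1" by simp
    show "(\<Sum>K | K \<in> ?T \<and> index L K = m. W K) = refl_coeff m * of_nat m powr (- s)"
      unfolding sublattices_of_index[OF m] by (rule sumW[OF m])
  qed
  finally show ?thesis .
qed

lemma dedekind_zeta_eq:
  assumes s: "Re s > 2"
  shows "dedekind_zeta F s = (\<Sum>\<^sub>\<infinity>d\<in>{1..}. of_nat (card (ideals Ord d)) * of_nat d powr (- s))"
proof -
  \<comment> \<open>Infinite index is recorded as 0 and contributes \<open>0 powr (- s) = 0\<close>,
    so the sum over nonzero ideals may be replaced by the sum over ideals of positive index.\<close>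
  let ?T = "{J. ideal J (integer_ring F) \<and> index Ord J > 0}"
  have T: "{J \<in> ?T. index Ord J = d} = ideals Ord d" if "d \<ge> 1" for d
  proof (intro equalityI subsetI)
    fix J assume "J \<in> {J \<in> ?T. index Ord J = d}"
    then show "J \<in> ideals Ord d"
      using tau_Ord by (simp add: ideals_def subs_def ideal_integer_ring_iff)
  next
    fix J assume "J \<in> ideals Ord d"
    then have J: "subgrp J" "J \<subseteq> Ord" "index Ord J = d" "\<And>x. x \<in> J \<Longrightarrow> tau * x \<in> J"
      by (simp_all add: ideals_def subs_def)
    have "ideal J (integer_ring F)"
      unfolding ideal_integer_ring_iff using J(1,2) Ord_mult_closed[OF J(1,4)] by (intro conjI ballI)
    then show "J \<in> {J \<in> ?T. index Ord J = d}" using J(3) that by simp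
  qed
  have fin: "finite {J \<in> ?T. index Ord J = d}" if "d \<ge> 1" for d
    unfolding T[OF that] using finite_ideals[OF olat_Ord] that by simp
  have h1: "index Ord J \<ge> 1" if "J \<in> ?T" for J using that by simp
  have sum: "(\<Sum>J | J \<in> ?T \<and> index Ord J = d. x (of_nat (index Ord J) powr (- s)))
      = of_nat (card (ideals Ord d)) * x (of_nat d powr (- s))" if "d \<ge> 1"
    for d and x :: "complex \<Rightarrow> 'z::real_normed_field"
  proof -
    have "(\<Sum>J | J \<in> ?T \<and> index Ord J = d. x (of_nat (index Ord J) powr (- s)))
        = (\<Sum>J | J \<in> ?T \<and> index Ord J = d. x (of_nat d powr (- s)))"
      by (rule sum.cong) auto
    then show ?thesis unfolding T[OF that] by simp
  qed
  have "(\<lambda>d. norm (of_nat (card (ideals Ord d)) * (of_nat d :: complex) powr (- s))) summable_on {1..}"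
    by (rule divisor_sum_bounded_summable[OF s])
      (simp only: norm_of_nat of_nat_le_iff, rule card_ideals_le, simp)
  then have abs: "(\<lambda>d. \<Sum>J | J \<in> ?T \<and> index Ord J = d. norm ((of_nat (index Ord J) :: complex) powr (- s))) summable_on {1..}"
  proof (rule summable_on_cong[THEN iffD2, rotated])
    fix d :: nat assume "d \<in> {1..}"
    then have "d \<ge> 1" by simp
    from sum[OF this, of norm] show "(\<Sum>J | J \<in> ?T \<and> index Ord J = d. norm ((of_nat (index Ord J) :: complex) powr (- s)))
        = norm (of_nat (card (ideals Ord d)) * (of_nat d :: complex) powr (- s))"
      unfolding norm_mult norm_of_nat .
  qed
  have "dedekind_zeta F s = (\<Sum>\<^sub>\<infinity>J\<in>?T. of_nat (index Ord J) powr (- s))"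
    unfolding dedekind_zeta_def integers_F
  proof (rule infsum_cong_neutral)
    fix J assume "J \<in> {J. ideal J (integer_ring F) \<and> J \<noteq> {0}} - ?T"
    then show "of_nat (index Ord J) powr (- s) = (0 :: complex)" by auto
  next
    fix J assume J: "J \<in> ?T - {J. ideal J (integer_ring F) \<and> J \<noteq> {0}}"
    then have "planar J"
      using planar_sub[OF planar_Ord] by (simp add: ideal_integer_ring_iff)
    then obtain x where "x \<in> J" "x \<noteq> 0" by (rule planar_nonzero)
    then show "of_nat (index Ord J) powr (- s) = (0 :: complex)" using J by auto
  qed simp
  also have "\<dots> = (\<Sum>\<^sub>\<infinity>d\<in>{1..}. \<Sum>J | J \<in> ?T \<and> index Ord J = d. of_nat (index Ord J) powr (- s))"
    by (rule infsum_by_index(2)[OF h1 fin abs])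
  also have "\<dots> = (\<Sum>\<^sub>\<infinity>d\<in>{1..}. of_nat (card (ideals Ord d)) * of_nat d powr (- s))"
  proof (rule infsum_cong)
    fix d :: nat assume "d \<in> {1..}"
    then have "d \<ge> 1" by simp
    from sum[OF this, of "\<lambda>x. x"] show "(\<Sum>J | J \<in> ?T \<and> index Ord J = d. of_nat (index Ord J) powr (- s))
        = of_nat (card (ideals Ord d)) * (of_nat d powr (- s) :: complex)" .
  qed
  finally show ?thesis .
qed

lemma class_asym_eq:
  assumes d: "d \<ge> 1"
  shows "class_asym lideal d = card
    ({C \<in> class_group F. \<exists>J. fractional_ideal F J \<and> J \<subseteq> lideal \<and> index lideal J = d \<and> C = ideal_class F J} -
     {C \<in> class_group F. \<exists>J. fractional_ideal F J \<and> J \<subseteq> lideal \<and> index lideal J = d \<and> C = ideal_class F (cnj ` J)})"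
proof -
  have iff: "J \<in> ideals lideal d \<longleftrightarrow> fractional_ideal F J \<and> J \<subseteq> lideal \<and> index lideal J = d" for J
    using ideals_iff_fractional[OF olat_lideal] d by simp
  have cg: "ideal_class F J \<in> class_group F" if "fractional_ideal F J" for J
    using that unfolding class_group_def ideal_class_def by (intro quotientI) simp
  have "{C \<in> class_group F. \<exists>J. fractional_ideal F J \<and> J \<subseteq> lideal \<and> index lideal J = d \<and> C = ideal_class F J}
      = ideal_class F ` ideals lideal d"
    using cg iff by blast
  moreover have "{C \<in> class_group F. \<exists>J. fractional_ideal F J \<and> J \<subseteq> lideal \<and> index lideal J = d \<and> C = ideal_class F (cnj ` J)}
      = (\<lambda>J. ideal_class F (cnj ` J)) ` ideals lideal d"
    using cg[OF fractional_ideal_cnj] iff by blast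
  moreover have "(\<lambda>J. ideal_class F (cnj ` J)) ` ideals lideal d = bar ` ideal_class F ` ideals lideal d"
    unfolding image_image by (rule image_cong) (simp_all add: iff bar_ideal_class)
  ultimately show ?thesis unfolding class_asym_def by (simp only:)
qed

lemma zeta_GL_eq:
  assumes s: "Re s > 2"
  shows "zeta_GL L s = (1 / 2 * zeta_SL L s
     + riemann_zeta s * riemann_zeta (s - 1) / (2 * dedekind_zeta F s) *
       (\<Sum>\<^sub>\<infinity>n\<in>{1..}. of_nat (class_asym lideal n) * of_nat n powr (- s))) + zeta_Refl L s"
proof -
  define p where "p n = (of_nat (card (gens Ord n)) :: complex)" for n
  define i where "i n = (of_nat (card (ideals Ord n)) :: complex)" for n
  define x where "x n = (of_nat (class_asym lideal n) :: complex)" for n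
  define S where "S f = (\<Sum>\<^sub>\<infinity>n\<in>{1..}. f n * of_nat n powr (- s))" for f :: "nat \<Rightarrow> complex"
  define sm where "sm f \<longleftrightarrow> (\<lambda>n. norm (f n * (of_nat n :: complex) powr (- s))) summable_on {1..}" for f
  have sm_nat: "sm (\<lambda>n. of_nat (f n))" if "\<And>n. n \<ge> 1 \<Longrightarrow> f n \<le> \<Sum>{d. d dvd n}" for f
    unfolding sm_def by (rule divisor_sum_bounded_summable[OF s]) (simp only: norm_of_nat of_nat_le_iff that)
  have smp: "sm p" unfolding p_def by (rule sm_nat) (rule card_gens_le, simp)
  have smi: "sm i" unfolding i_def by (rule sm_nat) (rule card_ideals_le, simp)
  have smx: "sm x" unfolding x_def by (rule sm_nat) (rule class_asym_le[OF olat_lideal], simp)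
  have smSL: "sm (\<lambda>n. of_nat (num_classes O\<^sub>V\<^sup>+ L n))" by (rule sm_nat) (rule num_classes_eq(3), simp)
  have smR: "sm refl_coeff"
    unfolding sm_def by (rule divisor_sum_bounded_summable[OF s]) (rule norm_refl_coeff, simp)
  have smE: "sm excess_coeff" and SE: "S excess_coeff = S x * S p"
    unfolding sm_def S_def excess_coeff_def x_def[symmetric] p_def[symmetric]
    using dirichlet_product[of x s p] smx smp unfolding sm_def by blast+
  have "S (\<lambda>n. \<Sum>d | d dvd n. i d * p (n div d)) = S i * S p"
    unfolding S_def using dirichlet_product(2)[of i s p] smi smp unfolding sm_def by blast
  moreover have "S (\<lambda>n. \<Sum>d | d dvd n. i d * p (n div d)) = riemann_zeta s * riemann_zeta (s - 1)"
    unfolding S_def divisor_sum_series(2)[OF s, symmetric]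
  proof (rule infsum_cong)
    fix n :: nat assume "n \<in> {1..}"
    then have "n > 0" by simp
    have "(\<Sum>d | d dvd n. i d * p (n div d)) = of_nat (\<Sum>{d. d dvd n})"
      unfolding card_subs_Ord[OF \<open>n > 0\<close>, symmetric] i_def p_def by simp
    then show "(\<Sum>d | d dvd n. i d * p (n div d)) * of_nat n powr (- s)
        = of_nat (\<Sum>{d. d dvd n}) * of_nat n powr (- s)" by (simp only:)
  qed
  ultimately have prod: "S i * S p = riemann_zeta s * riemann_zeta (s - 1)" by (simp only:)
  \<comment> \<open>\<open>S i\<close> is the Dedekind zeta function. Its nonvanishing, needed to
    solve for \<open>S p\<close>, is inherited from the product.\<close>
  have "riemann_zeta s \<noteq> 0" "riemann_zeta (s - 1) \<noteq> 0"
    using s by (auto intro!: riemann_zeta_nonzero)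
  then have "S i \<noteq> 0" using prod by auto
  then have Sp: "S p = riemann_zeta s * riemann_zeta (s - 1) / S i"
    using prod by (simp add: eq_divide_eq mult.commute)
  have lin: "sm (\<lambda>n. f n + g n)" "S (\<lambda>n. f n + g n) = S f + S g" if "sm f" "sm g" for f g
  proof -
    have f: "(\<lambda>n. f n * of_nat n powr (- s)) summable_on {1..}"
      and g: "(\<lambda>n. g n * of_nat n powr (- s)) summable_on {1..}"
      using that unfolding sm_def by (auto intro: abs_summable_summable)
    show "S (\<lambda>n. f n + g n) = S f + S g"
      unfolding S_def distrib_right by (rule infsum_add[OF f g])
    have "(\<lambda>n. norm (f n * (of_nat n :: complex) powr (- s)) + norm (g n * (of_nat n :: complex) powr (- s))) summable_on {1..}"
      using that unfolding sm_def by (rule summable_on_add)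
    then show "sm (\<lambda>n. f n + g n)"
      unfolding sm_def distrib_right
      by (rule Infinite_Sum.abs_summable_on_comparison_test') (rule norm_triangle_ineq)
  qed
  have scal: "sm (\<lambda>n. k * f n)" "S (\<lambda>n. k * f n) = k * S f" if "sm f" for f k
  proof -
    show "S (\<lambda>n. k * f n) = k * S f" unfolding S_def mult.assoc by (rule infsum_cmult_right')
    have "(\<lambda>n. norm k * norm (f n * (of_nat n :: complex) powr (- s))) summable_on {1..}"
      using that unfolding sm_def by (rule summable_on_cmult_right)
    then show "sm (\<lambda>n. k * f n)" unfolding sm_def mult.assoc norm_mult[of k] .
  qed
  have "zeta_GL L s = S (\<lambda>n. 1 / 2 * of_nat (num_classes O\<^sub>V\<^sup>+ L n) + 1 / 2 * excess_coeff n + refl_coeff n)"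
    unfolding zeta_GL_def S_def by (rule infsum_cong) (simp only: num_classes_split atLeast_iff One_nat_def Suc_le_eq)
  also have "\<dots> = 1 / 2 * S (\<lambda>n. of_nat (num_classes O\<^sub>V\<^sup>+ L n)) + 1 / 2 * S excess_coeff + S refl_coeff"
    by (simp only: lin scal smSL smE smR)
  also have "S (\<lambda>n. of_nat (num_classes O\<^sub>V\<^sup>+ L n)) = zeta_SL L s" unfolding S_def zeta_SL_def ..
  also have "S refl_coeff = zeta_Refl L s" unfolding S_def zeta_Refl_eq[OF s] ..
  also have "1 / 2 * S excess_coeff = riemann_zeta s * riemann_zeta (s - 1) / (2 * S i) * S x"
    unfolding SE Sp by simp
  also have "S i = dedekind_zeta F s" unfolding S_def i_def dedekind_zeta_eq[OF s] ..
  also have "S x = (\<Sum>\<^sub>\<infinity>n\<in>{1..}. of_nat (class_asym lideal n) * of_nat n powr (- s))"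
    unfolding S_def x_def ..
  finally show ?thesis .
qed

end

theorem theorem1p3:
  fixes L :: "'v::pos_def_quadratic_space set"
    and e1 e2 :: 'v
    and a b c D :: int
    and F I :: "complex set"
    and s :: complex
  assumes lattice: "binary_Z_lattice L"
    and D: "of_int D = -4 * lattice_det L"
    and F: "F = quadratic_field D"
    and disc: "is_discriminant D F"
    and basis: "Z_basis e1 e2 L"
    and form: "\<And>x y :: int. qform (of_int x *\<^sub>Q e1 + of_int y *\<^sub>Q e2)
                 = of_int (a * x\<^sup>2 + b * x * y + c * y\<^sup>2)"
    and a: "a > 0"
    and I: "I = {of_int m * of_int a + of_int n * ((of_int b - csqrt (of_int D)) / 2) | m n. True}"
    and s: "Re s > 2"
  shows "zeta_GL L s =
    (1 / 2 * zeta_SL L s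
     + riemann_zeta s * riemann_zeta (s - 1) / (2 * dedekind_zeta F s) *
       (\<Sum>\<^sub>\<infinity>n\<in>{1..}.
          of_nat (card
            ({C \<in> class_group F. \<exists>J. fractional_ideal F J \<and> J \<subseteq> I \<and> index I J = n \<and>
                C = ideal_class F J} -
             {C \<in> class_group F. \<exists>J. fractional_ideal F J \<and> J \<subseteq> I \<and> index I J = n \<and>
                C = ideal_class F (cnj ` J)}))
          / of_nat n powr s))
    + zeta_Refl L s"
proof -
  have det: "lattice_det L = of_int a * of_int c - of_int b / 2 * (of_int b / 2)"
    unfolding lattice_det_eq[OF basis] det_gram bform_of_form[OF form] ..
  have "rat_of_int D = of_int (b\<^sup>2 - 4 * (a * c))"
    unfolding D det by (simp add: power2_eq_square algebra_simps)
  then have D': "D = b\<^sup>2 - 4 * (a * c)" by (simp only: of_int_eq_iff)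
  have "lattice_det L > 0"
    unfolding lattice_det_eq[OF basis] by (rule det_gram_pos) (use basis in \<open>simp add: Z_basis_def\<close>)
  then have "rat_of_int D < 0" unfolding D by simp
  then have "D < 0" by simp
  then interpret iq: imaginary_quadratic b "a * c" D F by unfold_locales (use D' F in auto)
  interpret quadratic_order b "a * c" D F by (rule iq.quadratic_order_if_discriminant[OF disc])
  interpret quadratic_lattice a b c D F e1 e2 L
    by unfold_locales (use a basis form lattice in \<open>auto simp: binary_Z_lattice_def\<close>)
  have I: "I = lideal" unfolding I lideal_def Zlat_def iq.tau_def ..
  have "(\<Sum>\<^sub>\<infinity>n\<in>{1..}. of_nat (class_asym lideal n) * of_nat n powr (- s)) = (\<Sum>\<^sub>\<infinity>n\<in>{1..}.
      of_nat (card
        ({C \<in> class_group F. \<exists>J. fractional_ideal F J \<and> J \<subseteq> I \<and> index I J = n \<and> C = ideal_class F J} -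
         {C \<in> class_group F. \<exists>J. fractional_ideal F J \<and> J \<subseteq> I \<and> index I J = n \<and> C = ideal_class F (cnj ` J)}))
      / of_nat n powr s)"
    unfolding I
  proof (rule infsum_cong)
    fix n :: nat assume "n \<in> {1..}"
    then have "n \<ge> 1" by simp
    from class_asym_eq[OF this] show "of_nat (class_asym lideal n) * of_nat n powr (- s) = of_nat (card
        ({C \<in> class_group F. \<exists>J. fractional_ideal F J \<and> J \<subseteq> lideal \<and> index lideal J = n \<and> C = ideal_class F J} -
         {C \<in> class_group F. \<exists>J. fractional_ideal F J \<and> J \<subseteq> lideal \<and> index lideal J = n \<and> C = ideal_class F (cnj ` J)}))
      / of_nat n powr s"
      by (simp only: powr_minus_divide times_divide_eq_right mult_1_right)
  qed
  then show ?thesis using zeta_GL_eq[OF s] by (simp only:)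
qed

end
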